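(* Let $G$ be a spoke graph and let $\phi:\widehat{X_G}\to Y$ be the standard factor code on $G$, with $T_1$ the index set of regular spokes and $K_i$ ($i\in T_1$) the associated sets of residues (all as defined in the context). Then the following are equivalent: (1) there is a subset $W\subset T_1$ such that $\bigcup_{i\in W}K_i=\bigcup_{i\in T_1}K_i$ and the sets $\{K_i:i\in W\}$ are pairwise disjoint; (2) there is an irreducible shift of finite type $Z\subset\widehat{X_G}$ such that $\phi|_Z$ is almost invertible and onto $Y$; (3) there is an irreducible shift of finite type $Z\subset\widehat{X_G}$ such that $\phi|_Z$ is finite-to-one and onto $Y$.
   Context: Graphs are finite directed graphs without multiple edges; $|\gamma|$ is the number of edges of a path $\gamma$. The vertex shift $\widehat{X_G}$ is the set of all bi-infinite sequences of vertices of bi-infinite paths in $G$. Spoke graph: a (regular) spoke consists of a state $B$, a simple path $\gamma^+$ from $B$ to a state $B'\neq B$, a simple path $\gamma^-$ from $B'$ to $B$, and a simple cycle $C$ through $B'$, such that $\gamma^+,\gamma^-,C$ are disjoint except that all three share $B'$ and $\gamma^+,\gamma^-$ share $B$. A degenerate spoke is a simple cycle $C$ through $B$ (here $\gamma^+=\gamma^-=\emptyset$). A spoke graph $G$ consists of a central state $B$ and finitely many distinct spokes $U_i$, $i\in T$, any two of which intersect only at $B$. Write $\gamma_i^+,\gamma_i^-,B_i',C_i$ for the data of $U_i$; $T_0\subset T$ indexes the degenerate spokes and $T_1=T\setminus T_0$ the regular ones. Standard factor code: the 1-block code $\phi$ sending the symbol $B$ to $1$ and every other vertex to $0$; $Y:=\phi(\widehat{X_G})\subset\{0,1\}^{\mathbb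 Z}$. Let $d_i=|C_i|$ for $i\in T$. For $i\in T_1$ let $m_i=|\gamma_i^+|+|\gamma_i^-|-1$, $D=\mathrm{lcm}\{d_i:i\in T_1\}$ ($D=1$ if $T_1=\emptyset$), and $K_i=\{b\in\{0,1,\dots,D-1\}: b\equiv m_i \pmod{d_i}\}$. A shift space is irreducible if for all allowed blocks $u,v$ there is an allowed block $w$ with $uwv$ allowed. A shift of finite type (SFT) is a shift space defined by finitely many forbidden blocks; it is $M$-step if it can be defined by forbidden blocks of length $M+1$. A code is finite-to-one if the cardinalities of its fibers are uniformly bounded. Degree and almost invertibility: for a 1-block finite-to-one factor code $\phi:Z\to Y$ on an irreducible $M$-step SFT $Z$, put $N=\max\{1,M\}$; its degree is the minimum, over all allowed blocks $w=w_1\cdots w_{|w|}$ of $Y$ and all $1\le i\le |w|-N+1$, of the number of distinct $N$-blocks of $Z$ that appear beginning at coordinate $i$ among all blocks of $Z$ that are preimages of $w$. A factor code is almost invertible if its degree is $1$ (equivalently, on an irreducible SFT, it is finite-to-one with degree $1$, since almost invertible codes on irreducible SFTs are finite-to-one). *)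

theory Defs
  imports
    "Graph_Theory.Pair_Digraph"
    "HOL-Library.Disjoint_Sets"
    "HOL-Number_Theory.Cong"
begin

section \<open>Shift spaces and codes\<close>

text \<open>Points are maps from the integers to symbols; blocks are lists of symbols.\<close>

definition block_at :: "(int \<Rightarrow> 'a) \<Rightarrow> int \<Rightarrow> nat \<Rightarrow> 'a list" where
  "block_at x i n = map (\<lambda>k. x (i + int k)) [0..<n]"

definition allowed_blocks :: "(int \<Rightarrow> 'a) set \<Rightarrow> 'a list set" where
  "allowed_blocks X = {block_at x i n | x i n. x \<in> X}"

definition shift_avoiding :: "'a set \<Rightarrow> 'a list set \<Rightarrow> (int \<Rightarrow> 'a) set" where
  "shift_avoiding A F =
     {x. range x \<subseteq> A \<and> (\<forall>w\<in>F. \<forall>i. block_at x i (length w) \<noteq> w)}"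

definition SFT :: "'a set \<Rightarrow> (int \<Rightarrow> 'a) set \<Rightarrow> bool" where
  "SFT A X \<longleftrightarrow> (\<exists>F. finite F \<and> F \<subseteq> lists A \<and> X = shift_avoiding A F)"

definition step_SFT :: "'a set \<Rightarrow> nat \<Rightarrow> (int \<Rightarrow> 'a) set \<Rightarrow> bool" where
  "step_SFT A M X \<longleftrightarrow>
     (\<exists>F. finite F \<and> F \<subseteq> {w \<in> lists A. length w = M + 1} \<and> X = shift_avoiding A F)"

definition irreducible_shift :: "(int \<Rightarrow> 'a) set \<Rightarrow> bool" where
  "irreducible_shift X \<longleftrightarrow>
     (\<forall>u\<in>allowed_blocks X. \<forall>v\<in>allowed_blocks X. \<exists>w\<in>allowed_blocks X.
        u @ w @ v \<in> allowed_blocks X)"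

definition one_block_code :: "('a \<Rightarrow> 'b) \<Rightarrow> (int \<Rightarrow> 'a) \<Rightarrow> (int \<Rightarrow> 'b)" where
  "one_block_code \<Phi> x = (\<lambda>i. \<Phi> (x i))"

definition finite_to_one_on :: "('x \<Rightarrow> 'y) \<Rightarrow> 'x set \<Rightarrow> bool" where
  "finite_to_one_on f Z \<longleftrightarrow>
     (\<exists>K::nat. \<forall>y\<in>f ` Z. finite {z \<in> Z. f z = y} \<and> card {z \<in> Z. f z = y} \<le> K)"

text \<open>
  Coordinates of a block are counted from 0, so the range of positions is
  \<open>i + N \<le> length w\<close>.  The infimum in the naturals is attained whenever \<open>Z\<close> is nonempty.
\<close>

definition code_degree :: "nat \<Rightarrow> ('a \<Rightarrow> 'b) \<Rightarrow> (int \<Rightarrow> 'a) set \<Rightarrow> nat" where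
  "code_degree M \<Phi> Z =
     (let N = max 1 M in
      Inf {card {take N (drop i u) | u. u \<in> allowed_blocks Z \<and> map \<Phi> u = w} | w i.
             w \<in> allowed_blocks (one_block_code \<Phi> ` Z) \<and> i + N \<le> length w})"

text \<open>
  The degree is only meaningful for finite-to-one codes: the formula of \<^const>\<open>code_degree\<close>
  may also evaluate to 1 on codes that are not finite-to-one.  For a finite-to-one code on an
  irreducible shift of finite type it does not depend on the choice of the step \<open>M\<close>.
\<close>

definition almost_invertible_on :: "'a set \<Rightarrow> ('a \<Rightarrow> 'b) \<Rightarrow> (int \<Rightarrow> 'a) set \<Rightarrow> bool" where
  "almost_invertible_on A \<Phi> Z \<longleftrightarrow>
     finite_to_one_on (one_block_code \<Phi>) Z \<and>
     (\<exists>M. step_SFT A M Z \<and> code_degree M \<Phi> Z = 1)"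

definition vertex_shift :: "'v pair_pre_digraph \<Rightarrow> (int \<Rightarrow> 'v) set" where
  "vertex_shift G = {x. \<forall>i. (x i, x (i + 1)) \<in> parcs G}"

section \<open>Spoke graphs\<close>

text \<open>
  The fields are \<open>\<gamma>\<^sup>+\<close>, \<open>\<gamma>\<^sup>-\<close>, \<open>B'\<close> and \<open>C\<close>.  Walks are lists of arcs, so \<^const>\<open>length\<close> counts edges.
  The cycle \<open>C\<close> is listed starting from \<open>B'\<close>.  Degenerate spokes have \<open>B' = B\<close> and empty paths.
\<close>

record 'v spoke =
  out_path :: "('v \<times> 'v) awalk"
  in_path :: "('v \<times> 'v) awalk"
  rim :: 'v
  circuit :: "('v \<times> 'v) awalk"

definition regular_spoke :: "'v pair_pre_digraph \<Rightarrow> 'v \<Rightarrow> 'v spoke \<Rightarrow> bool" where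
  "regular_spoke G B S \<longleftrightarrow>
     rim S \<noteq> B \<and>
     pre_digraph.apath (with_proj G) B (out_path S) (rim S) \<and>
     pre_digraph.apath (with_proj G) (rim S) (in_path S) B \<and>
     pre_digraph.cycle (with_proj G) (circuit S) \<and>
     pre_digraph.awalk (with_proj G) (rim S) (circuit S) (rim S) \<and>
     set (pawalk_verts B (out_path S)) \<inter> set (pawalk_verts (rim S) (in_path S)) = {B, rim S} \<and>
     set (pawalk_verts B (out_path S)) \<inter> set (pawalk_verts (rim S) (circuit S)) = {rim S} \<and>
     set (pawalk_verts (rim S) (in_path S)) \<inter> set (pawalk_verts (rim S) (circuit S)) = {rim S}"

definition degenerate_spoke :: "'v pair_pre_digraph \<Rightarrow> 'v \<Rightarrow> 'v spoke \<Rightarrow> bool" where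
  "degenerate_spoke G B S \<longleftrightarrow>
     rim S = B \<and> out_path S = [] \<and> in_path S = [] \<and>
     pre_digraph.cycle (with_proj G) (circuit S) \<and>
     pre_digraph.awalk (with_proj G) B (circuit S) B"

definition spoke_verts :: "'v \<Rightarrow> 'v spoke \<Rightarrow> 'v set" where
  "spoke_verts B S =
     set (pawalk_verts B (out_path S)) \<union> set (pawalk_verts (rim S) (in_path S)) \<union>
     set (pawalk_verts (rim S) (circuit S))"

definition spoke_arcs :: "'v spoke \<Rightarrow> ('v \<times> 'v) set" where
  "spoke_arcs S = set (out_path S) \<union> set (in_path S) \<union> set (circuit S)"

text \<open>
  At least one spoke is required: without spokes the vertex shift is empty, and the degree of
  the factor code would be a minimum over the empty set.
\<close>

definition spoke_graph ::
    "'v pair_pre_digraph \<Rightarrow> 'v \<Rightarrow> 'i set \<Rightarrow> ('i \<Rightarrow> 'v spoke) \<Rightarrow> bool" where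
  "spoke_graph G B T U \<longleftrightarrow>
     pair_fin_digraph G \<and> finite T \<and> T \<noteq> {} \<and> inj_on U T \<and>
     (\<forall>i\<in>T. regular_spoke G B (U i) \<or> degenerate_spoke G B (U i)) \<and>
     (\<forall>i\<in>T. \<forall>j\<in>T. i \<noteq> j \<longrightarrow> spoke_verts B (U i) \<inter> spoke_verts B (U j) = {B}) \<and>
     pverts G = (\<Union>i\<in>T. spoke_verts B (U i)) \<and>
     parcs G = (\<Union>i\<in>T. spoke_arcs (U i))"

definition regular_indices ::
    "'v pair_pre_digraph \<Rightarrow> 'v \<Rightarrow> 'i set \<Rightarrow> ('i \<Rightarrow> 'v spoke) \<Rightarrow> 'i set" where
  "regular_indices G B T U = {i \<in> T. regular_spoke G B (U i)}"

definition spoke_period :: "'v spoke \<Rightarrow> nat" where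
  "spoke_period S = length (circuit S)"

definition spoke_offset :: "'v spoke \<Rightarrow> nat" where
  "spoke_offset S = length (out_path S) + length (in_path S) - 1"

text \<open>The least common multiple of the empty set is 1.\<close>

definition common_period :: "'i set \<Rightarrow> ('i \<Rightarrow> 'v spoke) \<Rightarrow> nat" where
  "common_period T1 U = Lcm ((\<lambda>i. spoke_period (U i)) ` T1)"

definition residue_set :: "'i set \<Rightarrow> ('i \<Rightarrow> 'v spoke) \<Rightarrow> 'i \<Rightarrow> nat set" where
  "residue_set T1 U i =
     {b \<in> {0..<common_period T1 U}. [b = spoke_offset (U i)] (mod spoke_period (U i))}"

definition standard_symbol :: "'v \<Rightarrow> 'v \<Rightarrow> nat" where
  "standard_symbol B v = (if v = B then 1 else 0)"

definition standard_image :: "'v pair_pre_digraph \<Rightarrow> 'v \<Rightarrow> (int \<Rightarrow> nat) set" where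
  "standard_image G B = one_block_code (standard_symbol B) ` vertex_shift G"

end

theory Submission
  imports Defs
begin

text \<open>
  The symbol 1 is synchronizing: a point of \<open>Y\<close> is a concatenation of first returns to \<open>B\<close>, and a
  regular spoke \<open>i\<close> offers the gaps \<open>m\<^sub>i + k d\<^sub>i\<close>.  Everything reduces to the existence of a set \<open>W\<close>
  of regular spokes such that every long gap length is offered by exactly one member of \<open>W\<close>.

  Given \<open>W\<close>, choose for each gap length one spoke, the one in \<open>W\<close> if the gap is long.  The points of
  the vertex shift that follow this choice form a subshift of finite type, because long gaps are
  recognized by a stay in some \<open>C\<^sub>i\<close> with \<open>i \<in> W\<close>; a stretch between two visits to \<open>B\<close> is then
  determined by its image, so the degree is 1.

  Conversely let \<open>Z\<close> be finite-to-one and onto.  Take a word of \<open>Y\<close> that begins and ends with 1 and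
  has the least number of \<open>N\<close>-blocks over one of its positions.  By minimality all these blocks
  survive when the word is repeated with gaps in between, and if one of them had two continuations
  across a gap, then the number of paths would grow without bound.  So, for a fixed block \<open>a\<close>,
  the spoke that is used after \<open>a\<close> in a gap of length \<open>n\<close> is determined by \<open>n\<close>.  Since turns around
  \<open>C\<^sub>i\<close> can be inserted, the spokes used after \<open>a\<close> in long gaps form the required \<open>W\<close>.
\<close>

section \<open>Gluing and translating points\<close>

text \<open>The implications run (3) to (1) to (2) to (3), with (1) in the form
  \<open>splits\<close>. Beyond some length, spoke \<open>i\<close> offers a gap of length
  \<open>n\<close> exactly when \<open>n mod D\<close> lies in \<open>K_i\<close>, so "exactly one
  spoke of \<open>W\<close> for every long gap" says that the \<open>K_i\<close> with
  \<open>i\<close> in \<open>W\<close> partition the union of all of them.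

  Return times do not describe every point: a point may visit \<open>B\<close> finitely often or
  never, and then it runs around some \<open>C_i\<close> for ever. Such tails have no gap length, so
  membership in \<open>W\<close> is imposed by a rule that speaks about tails as well: any
  \<open>L\<close> consecutive vertices other than \<open>B\<close> belong to spokes of
  \<open>W\<close>.

  Conversely, a finite-to-one \<open>Z\<close> may use different spokes for the same gap in
  different contexts, which is why a set \<open>W\<close> can be read off only after the context is
  fixed by a block \<open>a\<close>. The fibre bound concerns bi-infinite points, the growth
  argument finite paths; prescribing the \<open>N\<close>-blocks at both ends of a path turns one
  count into the other at the cost of a constant factor.

  Statements about the past of a walk are obtained from those about its future in the reversed
  graph.\<close>

definition glue :: "int \<Rightarrow> (int \<Rightarrow> 'a) \<Rightarrow> (int \<Rightarrow> 'a) \<Rightarrow> int \<Rightarrow> 'a" where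
  "glue p x y = (\<lambda>t. if t < p then x t else y t)"

definition translate :: "int \<Rightarrow> (int \<Rightarrow> 'a) \<Rightarrow> int \<Rightarrow> 'a" where
  "translate k x = (\<lambda>t. x (t + k))"

lemma block_at_eq_iff:
  "block_at x i n = block_at y j n \<longleftrightarrow> (\<forall>k<n. x (i + int k) = y (j + int k))"
  by (auto simp: block_at_def)

lemma length_block_at [simp]: "length (block_at x i n) = n"
  by (simp add: block_at_def)

lemma take_block_at: "m \<le> n \<Longrightarrow> take m (block_at x i n) = block_at x i m"
  by (auto simp: block_at_def take_map)

lemma drop_block_at: "drop m (block_at x i n) = block_at x (i + int m) (n - m)"
  by (rule nth_equalityI) (auto simp: block_at_def algebra_simps)

lemma map_block_at: "map f (block_at x i n) = block_at (one_block_code f x) i n"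
  by (simp add: block_at_def one_block_code_def)

lemma block_at_append: "block_at x i m @ block_at x (i + int m) n = block_at x i (m + n)"
  by (rule nth_equalityI) (auto simp: block_at_def nth_append algebra_simps)

lemma shift_avoiding_translate:
  assumes "x \<in> shift_avoiding A F"
  shows "translate k x \<in> shift_avoiding A F"
proof -
  have "block_at (translate k x) i n = block_at x (i + k) n" for i n
    by (auto simp: block_at_def translate_def algebra_simps)
  with assms show ?thesis by (auto simp: shift_avoiding_def translate_def)
qed

lemma SFT_translate: "SFT A Z \<Longrightarrow> x \<in> Z \<Longrightarrow> translate k x \<in> Z"
  unfolding SFT_def using shift_avoiding_translate by blast

lemma SFT_range: "SFT A Z \<Longrightarrow> x \<in> Z \<Longrightarrow> x t \<in> A"
  unfolding SFT_def shift_avoiding_def by auto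

text \<open>Here \<open>N\<close> bounds the lengths of the forbidden words. An occurrence that
  starts before \<open>p\<close> ends before \<open>p + N\<close>, where the glued point still
  agrees with \<open>x\<close>; one that starts at or after \<open>p\<close> sees only
  \<open>y\<close>.\<close>

lemma SFT_glue:
  assumes "SFT A Z"
  obtains N :: nat where
    "\<And>x y p. x \<in> Z \<Longrightarrow> y \<in> Z \<Longrightarrow> (\<And>t. p \<le> t \<Longrightarrow> t < p + int N \<Longrightarrow> x t = y t) \<Longrightarrow> glue p x y \<in> Z"
proof -
  from assms obtain F where F: "finite F" "Z = shift_avoiding A F" by (auto simp: SFT_def)
  obtain N where N: "\<And>w. w \<in> F \<Longrightarrow> length w \<le> N"
    using F(1) by (meson finite_imageI finite_nat_set_iff_bounded_le imageI)
  show thesis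
  proof (rule that[of N])
    fix x y p assume xy: "x \<in> Z" "y \<in> Z" and eq: "\<And>t. p \<le> t \<Longrightarrow> t < p + int N \<Longrightarrow> x t = y t"
    have "block_at (glue p x y) i (length w) \<noteq> w" if w: "w \<in> F" for w i
    proof -
      have "block_at (glue p x y) i (length w) = block_at x i (length w)
        \<or> block_at (glue p x y) i (length w) = block_at y i (length w)"
      proof (cases "i < p")
        case True
        then have "block_at (glue p x y) i (length w) = block_at x i (length w)"
          using N[OF w] eq by (auto simp: block_at_eq_iff glue_def)
        then show ?thesis ..
      next
        case False
        then have "block_at (glue p x y) i (length w) = block_at y i (length w)"
          by (auto simp: block_at_eq_iff glue_def)
        then show ?thesis ..
      qed
      then show ?thesis using xy w F(2) by (auto simp: shift_avoiding_def)
    qed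
    moreover have "range (glue p x y) \<subseteq> A"
      using xy F(2) by (auto simp: shift_avoiding_def glue_def)
    ultimately show "glue p x y \<in> Z" using F(2) by (auto simp: shift_avoiding_def)
  qed
qed

section \<open>Words with the least number of states\<close>

text \<open>The assumption \<open>sync\<close> is about images: they may be concatenated at an
  occurrence of \<open>s\<close>, although \<open>Z\<close> itself is only closed under gluing along
  \<open>N\<close> common symbols. The lift of the concatenation need not agree with
  \<open>x\<close> or \<open>y\<close> anywhere.\<close>

locale sync_code =
  fixes A :: "'a set" and Z :: "(int \<Rightarrow> 'a) set" and f :: "'a \<Rightarrow> 'b" and s :: 'b and N K :: nat
  assumes finite_A: "finite A"
    and range_Z: "z \<in> Z \<Longrightarrow> z t \<in> A"
    and translate_Z: "z \<in> Z \<Longrightarrow> translate k z \<in> Z"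
    and glue_Z: "x \<in> Z \<Longrightarrow> y \<in> Z \<Longrightarrow> (\<And>t. p \<le> t \<Longrightarrow> t < p + int N \<Longrightarrow> x t = y t) \<Longrightarrow> glue p x y \<in> Z"
    and finite_fiber: "z \<in> Z \<Longrightarrow> finite {z' \<in> Z. \<forall>t. f (z' t) = f (z t)}"
    and card_fiber: "z \<in> Z \<Longrightarrow> card {z' \<in> Z. \<forall>t. f (z' t) = f (z t)} \<le> K"
    and sync: "x \<in> Z \<Longrightarrow> y \<in> Z \<Longrightarrow> f (x p) = s \<Longrightarrow> f (y p) = s \<Longrightarrow>
      \<exists>z\<in>Z. \<forall>t. f (z t) = f (glue p x y t)"
begin

text \<open>The least cardinality of such a set takes over the role of the degree. Only the image on
  the window is prescribed; the \<open>N\<close>-block starts at coordinate 0 and may reach beyond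
  \<open>v\<close>.\<close>

definition states :: "(int \<Rightarrow> 'b) \<Rightarrow> nat \<Rightarrow> nat \<Rightarrow> 'a list set" where
  "states y u v = {block_at z 0 N | z. z \<in> Z \<and> (\<forall>t. - int u \<le> t \<and> t \<le> int v \<longrightarrow> f (z t) = y t)}"

definition window :: "(int \<Rightarrow> 'b) \<Rightarrow> nat \<Rightarrow> nat \<Rightarrow> bool" where
  "window y u v \<longleftrightarrow> y (- int u) = s \<and> y (int v) = s \<and>
     (\<exists>z\<in>Z. \<forall>t. - int u \<le> t \<and> t \<le> int v \<longrightarrow> f (z t) = y t)"

lemma set_block_at: "z \<in> Z \<Longrightarrow> set (block_at z i n) \<subseteq> A"
  using range_Z by (auto simp: block_at_def)

lemma finite_blocks: "finite {w. set w \<subseteq> A \<and> length w = n}"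
  using finite_A by (rule finite_lists_length_eq)

lemma finite_states: "finite (states y u v)"
  by (rule finite_subset[OF _ finite_blocks[of N]]) (use set_block_at in \<open>auto simp: states_def\<close>)

lemma minimal_window:
  assumes "z \<in> Z" "f (z 0) = s"
  obtains y u v where "window y u v"
    "\<And>y' u' v'. window y' u' v' \<Longrightarrow> card (states y u v) \<le> card (states y' u' v')"
proof -
  let ?P = "\<lambda>(y, u, v). window y u v"
  have "?P (\<lambda>t. f (z t), 0, 0)" using assms by (auto simp: window_def)
  from ex_has_least_nat[of ?P, OF this, of "\<lambda>(y, u, v). card (states y u v)"]
  show thesis using that by auto
qed

text \<open>The middle of one path can be exchanged for that of any other with the same end blocks,
  since the common \<open>N\<close>-blocks allow gluing at both ends. The image does not change, so
  different paths give different points of a single fibre.\<close>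

lemma card_connecting:
  assumes n: "N \<le> n"
  shows "finite {block_at z 0 n | z. z \<in> Z \<and> (\<forall>k<n. f (z (int k)) = y (int k)) \<and>
           block_at z 0 N = a \<and> block_at z (int (n - N)) N = b} \<and>
         card {block_at z 0 n | z. z \<in> Z \<and> (\<forall>k<n. f (z (int k)) = y (int k)) \<and>
           block_at z 0 N = a \<and> block_at z (int (n - N)) N = b} \<le> K"
    (is "finite ?Q \<and> card ?Q \<le> K")
proof (cases "?Q = {}")
  case False
  then obtain z0 where z0: "z0 \<in> Z" "\<forall>k<n. f (z0 (int k)) = y (int k)"
    "block_at z0 0 N = a" "block_at z0 (int (n - N)) N = b" by auto
  let ?F = "{z' \<in> Z. \<forall>t. f (z' t) = f (z0 t)}"
  have "?Q \<subseteq> (\<lambda>z. block_at z 0 n) ` ?F"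
  proof
    fix w assume "w \<in> ?Q"
    then obtain z where z: "z \<in> Z" "\<forall>k<n. f (z (int k)) = y (int k)"
      "block_at z 0 N = a" "block_at z (int (n - N)) N = b" "w = block_at z 0 n" by auto
    have "glue 0 z0 z \<in> Z"
    proof (rule glue_Z[OF z0(1) z(1)])
      fix t :: int assume "0 \<le> t" "t < 0 + int N"
      then show "z0 t = z t" using z0(3) z(3) by (auto simp: block_at_eq_iff dest!: spec[of _ "nat t"])
    qed
    then have "glue (int (n - N)) (glue 0 z0 z) z0 \<in> Z" (is "?z \<in> Z")
    proof (rule glue_Z[OF _ z0(1)])
      fix t :: int assume t: "int (n - N) \<le> t" "t < int (n - N) + int N"
      then have "0 \<le> t" by linarith
      moreover have "block_at z (int (n - N)) N = block_at z0 (int (n - N)) N" using z0(4) z(4) by simp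
      then have "z t = z0 t" using t by (auto simp: block_at_eq_iff dest!: spec[of _ "nat (t - int (n - N))"])
      ultimately show "glue 0 z0 z t = z0 t" by (simp add: glue_def)
    qed
    \<comment> \<open>The second gluing returns to \<open>z0\<close> already at
      \<open>n - N\<close>, but \<open>z\<close> and \<open>z0\<close> coincide on the last
      \<open>N\<close> positions, so the glued point follows \<open>z\<close> on the whole
      segment.\<close>
    moreover have z': "?z t = (if 0 \<le> t \<and> t < int n then z t else z0 t)" for t
    proof (cases "int (n - N) \<le> t \<and> t < int n")
      case True
      have "block_at z (int (n - N)) N = block_at z0 (int (n - N)) N" using z0(4) z(4) by simp
      then have "z t = z0 t" using True n by (auto simp: block_at_eq_iff dest!: spec[of _ "nat (t - int (n - N))"])
      then show ?thesis by (simp add: glue_def)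
    qed (auto simp: glue_def)
    moreover have "\<forall>t. f (?z t) = f (z0 t)"
    proof
      fix t show "f (?z t) = f (z0 t)"
        using z(2) z0(2) unfolding z' by (auto dest!: spec[of _ "nat t"])
    qed
    ultimately have "?z \<in> ?F" by simp
    moreover have "w = block_at ?z 0 n" unfolding z(5) block_at_eq_iff z' by simp
    ultimately show "w \<in> (\<lambda>z. block_at z 0 n) ` ?F" by blast
  qed
  then show ?thesis using finite_fiber[OF z0(1)] card_fiber[OF z0(1)]
    by (meson card_image_le card_mono finite_imageI finite_subset order_trans)
next
  case True
  show ?thesis unfolding True by simp
qed

end

section \<open>The periodic repetition of a minimal word\<close>

locale magic_loop = sync_code +
  fixes y :: "int \<Rightarrow> 'b" and u v :: nat and w :: "int \<Rightarrow> 'a" and m :: nat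
  assumes win: "window y u v"
    and minimal: "window y' u' v' \<Longrightarrow> card (states y u v) \<le> card (states y' u' v')"
    and w: "w \<in> Z" "f (w 0) = s" "f (w (int m)) = s" "0 < m"
begin

definition len :: nat where "len = u + v + m"

text \<open>Copies of the minimal window alternate with a filler of length \<open>m\<close> taken
  from the image of \<open>w\<close>; \<open>m\<close> is left free because it later runs through
  the gap lengths. The number \<open>r\<close> is the representative of \<open>t\<close> modulo
  \<open>len\<close> in \<open>{-u..<v + m}\<close>. Window and filler overlap only in symbols
  \<open>s\<close>.\<close>

definition per :: "int \<Rightarrow> 'b" where
  "per t = (let r = (t + int u) mod int len - int u in if r \<le> int v then y r else f (w (r - int v)))"

lemma per_add: "per (t + int k * int len) = per t"
proof -
  have "(t + int k * int len + int u) mod int len = (t + int u + int k * int len) mod int len"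
    by (simp add: ac_simps)
  then show ?thesis by (simp add: per_def)
qed

lemma per_window: "- int u \<le> t \<Longrightarrow> t \<le> int v \<Longrightarrow> per t = y t"
  using w(4) by (simp add: per_def len_def)

lemma per_loop:
  assumes "int v \<le> t" "t \<le> int v + int m"
  shows "per t = f (w (t - int v))"
proof -
  have y: "y (int v) = s" "y (- int u) = s" using win by (auto simp: window_def)
  consider "t = int v" | "int v < t" "t < int v + int m" | "t = int v + int m" using assms by linarith
  then show ?thesis
  proof cases
    case 1
    then show ?thesis using y w per_window[of t] by simp
  next
    case 2
    then show ?thesis by (simp add: per_def len_def)
  next
    case 3
    then have "t = - int u + int 1 * int len" by (simp add: len_def)
    then have "per t = per (- int u)" by (simp only: per_add)
    then show ?thesis using 3 y w per_window[of "- int u"] by simp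
  qed
qed

lemma per_loop': "int k * int len + int v \<le> t \<Longrightarrow> t \<le> int k * int len + int v + int m \<Longrightarrow>
    per t = f (w (t - (int k * int len + int v)))"
  using per_add[of "t - int k * int len" k] per_loop[of "t - int k * int len"]
  by (simp add: algebra_simps)

lemma per_window': "int k * int len - int u \<le> t \<Longrightarrow> t \<le> int k * int len + int v \<Longrightarrow>
    per t = y (t - int k * int len)"
  using per_add[of "t - int k * int len" k] per_window[of "t - int k * int len"]
  by (simp add: algebra_simps)

text \<open>A period is appended by two concatenations at an \<open>s\<close>, first the filler and
  then the window. Each of them replaces the lift by a new one, so only the image is
  controlled.\<close>

lemma window_per: "window per u (k * len + v)"
proof (induction k)
  case 0
  show ?case using win per_window unfolding window_def by auto
next
  case (Suc k)
  let ?a = "int k * int len + int v" and ?b = "int (Suc k) * int len - int u"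
  define c where "c = int (Suc k) * int len"
  have ab: "?b = ?a + int m" by (simp add: len_def algebra_simps)
  from Suc obtain z where z: "z \<in> Z" "\<forall>t. - int u \<le> t \<and> t \<le> ?a \<longrightarrow> f (z t) = per t"
    by (auto simp: window_def)
  have "per ?a = f (w (?a - ?a))" by (rule per_loop') auto
  moreover have "per ?b = f (w (?b - ?a))" unfolding ab by (rule per_loop') simp_all
  moreover have "?b - ?a = int m" using ab by simp
  ultimately have s: "per ?a = s" "per ?b = s" using w by simp_all
  from win obtain z0 where z0: "z0 \<in> Z" "\<forall>t. - int u \<le> t \<and> t \<le> int v \<longrightarrow> f (z0 t) = y t"
    by (auto simp: window_def)
  have "- int u \<le> ?a" using of_nat_0_le_iff[of "k * len", where ?'a = int] unfolding of_nat_mult by linarith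
  then have "f (z ?a) = s" using z(2) s by simp
  moreover have "f (translate (- ?a) w ?a) = s" using w by (simp add: translate_def)
  ultimately obtain z1 where z1: "z1 \<in> Z" "\<forall>t. f (z1 t) = f (glue ?a z (translate (- ?a) w) t)"
    using sync[OF z(1) translate_Z[OF w(1)]] by metis
  have "f (z1 ?b) = s" unfolding ab using z1(2) w by (simp add: glue_def translate_def)
  moreover have "f (translate (- c) z0 ?b) = s"
  proof -
    have "?b + - c = - int u" unfolding c_def by linarith
    then have "translate (- c) z0 ?b = z0 (- int u)"
      unfolding translate_def by (simp only:)
    then show ?thesis using z0(2) win by (simp add: window_def)
  qed
  ultimately obtain z2 where z2: "z2 \<in> Z"
    "\<forall>t. f (z2 t) = f (glue ?b z1 (translate (- c) z0) t)"
    using sync[OF z1(1) translate_Z[OF z0(1)]] by metis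
  have "f (z2 t) = per t" if t: "- int u \<le> t" "t \<le> int (Suc k * len + v)" for t
  proof -
    consider "t < ?a" | "?a \<le> t" "t < ?b" | "?b \<le> t" by linarith
    then show ?thesis
    proof cases
      case 1
      then show ?thesis using t z z1 z2 ab by (simp add: glue_def)
    next
      case 2
      then have "f (z2 t) = f (w (t + - ?a))" using z1(2) z2(2) by (simp add: glue_def translate_def)
      moreover have "t + - ?a = t - ?a" by (rule add_uminus_conv_diff)
      moreover have "per t = f (w (t - ?a))" by (rule per_loop') (use 2 ab in linarith)+
      ultimately show ?thesis by (simp only:)
    next
      case 3
      have "t \<le> int (Suc k) * int len + int v" using t(2) by (simp only: of_nat_mult of_nat_add)
      moreover have "f (z2 t) = f (z0 (t - int (Suc k) * int len))"
        unfolding c_def[symmetric] using z2 3 by (simp add: glue_def translate_def)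
      ultimately show ?thesis
        using z0(2) 3 per_window'[of "Suc k" t] by simp
    qed
  qed
  moreover have "per (- int u) = s" "per (int (Suc k * len + v)) = s"
  proof -
    show "per (- int u) = s" using per_window[of "- int u"] win by (simp add: window_def)
    have "per (int v + int (Suc k) * int len) = s"
      unfolding per_add using per_window[of "int v"] win by (simp add: window_def)
    then show "per (int (Suc k * len + v)) = s" by (simp only: of_nat_add of_nat_mult add.commute)
  qed
  ultimately show ?case using z2(1) by (auto simp: window_def)
qed

text \<open>A longer window can only lose states, and minimality forbids losing any.\<close>

lemma states_extend:
  assumes "window y' u' v'" "u \<le> u'" "v \<le> v'" "\<And>t. - int u \<le> t \<Longrightarrow> t \<le> int v \<Longrightarrow> y' t = y t"
  shows "states y' u' v' = states y u v"
proof (rule card_subset_eq[OF finite_states])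
  show sub: "states y' u' v' \<subseteq> states y u v"
    using assms(2-4) unfolding states_def by fastforce
  show "card (states y' u' v') = card (states y u v)"
    using minimal[OF assms(1)] card_mono[OF finite_states sub] by simp
qed

lemma states_left: "states per u (k * len + v) = states y u v"
  by (rule states_extend[OF window_per]) (auto simp: per_window)

text \<open>With the origin moved to the last copy of the window, the repeated word extends the
  window to the left. Hence every state is reached after \<open>k\<close> periods, just as by
  \<open>states_left\<close> every state can be continued for \<open>k\<close> periods.\<close>

lemma states_right: "states (translate (int (k * len)) per) (k * len + u) v = states y u v"
proof (rule states_extend)
  from window_per[of k] obtain z where z: "z \<in> Z"
    "\<forall>t. - int u \<le> t \<and> t \<le> int (k * len + v) \<longrightarrow> f (z t) = per t"
    "per (- int u) = s" "per (int (k * len + v)) = s"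
    unfolding window_def by metis
  have "\<forall>t. - int (k * len + u) \<le> t \<and> t \<le> int v \<longrightarrow>
      f (translate (int (k * len)) z t) = translate (int (k * len)) per t"
    using z(2) by (auto simp: translate_def)
  moreover have "translate (int (k * len)) per (- int (k * len + u)) = s"
    "translate (int (k * len)) per (int v) = s"
    using z(3,4) by (simp_all add: translate_def algebra_simps)
  ultimately show "window (translate (int (k * len)) per) (k * len + u) v"
    unfolding window_def using translate_Z[OF z(1)] by blast
next
  fix t :: int assume "- int u \<le> t" "t \<le> int v"
  then show "translate (int (k * len)) per t = y t"
    using per_add[of t k] per_window by (simp add: translate_def)
qed auto

section \<open>Counting the paths over the repeated word\<close>

definition over :: "nat \<Rightarrow> (int \<Rightarrow> 'a) \<Rightarrow> bool" where
  "over k z \<longleftrightarrow> z \<in> Z \<and> (\<forall>t. - int u \<le> t \<and> t \<le> int (k * len + v) \<longrightarrow> f (z t) = per t)"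

definition paths :: "nat \<Rightarrow> 'a list set" where
  "paths k = {block_at z 0 (k * len + N) | z. over k z}"

lemma finite_paths: "finite (paths k)"
  by (rule finite_subset[OF _ finite_blocks[of "k * len + N"]])
    (use set_block_at in \<open>auto simp: paths_def over_def\<close>)

lemma nth_block_at_diff:
  "c \<le> j \<Longrightarrow> j < c + n \<Longrightarrow> block_at z (int c) n ! nat (int j - int c) = z (int j)"
proof -
  assume "c \<le> j" "j < c + n"
  then have "nat (int j - int c) = j - c" "j - c < n" "int c + int (j - c) = int j" by linarith+
  then show ?thesis by (simp add: block_at_def)
qed

lemma card_paths: "card (paths k) \<le> (card {a. set a \<subseteq> A \<and> length a = N})\<^sup>2 * K"
proof -
  let ?S = "{a. set a \<subseteq> A \<and> length a = N}" and ?n = "k * len + N"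
  \<comment> \<open>\<open>over\<close> prescribes the image only up to \<open>k * len + v\<close>,
    and a path has \<open>N\<close> symbols from \<open>k * len\<close> on. On these the image is
    read off from the prescribed last block \<open>b\<close>.\<close>
  let ?y = "\<lambda>b t. if t < int (k * len) then per t else f (b ! nat (t - int (k * len)))"
  let ?C = "\<lambda>a b. {block_at z 0 ?n | z. z \<in> Z \<and> (\<forall>j<?n. f (z (int j)) = ?y b (int j)) \<and>
           block_at z 0 N = a \<and> block_at z (int (?n - N)) N = b}"
  have "paths k \<subseteq> (\<Union>ab\<in>?S \<times> ?S. ?C (fst ab) (snd ab))"
  proof
    fix x assume "x \<in> paths k"
    then obtain z where z: "over k z" "x = block_at z 0 ?n" by (auto simp: paths_def)
    then have zZ: "z \<in> Z" by (simp add: over_def)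
    have *: "f (z (int j)) = ?y (block_at z (int (k * len)) N) (int j)" if "j < ?n" for j
    proof (cases "j < k * len")
      case True
      then have less: "int j < int (k * len)" by (rule iffD2[OF of_nat_less_iff])
      then have "f (z (int j)) = per (int j)" using z(1) unfolding over_def by simp
      with less show ?thesis by (simp only: if_True)
    next
      case False
      then have "\<not> int j < int (k * len)" by (simp only: of_nat_less_iff not_False_eq_True)
      moreover have "block_at z (int (k * len)) N ! nat (int j - int (k * len)) = z (int j)"
        by (rule nth_block_at_diff) (use False that in linarith)+
      ultimately show ?thesis by (simp only: if_False)
    qed
    then have *: "\<forall>j<?n. f (z (int j)) = ?y (block_at z (int (k * len)) N) (int j)" by blast
    have "x \<in> ?C (block_at z 0 N) (block_at z (int (k * len)) N)"
      unfolding mem_Collect_eq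
      by (rule exI[of _ z]) (use z(2) zZ * in \<open>simp only: add_diff_cancel_right' simp_thms\<close>)
    moreover have "(block_at z 0 N, block_at z (int (k * len)) N) \<in> ?S \<times> ?S"
      using set_block_at[OF zZ] by auto
    ultimately show "x \<in> (\<Union>ab\<in>?S \<times> ?S. ?C (fst ab) (snd ab))"
      by (intro UN_I[of "(block_at z 0 N, block_at z (int (k * len)) N)"]) (simp_all only: fst_conv snd_conv)
  qed
  moreover have fin: "finite (?S \<times> ?S)" using finite_blocks by simp
  moreover have C: "finite (?C a b) \<and> card (?C a b) \<le> K" for a b by (rule card_connecting) simp
  ultimately have "card (paths k) \<le> card (\<Union>ab\<in>?S \<times> ?S. ?C (fst ab) (snd ab))"
    by (intro card_mono finite_UN_I) blast+
  also have "\<dots> \<le> (\<Sum>ab\<in>?S \<times> ?S. card (?C (fst ab) (snd ab)))" by (rule card_UN_le[OF fin])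
  also have "\<dots> \<le> (\<Sum>ab\<in>?S \<times> ?S. K)" by (rule sum_mono) (use C in blast)
  also have "\<dots> = (card ?S)\<^sup>2 * K" by (simp add: card_cartesian_product power2_eq_square)
  finally show ?thesis .
qed

lemma over_extend:
  assumes z: "over k z" and x: "over 1 x" and eq: "block_at x 0 N = block_at z (int (k * len)) N"
  shows "over (Suc k) (glue (int (k * len)) z (translate (- int (k * len)) x))" (is "over _ ?g")
  unfolding over_def
proof (intro conjI allI impI)
  have zx: "z \<in> Z" "x \<in> Z" using z x by (auto simp: over_def)
  show "?g \<in> Z"
  proof (rule glue_Z[OF zx(1) translate_Z[OF zx(2)]])
    fix t assume "int (k * len) \<le> t" "t < int (k * len) + int N"
    then show "z t = translate (- int (k * len)) x t"
      using eq by (auto simp: block_at_eq_iff translate_def dest!: spec[of _ "nat (t - int (k * len))"])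
  qed
  fix t assume t: "- int u \<le> t \<and> t \<le> int (Suc k * len + v)"
  show "f (?g t) = per t"
  proof (cases "t < int (k * len)")
    case True
    then show ?thesis using z t by (simp add: over_def glue_def)
  next
    case False
    then have "f (?g t) = f (x (t - int (k * len)))" by (simp add: glue_def translate_def)
    also have "\<dots> = per (t - int (k * len))"
      using x t False unfolding over_def by (simp add: algebra_simps)
    also have "\<dots> = per t" using per_add[of "t - int (k * len)" k] by simp
    finally show ?thesis .
  qed
qed

lemma block_at_extend:
  assumes "block_at x 0 N = block_at z (int (k * len)) N"
  shows "block_at (glue (int (k * len)) z (translate (- int (k * len)) x)) 0 (k * len + N) =
     block_at z 0 (k * len + N)"
    and "block_at (glue (int (k * len)) z (translate (- int (k * len)) x)) (int (k * len)) n =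
     block_at x 0 n"
proof -
  define c where "c = int (k * len)"
  have eq: "x (t - c) = z t" if "c \<le> t" "t < c + int N" for t
    using assms that unfolding block_at_eq_iff c_def[symmetric] by (auto dest!: spec[of _ "nat (t - c)"])
  show "block_at (glue (int (k * len)) z (translate (- int (k * len)) x)) 0 (k * len + N) =
     block_at z 0 (k * len + N)"
    unfolding block_at_eq_iff c_def[symmetric]
  proof (intro allI impI)
    fix j assume "j < k * len + N"
    then have "int j < c + int N" unfolding c_def by linarith
    then show "glue c z (translate (- c) x) (0 + int j) = z (0 + int j)"
      using eq[of "int j"] by (simp add: glue_def translate_def)
  qed
  show "block_at (glue (int (k * len)) z (translate (- int (k * len)) x)) (int (k * len)) n =
     block_at x 0 n"
    unfolding block_at_eq_iff c_def[symmetric] by (simp add: glue_def translate_def)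
qed

lemma start_state: "a \<in> states y u v \<Longrightarrow> \<exists>z. over k z \<and> block_at z 0 N = a"
  unfolding states_left[of k, symmetric] by (auto simp: states_def over_def)

lemma end_state: "over k z \<Longrightarrow> block_at z (int (k * len)) N \<in> states y u v"
proof -
  assume z: "over k z"
  then have "translate (int (k * len)) z \<in> Z" by (simp add: over_def translate_Z)
  moreover have "f (translate (int (k * len)) z t) = y t" if "- int u \<le> t" "t \<le> int v" for t
  proof -
    have "0 \<le> int (k * len)" by (rule of_nat_0_le_iff)
    then have "f (z (t + int (k * len))) = per (t + int (k * len))"
      using z that unfolding over_def by (elim conjE allE[of _ "t + int (k * len)"] impE) linarith+
    then show ?thesis using per_add[of t k] per_window[OF that] by (simp add: translate_def)
  qed
  moreover have "block_at z (int (k * len)) N = block_at (translate (int (k * len)) z) 0 N"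
    by (simp add: block_at_eq_iff translate_def add.commute)
  ultimately show ?thesis by (auto simp: states_def)
qed

lemma end_state_attained: "a \<in> states y u v \<Longrightarrow> \<exists>z. over k z \<and> block_at z (int (k * len)) N = a"
proof -
  assume "a \<in> states y u v"
  then obtain z where z: "z \<in> Z" "a = block_at z 0 N"
    "\<forall>t. - int (k * len + u) \<le> t \<and> t \<le> int v \<longrightarrow> f (z t) = translate (int (k * len)) per t"
    unfolding states_right[of k, symmetric] by (auto simp: states_def)
  have "over k (translate (- int (k * len)) z)"
    unfolding over_def
  proof (intro conjI allI impI translate_Z[OF z(1)])
    fix t assume "- int u \<le> t \<and> t \<le> int (k * len + v)"
    then have "- int (k * len + u) \<le> t - int (k * len) \<and> t - int (k * len) \<le> int v" by simp
    then show "f (translate (- int (k * len)) z t) = per t"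
      using z(3) by (simp add: translate_def)
  qed
  moreover have "block_at (translate (- int (k * len)) z) (int (k * len)) N = a"
    using z(2) by (simp add: block_at_eq_iff translate_def)
  ultimately show ?thesis by blast
qed

text \<open>
  Two different continuations of one state would make the number of paths grow without bound,
  because every path can be prolonged, and every state ends a path of every length.
\<close>

lemma unique_continuation:
  assumes x: "over 1 x" and x': "over 1 x'" and eq: "block_at x 0 N = block_at x' 0 N"
  shows "block_at x 0 (len + N) = block_at x' 0 (len + N)"
proof (rule ccontr)
  assume neq: "\<not> ?thesis"
  let ?cut = "\<lambda>k. take (k * len + N)"
  have step: "card (paths k) < card (paths (Suc k))" for k
  proof -
    have sub: "paths k \<subseteq> ?cut k ` paths (Suc k)"
    proof
      fix p assume "p \<in> paths k"
      then obtain z where z: "over k z" "p = block_at z 0 (k * len + N)" by (auto simp: paths_def)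
      obtain x where x: "over 1 x" "block_at x 0 N = block_at z (int (k * len)) N"
        using start_state[OF end_state[OF z(1)]] by blast
      have "p = ?cut k (block_at (glue (int (k * len)) z (translate (- int (k * len)) x)) 0 (Suc k * len + N))"
        using block_at_extend(1)[OF x(2)] z(2) by (subst take_block_at) auto
      then show "p \<in> ?cut k ` paths (Suc k)"
        using over_extend[OF z(1) x] unfolding paths_def by blast
    qed
    have "block_at x 0 N \<in> states y u v" using end_state[of 0 x] x
      by (auto simp: over_def)
    then obtain z where z: "over k z" "block_at z (int (k * len)) N = block_at x 0 N"
      using end_state_attained by blast
    let ?g = "\<lambda>x. glue (int (k * len)) z (translate (- int (k * len)) x)"
    let ?p = "\<lambda>x. block_at (?g x) 0 (Suc k * len + N)"
    have p: "?p x \<in> paths (Suc k)" "?p x' \<in> paths (Suc k)"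
      using over_extend[OF z(1) x z(2)[symmetric]] over_extend[OF z(1) x'] z(2) eq
      unfolding paths_def by auto
    have cut: "?cut k (?p x) = ?cut k (?p x')"
      using block_at_extend(1)[of x z k] block_at_extend(1)[of x' z k] z(2) eq
      by (simp add: take_block_at)
    have "?p x \<noteq> ?p x'"
    proof
      assume "?p x = ?p x'"
      then have "drop (k * len) (?p x) = drop (k * len) (?p x')" by simp
      then have "block_at (?g x) (int (k * len)) (len + N) = block_at (?g x') (int (k * len)) (len + N)"
        by (simp add: drop_block_at)
      then show False using neq block_at_extend(2)[of x z k "len + N"]
          block_at_extend(2)[of x' z k "len + N"] z(2) eq by simp
    qed
    \<comment> \<open>Truncation covers \<open>paths k\<close> and identifies two members of
      \<open>paths (Suc k)\<close>, so the count grows strictly.\<close>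
    with cut p have "\<not> inj_on (?cut k) (paths (Suc k))" by (meson inj_onD)
    then have "card (?cut k ` paths (Suc k)) < card (paths (Suc k))"
      using card_image_le[OF finite_paths] eq_card_imp_inj_on[OF finite_paths] le_neq_implies_less by blast
    moreover have "card (paths k) \<le> card (?cut k ` paths (Suc k))"
      by (rule card_mono[OF _ sub]) (simp add: finite_paths)
    ultimately show ?thesis by simp
  qed
  have "k \<le> card (paths k)" for k
    by (induction k) (use step in \<open>auto intro: Suc_leI order.strict_trans1\<close>)
  then show False
    using card_paths[of "Suc ((card {a. set a \<subseteq> A \<and> length a = N})\<^sup>2 * K)"] by (meson Suc_n_not_le_n order_trans)
qed

end

section \<open>Walks in a system of spokes\<close>

definition walks :: "('v \<times> 'v) set \<Rightarrow> (int \<Rightarrow> 'v) set" where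
  "walks E = {x. \<forall>t. (x t, x (t + 1)) \<in> E}"

definition gap :: "'v \<Rightarrow> (int \<Rightarrow> 'v) \<Rightarrow> int \<Rightarrow> nat \<Rightarrow> bool" where
  "gap B x a n \<longleftrightarrow> x a = B \<and> x (a + int n + 1) = B \<and> (\<forall>t. a < t \<and> t \<le> a + int n \<longrightarrow> x t \<noteq> B)"

text \<open>Coordinates that make walks computable: \<open>gp\<close> and \<open>gm\<close> run
  along the two paths of a spoke, and \<open>cc\<close> runs around the circuit with time in all of
  the integers, so that turns need no wrap-around. \<open>sp\<close> names the spoke of a vertex
  other than \<open>B\<close>. The assumptions on successors and predecessors mirror each other,
  which keeps the notion closed under reversal.\<close>

locale spokes =
  fixes E :: "('v \<times> 'v) set" and B :: 'v and T T1 :: "'i set" and p q d :: "'i \<Rightarrow> nat"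
    and gp gm :: "'i \<Rightarrow> nat \<Rightarrow> 'v" and cc :: "'i \<Rightarrow> int \<Rightarrow> 'v" and sp :: "'v \<Rightarrow> 'i"
  assumes finite_T: "finite T" and T1_subset: "T1 \<subseteq> T"
    and d_pos: "i \<in> T \<Longrightarrow> 0 < d i"
    and p_pos: "i \<in> T1 \<Longrightarrow> 0 < p i" and q_pos: "i \<in> T1 \<Longrightarrow> 0 < q i"
    and gp_0: "i \<in> T1 \<Longrightarrow> gp i 0 = B" and gp_p: "i \<in> T1 \<Longrightarrow> gp i (p i) = cc i 0"
    and gm_0: "i \<in> T1 \<Longrightarrow> gm i 0 = cc i 0" and gm_q: "i \<in> T1 \<Longrightarrow> gm i (q i) = B"
    and cc_deg: "i \<in> T - T1 \<Longrightarrow> cc i 0 = B"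
    and cc_eq_iff: "i \<in> T \<Longrightarrow> cc i r = cc i s \<longleftrightarrow> [r = s] (mod int (d i))"
    and gp_arc: "i \<in> T1 \<Longrightarrow> t < p i \<Longrightarrow> (gp i t, gp i (Suc t)) \<in> E"
    and gm_arc: "i \<in> T1 \<Longrightarrow> t < q i \<Longrightarrow> (gm i t, gm i (Suc t)) \<in> E"
    and cc_arc: "i \<in> T \<Longrightarrow> (cc i s, cc i (s + 1)) \<in> E"
    and sp_gp: "i \<in> T1 \<Longrightarrow> 0 < t \<Longrightarrow> t \<le> p i \<Longrightarrow> gp i t \<noteq> B \<and> sp (gp i t) = i"
    and sp_gm: "i \<in> T1 \<Longrightarrow> t < q i \<Longrightarrow> gm i t \<noteq> B \<and> sp (gm i t) = i"
    and sp_cc: "i \<in> T1 \<Longrightarrow> cc i s \<noteq> B \<and> sp (cc i s) = i"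
    and sp_deg: "i \<in> T - T1 \<Longrightarrow> 0 < s \<Longrightarrow> s < int (d i) \<Longrightarrow> cc i s \<noteq> B \<and> sp (cc i s) = i"
    and B_succ: "(B, v) \<in> E \<Longrightarrow> (\<exists>i\<in>T1. v = gp i 1) \<or> (\<exists>i\<in>T-T1. v = cc i 1)"
    and gp_succ: "(gp i t, v) \<in> E \<Longrightarrow> i \<in> T1 \<Longrightarrow> 0 < t \<Longrightarrow> t < p i \<Longrightarrow> v = gp i (Suc t)"
    and cc_succ: "(cc i s, v) \<in> E \<Longrightarrow> i \<in> T1 \<Longrightarrow> v = cc i (s + 1) \<or> int (d i) dvd s \<and> v = gm i 1"
    and deg_succ: "(cc i s, v) \<in> E \<Longrightarrow> i \<in> T - T1 \<Longrightarrow> 0 < s \<Longrightarrow> s < int (d i) \<Longrightarrow> v = cc i (s + 1)"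
    and gm_succ: "(gm i t, v) \<in> E \<Longrightarrow> i \<in> T1 \<Longrightarrow> 0 < t \<Longrightarrow> t < q i \<Longrightarrow> v = gm i (Suc t)"
    and B_pred: "(v, B) \<in> E \<Longrightarrow> (\<exists>i\<in>T1. v = gm i (q i - 1)) \<or> (\<exists>i\<in>T-T1. v = cc i (-1))"
    and gp_pred: "(v, gp i t) \<in> E \<Longrightarrow> i \<in> T1 \<Longrightarrow> 0 < t \<Longrightarrow> t < p i \<Longrightarrow> v = gp i (t - 1)"
    and cc_pred: "(v, cc i s) \<in> E \<Longrightarrow> i \<in> T1 \<Longrightarrow> v = cc i (s - 1) \<or> int (d i) dvd s \<and> v = gp i (p i - 1)"
    and deg_pred: "(v, cc i s) \<in> E \<Longrightarrow> i \<in> T - T1 \<Longrightarrow> 0 < s \<Longrightarrow> s < int (d i) \<Longrightarrow> v = cc i (s - 1)"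
    and gm_pred: "(v, gm i t) \<in> E \<Longrightarrow> i \<in> T1 \<Longrightarrow> 0 < t \<Longrightarrow> t < q i \<Longrightarrow> v = gm i (t - 1)"
    and vertex_cases: "u \<in> Field E \<Longrightarrow> u \<noteq> B \<Longrightarrow>
      (\<exists>i\<in>T1. (\<exists>t. 0 < t \<and> t < p i \<and> u = gp i t) \<or> (\<exists>s. u = cc i s) \<or> (\<exists>t. 0 < t \<and> t < q i \<and> u = gm i t)) \<or>
      (\<exists>i\<in>T-T1. \<exists>s. 0 < s \<and> s < int (d i) \<and> u = cc i s)"
begin

lemma cc_cong: "i \<in> T \<Longrightarrow> int (d i) dvd s - t \<Longrightarrow> cc i s = cc i t"
  by (simp add: cc_eq_iff cong_iff_dvd_diff)

lemma cc_d: "i \<in> T \<Longrightarrow> cc i (int (d i)) = cc i 0"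
  by (rule cc_cong) auto

lemma T1D: "i \<in> T1 \<Longrightarrow> i \<in> T" using T1_subset by auto

lemma arc: "x \<in> walks E \<Longrightarrow> (x t, x (t + 1)) \<in> E" by (simp add: walks_def)

lemma in_Field: "x \<in> walks E \<Longrightarrow> x t \<in> Field E" using arc[of x t] by (auto simp: Field_def)

text \<open>Reversal exchanges outgoing and incoming paths and negates the time on the circuits. It
  yields the past of a walk from the lemmas about its future.\<close>

lemma reversed: "spokes (E\<inverse>) B T T1 q p d (\<lambda>i t. gm i (q i - t)) (\<lambda>i t. gp i (p i - t)) (\<lambda>i t. cc i (- t)) sp"
proof
  show "finite T" "T1 \<subseteq> T" by (fact finite_T T1_subset)+
next
  fix i r s assume "i \<in> T"
  then show "(cc i (- r) = cc i (- s)) = [r = s] (mod int (d i))"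
    by (simp add: cc_eq_iff cong_minus_minus_iff)
next
  fix i t assume i: "i \<in> T1" and t: "t < q i"
  then have "(gm i (q i - Suc t), gm i (Suc (q i - Suc t))) \<in> E" by (intro gm_arc) auto
  then show "(gm i (q i - t), gm i (q i - Suc t)) \<in> E\<inverse>" using t by (simp add: Suc_diff_Suc)
next
  fix i t assume i: "i \<in> T1" and t: "t < p i"
  then have "(gp i (p i - Suc t), gp i (Suc (p i - Suc t))) \<in> E" by (intro gp_arc) auto
  then show "(gp i (p i - t), gp i (p i - Suc t)) \<in> E\<inverse>" using t by (simp add: Suc_diff_Suc)
next
  fix i s assume i: "i \<in> T"
  show "(cc i (- s), cc i (- (s + 1))) \<in> E\<inverse>" using cc_arc[OF i, of "- s - 1"] by simp
next
  fix i s assume "i \<in> T - T1" "0 < s" "s < int (d i)"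
  \<comment> \<open>The assumptions on degenerate circuits speak of \<open>0 < s\<close> and
    \<open>s < d i\<close> only, so the negated index is moved back by one period.\<close>
  moreover from this have "cc i (- s) = cc i (int (d i) - s)" by (intro cc_cong) auto
  ultimately show "cc i (- s) \<noteq> B \<and> sp (cc i (- s)) = i" using sp_deg[of i "int (d i) - s"] by simp
next
  fix v assume "(B, v) \<in> E\<inverse>"
  then show "(\<exists>i\<in>T1. v = gm i (q i - 1)) \<or> (\<exists>i\<in>T-T1. v = cc i (- 1))" using B_pred by simp
next
  fix v i t assume "(gm i (q i - t), v) \<in> E\<inverse>" "i \<in> T1" "0 < t" "t < q i"
  then show "v = gm i (q i - Suc t)" using gm_pred[of v i "q i - t"] by simp
next
  fix v i s assume "(cc i (- s), v) \<in> E\<inverse>" "i \<in> T1"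
  then show "v = cc i (- (s + 1)) \<or> int (d i) dvd s \<and> v = gp i (p i - 1)" using cc_pred[of v i "- s"] by simp
next
  fix v i s assume *: "(cc i (- s), v) \<in> E\<inverse>" "i \<in> T - T1" "0 < s" "s < int (d i)"
  moreover from this have "cc i (- s) = cc i (int (d i) - s)" by (intro cc_cong) auto
  ultimately have "v = cc i (int (d i) - s - 1)" using deg_pred[of v i "int (d i) - s"] by simp
  also have "\<dots> = cc i (- (s + 1))" using * by (intro cc_cong) auto
  finally show "v = cc i (- (s + 1))" .
next
  fix v i t assume "(gp i (p i - t), v) \<in> E\<inverse>" "i \<in> T1" "0 < t" "t < p i"
  then show "v = gp i (p i - Suc t)" using gp_pred[of v i "p i - t"] by simp
next
  fix v assume "(v, B) \<in> E\<inverse>"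
  then have "(\<exists>i\<in>T1. v = gp i 1) \<or> (\<exists>i\<in>T-T1. v = cc i 1)" using B_succ by simp
  moreover have "p i - (p i - 1) = 1" if "i \<in> T1" for i using p_pos[OF that] by simp
  ultimately show "(\<exists>i\<in>T1. v = gp i (p i - (p i - 1))) \<or> (\<exists>i\<in>T-T1. v = cc i (- (- 1)))" by auto
next
  fix v i t assume "(v, gm i (q i - t)) \<in> E\<inverse>" "i \<in> T1" "0 < t" "t < q i"
  then show "v = gm i (q i - (t - 1))" using gm_succ[of i "q i - t" v] by (simp add: Suc_diff_le)
next
  fix v i s assume "(v, cc i (- s)) \<in> E\<inverse>" "i \<in> T1"
  moreover from this have "q i - (q i - 1) = 1" using q_pos by (simp add: Suc_leI)
  ultimately show "v = cc i (- (s - 1)) \<or> int (d i) dvd s \<and> v = gm i (q i - (q i - 1))"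
    using cc_succ[of i "- s" v] by simp
next
  fix v i s assume *: "(v, cc i (- s)) \<in> E\<inverse>" "i \<in> T - T1" "0 < s" "s < int (d i)"
  moreover from this have "cc i (- s) = cc i (int (d i) - s)" by (intro cc_cong) auto
  ultimately have "v = cc i (int (d i) - s + 1)" using deg_succ[of i "int (d i) - s" v] by simp
  also have "\<dots> = cc i (- (s - 1))" using * by (intro cc_cong) auto
  finally show "v = cc i (- (s - 1))" .
next
  fix v i t assume "(v, gp i (p i - t)) \<in> E\<inverse>" "i \<in> T1" "0 < t" "t < p i"
  then show "v = gp i (p i - (t - 1))" using gp_succ[of i "p i - t" v] by (simp add: Suc_diff_le)
next
  fix u assume "u \<in> Field (E\<inverse>)" and B: "u \<noteq> B"
  then have "u \<in> Field E" by simp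
  from vertex_cases[OF this B]
  show "(\<exists>i\<in>T1. (\<exists>t. 0 < t \<and> t < q i \<and> u = gm i (q i - t)) \<or> (\<exists>s. u = cc i (- s)) \<or>
      (\<exists>t. 0 < t \<and> t < p i \<and> u = gp i (p i - t))) \<or>
      (\<exists>i\<in>T-T1. \<exists>s. 0 < s \<and> s < int (d i) \<and> u = cc i (- s))"
  proof (elim disjE bexE exE conjE)
    fix i t assume "i \<in> T1" "0 < t" "t < p i" "u = gp i t"
    then have "0 < p i - t \<and> p i - t < p i \<and> u = gp i (p i - (p i - t))" by simp
    then show ?thesis using \<open>i \<in> T1\<close> by blast
  next
    fix i s assume "i \<in> T1" "u = cc i s"
    then show ?thesis by (metis add.inverse_inverse)
  next
    fix i t assume "i \<in> T1" "0 < t" "t < q i" "u = gm i t"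
    then have "0 < q i - t \<and> q i - t < q i \<and> u = gm i (q i - (q i - t))" by simp
    then show ?thesis using \<open>i \<in> T1\<close> by blast
  next
    fix i s assume i: "i \<in> T - T1" "0 < s" "s < int (d i)" "u = cc i s"
    then have "cc i s = cc i (- (int (d i) - s))" by (intro cc_cong) auto
    then have "0 < int (d i) - s \<and> int (d i) - s < int (d i) \<and> u = cc i (- (int (d i) - s))" using i by simp
    then show ?thesis using i(1) by blast
  qed
qed (use d_pos p_pos q_pos gp_0 gp_p gm_0 gm_q cc_deg sp_cc sp_gp sp_gm in auto)

lemma walks_reversed: "x \<in> walks E \<Longrightarrow> (\<lambda>t. x (- t)) \<in> walks (E\<inverse>)"
  unfolding walks_def
proof (clarsimp)
  fix t assume "\<forall>t. (x t, x (t + 1)) \<in> E"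
  from this[rule_format, of "- t - 1"] show "(x (- t - 1), x (- t)) \<in> E" by simp
qed

section \<open>Walks along the pieces of a spoke\<close>

lemma follow_gp:
  assumes "x \<in> walks E" "i \<in> T1" "x a = gp i s" "0 < s"
  shows "s + k \<le> p i \<Longrightarrow> x (a + int k) = gp i (s + k)"
proof (induction k)
  case (Suc k)
  then show ?case using gp_succ[of i "s + k" "x (a + int k + 1)"] arc[OF assms(1), of "a + int k"] assms
    by (simp add: add.assoc add.commute[of 1])
qed (use assms in simp)

lemma follow_gm:
  assumes "x \<in> walks E" "i \<in> T1" "x a = gm i s" "0 < s"
  shows "s + k \<le> q i \<Longrightarrow> x (a + int k) = gm i (s + k)"
proof (induction k)
  case (Suc k)
  then show ?case using gm_succ[of i "s + k" "x (a + int k + 1)"] arc[OF assms(1), of "a + int k"] assms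
    by (simp add: add.assoc add.commute[of 1])
qed (use assms in simp)

lemma follow_deg:
  assumes "x \<in> walks E" "i \<in> T - T1" "x a = cc i s" "0 < s"
  shows "s + int k \<le> int (d i) \<Longrightarrow> x (a + int k) = cc i (s + int k)"
proof (induction k)
  case (Suc k)
  then show ?case using deg_succ[of i "s + int k" "x (a + int k + 1)"] arc[OF assms(1), of "a + int k"] assms
    by (simp add: add.assoc add.commute[of 1])
qed (use assms in simp)

text \<open>The circuit of a regular spoke can be left only at \<open>cc i 0\<close>, that is, at an
  index divisible by \<open>d i\<close>. The second alternative records the exit and claims nothing
  about later times.\<close>

lemma follow_cc:
  assumes "x \<in> walks E" "i \<in> T1" "x a = cc i s"
  shows "(\<forall>j\<le>k. x (a + int j) = cc i (s + int j)) \<or>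
    (\<exists>j<k. int (d i) dvd s + int j \<and> (\<forall>j'\<le>j. x (a + int j') = cc i (s + int j')) \<and>
      x (a + int j + 1) = gm i 1)"
proof (induction k)
  case (Suc k)
  then show ?case
  proof
    assume *: "\<forall>j\<le>k. x (a + int j) = cc i (s + int j)"
    then have "x (a + int k + 1) = cc i (s + int k + 1) \<or> int (d i) dvd s + int k \<and> x (a + int k + 1) = gm i 1"
      using cc_succ[OF _ assms(2)] arc[OF assms(1), of "a + int k"] by (metis order_refl)
    then show ?thesis
    proof
      assume "x (a + int k + 1) = cc i (s + int k + 1)"
      then have "\<forall>j\<le>Suc k. x (a + int j) = cc i (s + int j)"
        using * by (auto simp: le_Suc_eq ac_simps)
      then show ?thesis ..
    qed (use * in auto)
  qed (auto intro: less_SucI)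
qed (use assms in simp)

text \<open>Leaving the circuit commits the walk to the path \<open>gm\<close>, which ends in
  \<open>B\<close>.\<close>

lemma stay_cc:
  assumes "x \<in> walks E" "i \<in> T1" "x a = cc i s" "\<And>t. a \<le> t \<Longrightarrow> x t \<noteq> B"
  shows "x (a + int k) = cc i (s + int k)"
  using follow_cc[OF assms(1-3), of k]
proof
  assume "\<exists>j<k. int (d i) dvd s + int j \<and> (\<forall>j'\<le>j. x (a + int j') = cc i (s + int j')) \<and>
      x (a + int j + 1) = gm i 1"
  then obtain j where j: "x (a + int j + 1) = gm i 1" by blast
  have "x (a + int j + 1 + int (q i - 1)) = gm i (1 + (q i - 1))"
    by (rule follow_gm[OF assms(1,2) j]) (use q_pos[OF assms(2)] in auto)
  then have "x (a + int j + 1 + int (q i - 1)) = B" using q_pos gm_q assms(2) by simp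
  with assms(4) show ?thesis by simp
qed blast

section \<open>Excursions between consecutive visits to the centre\<close>

definition gaplen :: "'i \<Rightarrow> nat \<Rightarrow> bool" where
  "gaplen i n \<longleftrightarrow> (if i \<in> T1 then \<exists>k. n + 1 = p i + q i + k * d i else n + 1 = d i)"

lemma gaplen_regular: "i \<in> T1 \<Longrightarrow> gaplen i n \<longleftrightarrow> (\<exists>k. n + 1 = p i + q i + k * d i)"
  by (simp add: gaplen_def)

text \<open>An excursion with \<open>n\<close> inner vertices has \<open>n + 1\<close> arcs. The
  index into \<open>gm\<close> is therefore counted back from time \<open>n + 1\<close>. At
  \<open>t + q i = n + 1\<close> the circuit is used, which agrees with \<open>gm i 0\<close> when
  the number of turns is whole. The formula is meaningful for \<open>gaplen i n\<close>.\<close>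

definition exc :: "'i \<Rightarrow> nat \<Rightarrow> nat \<Rightarrow> 'v" where
  "exc i n t = (if i \<in> T1 then
     if t \<le> p i then gp i t
     else if t + q i \<le> n + 1 then cc i (int t - int (p i))
     else gm i (t + q i - (n + 1))
   else cc i (int t))"

text \<open>After its first arc the walk has a choice only when it passes the rim vertex: how many
  whole turns to make. The length of the gap fixes that number, hence the whole excursion.\<close>

lemma gap_regular:
  assumes x: "x \<in> walks E" and i: "i \<in> T1" and gap: "gap B x a n" and 1: "x (a + 1) = gp i 1"
  shows "gaplen i n \<and> (\<forall>t\<le>n + 1. x (a + int t) = exc i n t)"
proof -
  have gp: "x (a + int t) = gp i t" if "t \<le> p i" for t
  proof (cases "t = 0")
    case True then show ?thesis using gap i by (simp add: gap_def gp_0)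
  next
    case False
    then show ?thesis using follow_gp[OF x i 1, of "t - 1"] that by (simp add: of_nat_diff)
  qed
  have np: "p i \<le> n"
  proof (rule ccontr)
    assume "\<not> p i \<le> n"
    then have "x (a + int (n + 1)) = gp i (n + 1)" "gp i (n + 1) \<noteq> B"
      using gp[of "n + 1"] sp_gp[OF i, of "n + 1"] by auto
    then show False using gap by (simp add: gap_def ac_simps)
  qed
  have "x (a + int (p i)) = cc i 0" using gp[of "p i"] gp_p i by simp
  \<comment> \<open>The circuit is followed up to the time of the closing \<open>B\<close>. Since
    \<open>B\<close> is not on it, an exit must have occurred before.\<close>
  from follow_cc[OF x i this, of "n + 1 - p i"]
  obtain j where j: "j < n + 1 - p i" "int (d i) dvd int j"
    "\<forall>j'\<le>j. x (a + int (p i) + int j') = cc i (int j')" "x (a + int (p i) + int j + 1) = gm i 1"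
  proof
    assume "\<forall>j\<le>n + 1 - p i. x (a + int (p i) + int j) = cc i (0 + int j)"
    then have *: "x (a + int (p i) + int (n + 1 - p i)) = cc i (0 + int (n + 1 - p i))" by blast
    have e: "a + int (p i) + int (n + 1 - p i) = a + int n + 1" using np by linarith
    have "x (a + int n + 1) = cc i (0 + int (n + 1 - p i))" using *[unfolded e] .
    moreover have "x (a + int n + 1) = B" using gap unfolding gap_def by blast
    ultimately show ?thesis using sp_cc[OF i, of "0 + int (n + 1 - p i)"] by simp
  next
    assume "\<exists>j<n + 1 - p i. int (d i) dvd 0 + int j \<and>
      (\<forall>j'\<le>j. x (a + int (p i) + int j') = cc i (0 + int j')) \<and> x (a + int (p i) + int j + 1) = gm i 1"
    then show ?thesis unfolding add_0 using that by blast
  qed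
  have gm: "x (a + int (p i) + int j + int t) = gm i t" if "t \<le> q i" for t
  proof (cases "t = 0")
    case True
    then show ?thesis
      using j(2) j(3)[rule_format, OF order_refl] gm_0[OF i] cc_cong[OF T1D[OF i], of "int j" 0] by simp
  next
    case False
    then show ?thesis using follow_gm[OF x i j(4), of "t - 1"] that by (simp add: of_nat_diff add.assoc)
  qed
  have n: "n + 1 = p i + j + q i"
  proof (rule antisym)
    have "x (a + int (p i) + int j + int (q i)) = B" using gm gm_q[OF i] by simp
    moreover have "a < a + int (p i) + int j + int (q i)" using q_pos[OF i] by simp
    ultimately have "\<not> a + int (p i) + int j + int (q i) \<le> a + int n"
      using gap unfolding gap_def by blast
    then show "n + 1 \<le> p i + j + q i" by simp
    show "p i + j + q i \<le> n + 1"
    proof (rule ccontr)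
      assume "\<not> ?thesis"
      then have "x (a + int (p i) + int j + int (n + 1 - p i - j)) \<noteq> B"
        using gm[of "n + 1 - p i - j"] sp_gm[OF i, of "n + 1 - p i - j"] j(1) by simp
      moreover have e: "a + int (p i) + int j + int (n + 1 - p i - j) = a + int n + 1" using j(1) by linarith
      ultimately have "x (a + int n + 1) \<noteq> B" by (simp only: e not_False_eq_True)
      then show False using gap unfolding gap_def by blast
    qed
  qed
  from j(2) have "d i dvd j" by simp
  then obtain k where "j = d i * k" ..
  then have k: "j = k * d i" by (simp only: mult.commute)
  have "x (a + int t) = exc i n t" if t: "t \<le> n + 1" for t
  proof -
    consider "t \<le> p i" | "p i < t" "t \<le> p i + j" | "p i + j < t" by linarith
    then show ?thesis
    proof cases
      case 1 then show ?thesis using gp i by (simp add: exc_def)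
    next
      case 2
      then have "t + q i \<le> n + 1" using n by simp
      moreover have e: "a + int t = a + int (p i) + int (t - p i)" "int (t - p i) = int t - int (p i)" using 2 by auto
      have "t - p i \<le> j" using 2 by simp
      then have "x (a + int t) = cc i (int (t - p i))" unfolding e(1) using j(3) by blast
      then have "x (a + int t) = cc i (int t - int (p i))" by (simp only: e(2))
      ultimately show ?thesis using 2 i by (simp add: exc_def)
    next
      case 3
      then have e: "t + q i - (n + 1) = t - p i - j" "a + int t = a + int (p i) + int j + int (t - p i - j)"
        using n by linarith+
      have "t - p i - j \<le> q i" using n t by simp
      then have "x (a + int t) = gm i (t + q i - (n + 1))" unfolding e by (rule gm)
      then show ?thesis using 3 n i by (simp add: exc_def)
    qed
  qed
  moreover have "n + 1 = p i + q i + k * d i" using n k by linarith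
  then have "gaplen i n" using gaplen_regular[OF i] by blast
  ultimately show ?thesis by blast
qed

lemma gap_degenerate:
  assumes x: "x \<in> walks E" and i: "i \<in> T - T1" and gap: "gap B x a n" and 1: "x (a + 1) = cc i 1"
  shows "gaplen i n \<and> (\<forall>t\<le>n + 1. x (a + int t) = exc i n t)"
proof -
  have *: "x (a + int t) = cc i (int t)" if "t \<le> d i" for t
  proof (cases "t = 0")
    case True then show ?thesis using gap cc_deg[OF i] by (simp add: gap_def)
  next
    case False
    then show ?thesis using follow_deg[OF x i 1, of "t - 1"] that by (simp add: of_nat_diff)
  qed
  have "n + 1 = d i"
  proof (rule antisym)
    have "x (a + int (d i)) = B" using *[of "d i"] cc_d[of i] cc_deg[OF i] i by simp
    moreover have "0 < d i" using d_pos i by simp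
    moreover from this have "a < a + int (d i)" by simp
    ultimately have "\<not> a + int (d i) \<le> a + int n" using gap unfolding gap_def by blast
    then show "n + 1 \<le> d i" by simp
    show "d i \<le> n + 1"
    proof (rule ccontr)
      assume "\<not> d i \<le> n + 1"
      then have "x (a + int (n + 1)) = cc i (int (n + 1))" "cc i (int (n + 1)) \<noteq> B"
        using *[of "n + 1"] sp_deg[OF i, of "int (n + 1)"] by auto
      then show False using gap by (simp add: gap_def ac_simps)
    qed
  qed
  then show ?thesis using * i by (auto simp: gaplen_def exc_def)
qed

lemma gap_exc:
  assumes x: "x \<in> walks E" and gap: "gap B x a n"
  obtains i where "i \<in> T" "gaplen i n" "\<And>t. t \<le> n + 1 \<Longrightarrow> x (a + int t) = exc i n t"
proof -
  have "(B, x (a + 1)) \<in> E" using arc[OF x, of a] gap by (simp add: gap_def)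
  from B_succ[OF this] show thesis
    using gap_regular[OF x _ gap] gap_degenerate[OF x _ gap] that T1D by blast
qed

lemma exc_0: "i \<in> T \<Longrightarrow> exc i n 0 = B"
  using gp_0 cc_deg by (simp add: exc_def)

lemma exc_end:
  assumes "i \<in> T" "gaplen i n"
  shows "exc i n (n + 1) = B"
proof (cases "i \<in> T1")
  case True
  then obtain k where "n + 1 = p i + q i + k * d i" using assms by (auto simp: gaplen_def)
  then show ?thesis using True q_pos[OF True] gm_q[OF True] by (simp add: exc_def)
next
  case False
  then have "n + 1 = d i" "exc i n (n + 1) = cc i (int (n + 1))" using assms by (auto simp: gaplen_def exc_def)
  then show ?thesis using cc_d[OF assms(1)] cc_deg False assms(1) by simp
qed

lemma exc_arc:
  assumes i: "i \<in> T" "gaplen i n" and t: "t \<le> n"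
  shows "(exc i n t, exc i n (Suc t)) \<in> E"
proof (cases "i \<in> T1")
  case False
  then show ?thesis using cc_arc[OF i(1), of "int t"] by (simp add: exc_def add.commute)
next
  case True
  then obtain k where k: "n + 1 = p i + q i + k * d i" using i(2) by (auto simp: gaplen_def)
  consider "t < p i" | "t = p i" "k * d i = 0" | "t = p i" "0 < k * d i" | "p i < t" "t < p i + k * d i"
    | "p i < t" "t = p i + k * d i" | "p i + k * d i < t" by linarith
  then show ?thesis
  proof cases
    case 1
    then show ?thesis using True gp_arc by (simp add: exc_def)
  next
    case 2
    then have "n + 1 = p i + q i" using k by simp
    then have "exc i n t = gm i 0" "exc i n (Suc t) = gm i 1"
      using 2 True q_pos[OF True] gp_p gm_0 by (auto simp: exc_def)
    then show ?thesis using gm_arc[OF True, of 0] q_pos[OF True] by simp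
  next
    case 3
    then have "exc i n t = cc i 0" "exc i n (Suc t) = cc i (0 + 1)"
      using k True gp_p by (auto simp: exc_def)
    then show ?thesis using cc_arc[OF i(1), of 0] by simp
  next
    case 4
    then show ?thesis using k True cc_arc[OF i(1), of "int t - int (p i)"] by (simp add: exc_def algebra_simps)
  next
    case 5
    then have "exc i n t = cc i (int (k * d i))" using k True by (simp add: exc_def)
    also have "\<dots> = gm i 0" using gm_0[OF True] cc_cong[OF i(1), of "int (k * d i)" 0] by simp
    finally have "exc i n t = gm i 0" .
    moreover have "Suc t + q i - (n + 1) = 1" using k 5 by linarith
    then have "exc i n (Suc t) = gm i 1" using k True 5 by (simp add: exc_def)
    ultimately show ?thesis using gm_arc[OF True, of 0] q_pos[OF True] by simp
  next
    case 6
    then have "\<not> t + q i \<le> n + 1" "Suc t + q i - (n + 1) = Suc (t + q i - (n + 1))" using k by auto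
    moreover have "t + q i - (n + 1) < q i" using t q_pos[OF True] by linarith
    ultimately show ?thesis using gm_arc[OF True, of "t + q i - (n + 1)"] True 6 by (simp add: exc_def)
  qed
qed

lemma exc_inner:
  assumes "i \<in> T" "gaplen i n" "0 < t" "t \<le> n"
  shows "exc i n t \<noteq> B \<and> sp (exc i n t) = i"
  using assms sp_gp[of i t] sp_cc[of i] sp_gm[of i "t + q i - (n + 1)"] sp_deg[of i "int t"]
  by (auto simp: exc_def gaplen_def)

section \<open>Walks that stay away from the centre\<close>

definition ray :: "'i \<Rightarrow> nat \<Rightarrow> 'v" where
  "ray i t = (if t \<le> p i then gp i t else cc i (int t - int (p i)))"

lemma ray_arc: "i \<in> T1 \<Longrightarrow> (ray i t, ray i (Suc t)) \<in> E"
  using gp_arc[of i t] cc_arc[OF T1D, of i "int t - int (p i)"] gp_p[of i]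
  by (cases "t = p i") (auto simp: ray_def algebra_simps)

lemma ray_0: "i \<in> T1 \<Longrightarrow> ray i 0 = B" by (simp add: ray_def gp_0)

lemma ray_inner: "i \<in> T1 \<Longrightarrow> 0 < t \<Longrightarrow> ray i t \<noteq> B \<and> sp (ray i t) = i"
  using sp_gp sp_cc by (simp add: ray_def)

text \<open>Incoming paths and degenerate circuits lead to \<open>B\<close> in bounded time, and an
  outgoing path leads to a regular circuit. Only circuits of regular spokes can hold a walk for
  ever.\<close>

lemma tail:
  assumes x: "x \<in> walks E" and nB: "\<And>t. a \<le> t \<Longrightarrow> x t \<noteq> B"
  obtains i b s where "i \<in> T1" "a \<le> b" "\<And>t. b \<le> t \<Longrightarrow> x t = cc i (s + t)"
proof -
  note result = that
  have *: thesis if i: "i \<in> T1" and b: "a \<le> b" "x b = cc i s" for i b s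
  proof (rule result[OF i b(1), of "s - b"])
    fix t assume "b \<le> t"
    then show "x t = cc i (s - b + t)"
      using stay_cc[OF x i b(2), of "nat (t - b)"] nB b(1) by (simp add: algebra_simps)
  qed
  from vertex_cases[OF in_Field[OF x] nB[OF order_refl]] show thesis
  proof (elim disjE bexE exE conjE)
    fix i t assume i: "i \<in> T1" and t: "0 < t" "t < p i" "x a = gp i t"
    then have "x (a + int (p i - t)) = cc i 0"
      using follow_gp[OF x i t(3), of "p i - t"] gp_p[OF i] by simp
    then show thesis using i by (intro *) auto
  next
    fix i s assume "i \<in> T1" "x a = cc i s"
    then show thesis using *[of i a s] by blast
  next
    fix i t assume i: "i \<in> T1" and t: "0 < t" "t < q i" "x a = gm i t"
    then have "x (a + int (q i - t)) = B"
      using follow_gm[OF x i t(3), of "q i - t"] gm_q[OF i] by simp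
    then show thesis using nB by simp
  next
    fix i s assume i: "i \<in> T - T1" and s: "0 < s" "s < int (d i)" "x a = cc i s"
    then have "x (a + int (nat (int (d i) - s))) = B"
      using follow_deg[OF x i s(3), of "nat (int (d i) - s)"] cc_deg[OF i] cc_d[of i] by simp
    then show thesis using nB by simp
  qed
qed

lemma right_ray:
  assumes x: "x \<in> walks E" and a: "x a = B" and nB: "\<And>t. a < t \<Longrightarrow> x t \<noteq> B"
  obtains i where "i \<in> T1" "\<And>t. x (a + int t) = ray i t"
proof -
  have "(B, x (a + 1)) \<in> E" using arc[OF x, of a] a by simp
  from B_succ[OF this] show thesis
  proof (elim disjE bexE)
    fix i assume i: "i \<in> T1" and 1: "x (a + 1) = gp i 1"
    have gp: "x (a + int t) = gp i t" if "t \<le> p i" for t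
    proof (cases "t = 0")
      case True then show ?thesis using a i by (simp add: gp_0)
    next
      case False
      then show ?thesis using follow_gp[OF x i 1, of "t - 1"] that by (simp add: of_nat_diff)
    qed
    have "x (a + int t) = ray i t" for t
    proof (cases "t \<le> p i")
      case False
      have "x (a + int (p i)) = cc i 0" using gp[of "p i"] gp_p i by simp
      then have "x (a + int (p i) + int (t - p i)) = cc i (0 + int (t - p i))"
        by (rule stay_cc[OF x i]) (use nB p_pos[OF i] in auto)
      then show ?thesis using False by (simp add: ray_def of_nat_diff)
    qed (simp add: ray_def gp)
    then show thesis using i that by blast
  next
    fix i assume i: "i \<in> T - T1" and 1: "x (a + 1) = cc i 1"
    have "x (a + 1 + int (d i - 1)) = cc i (1 + int (d i - 1))"
      by (rule follow_deg[OF x i 1]) (use d_pos[of i] i in auto)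
    then have "x (a + 1 + int (d i - 1)) = B" using cc_d[of i] cc_deg[OF i] d_pos[of i] i by simp
    then show thesis using nB by simp
  qed
qed

text \<open>From some time on the walk is on a circuit. Read backwards from there, it is a walk of
  the reversed graph that starts on a circuit and avoids \<open>B\<close>, so it never leaves the
  circuit in this direction either.\<close>

lemma never_B:
  assumes x: "x \<in> walks E" and nB: "\<And>t. x t \<noteq> B"
  obtains i s where "i \<in> T1" "\<And>t. x t = cc i (s + t)"
proof -
  obtain i b s where i: "i \<in> T1" and b: "\<And>t. b \<le> t \<Longrightarrow> x t = cc i (s + t)"
    using tail[OF x, of 0] nB by metis
  interpret rev: spokes "E\<inverse>" B T T1 q p d "\<lambda>i t. gm i (q i - t)" "\<lambda>i t. gp i (p i - t)" "\<lambda>i t. cc i (- t)" sp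
    by (rule reversed)
  have "x t = cc i (s + t)" for t
  proof (cases "b \<le> t")
    case False
    have "(\<lambda>t. x (- t)) (- b + int (nat (b - t))) = cc i (- (- (s + b) + int (nat (b - t))))"
      by (rule rev.stay_cc[OF walks_reversed[OF x] i]) (use nB b in \<open>auto simp: add.commute\<close>)
    then show ?thesis using False by (simp add: add.commute)
  qed (rule b)
  with i that show thesis by blast
qed

end

section \<open>A finite-to-one subshift splits the return times\<close>

lemma finite_nat_bound: "finite I \<Longrightarrow> \<exists>L::nat. \<forall>i\<in>I. f i \<le> L"
  by (rule exI[of _ "sum f I"]) (auto intro: member_le_sum)

lemma walks_glue:
  assumes "x \<in> walks E" "y \<in> walks E" "x p = y p"
  shows "glue p x y \<in> walks E"
  unfolding walks_def glue_def
proof (clarsimp, intro conjI impI)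
  fix i
  show "i < p \<Longrightarrow> i + 1 < p \<Longrightarrow> (x i, x (i + 1)) \<in> E" using assms by (auto simp: walks_def)
  show "\<not> i < p \<Longrightarrow> (y i, y (i + 1)) \<in> E" using assms by (auto simp: walks_def)
  assume "i < p" "\<not> i + 1 < p"
  then have "i + 1 = p" by simp
  then show "(x i, y (i + 1)) \<in> E" using assms by (auto simp: walks_def dest: spec[of _ i])
qed

lemma walks_translate:
  assumes "x \<in> walks E"
  shows "translate k x \<in> walks E"
  unfolding walks_def translate_def
proof (clarify)
  fix i
  have "(x (i + k), x (i + k + 1)) \<in> E" using assms by (simp add: walks_def)
  then show "(x (i + k), x (i + 1 + k)) \<in> E" by (simp add: ac_simps)
qed

lemma gap_iff:
  "gap B x a n \<longleftrightarrow> (\<forall>t. a \<le> t \<and> t \<le> a + int n + 1 \<longrightarrow> (x t = B \<longleftrightarrow> t = a \<or> t = a + int n + 1))"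
proof
  assume g: "gap B x a n"
  show "\<forall>t. a \<le> t \<and> t \<le> a + int n + 1 \<longrightarrow> (x t = B \<longleftrightarrow> t = a \<or> t = a + int n + 1)"
  proof (intro allI impI)
    fix t assume "a \<le> t \<and> t \<le> a + int n + 1"
    then consider "t = a" | "t = a + int n + 1" | "a < t" "t \<le> a + int n" by linarith
    then show "x t = B \<longleftrightarrow> t = a \<or> t = a + int n + 1"
      using g by cases (auto simp: gap_def)
  qed
next
  assume "\<forall>t. a \<le> t \<and> t \<le> a + int n + 1 \<longrightarrow> (x t = B \<longleftrightarrow> t = a \<or> t = a + int n + 1)"
  note * = this[rule_format]
  show "gap B x a n"
    unfolding gap_def using *[of a] *[of "a + int n + 1"] * by auto
qed

lemma gap_cong:
  assumes "\<And>t. 0 \<le> t \<Longrightarrow> t \<le> int n + 1 \<Longrightarrow> x (a + t) = B \<longleftrightarrow> y (b + t) = B"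
  shows "gap B x a n \<longleftrightarrow> gap B y b n"
proof -
  have *: "gap B y b n" if "gap B x a n" and eq: "\<And>t. 0 \<le> t \<Longrightarrow> t \<le> int n + 1 \<Longrightarrow> x (a + t) = B \<longleftrightarrow> y (b + t) = B" for x y a b
    unfolding gap_iff
  proof (intro allI impI)
    fix t assume t: "b \<le> t \<and> t \<le> b + int n + 1"
    then have "y t = B \<longleftrightarrow> x (a + (t - b)) = B" using eq[of "t - b"] by simp
    also have "\<dots> \<longleftrightarrow> a + (t - b) = a \<or> a + (t - b) = a + int n + 1"
      using that(1) t unfolding gap_iff by (elim allE[of _ "a + (t - b)"]) simp
    finally show "y t = B \<longleftrightarrow> t = b \<or> t = b + int n + 1" by linarith
  qed
  show ?thesis using *[of x a y b] *[of y b x a] assms by blast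
qed

lemma standard_symbol_eq_1 [simp]: "standard_symbol B v = Suc 0 \<longleftrightarrow> v = B"
  by (simp add: standard_symbol_def)

lemma standard_symbol_eq_iff:
  "standard_symbol B u = standard_symbol B v \<longleftrightarrow> (u = B \<longleftrightarrow> v = B)"
  by (simp add: standard_symbol_def)

context spokes
begin

text \<open>Condition (1) in terms of gap lengths instead of residues, the form that both dynamical
  arguments need; \<open>splits_iff_residues\<close> translates it.\<close>

definition splits :: "'i set \<Rightarrow> bool" where
  "splits W \<longleftrightarrow> W \<subseteq> T1 \<and>
     (\<exists>L. \<forall>n\<ge>L. (\<exists>i\<in>T1. gaplen i n) \<longrightarrow> (\<exists>!j. j \<in> W \<and> gaplen j n))"

lemma loop_walk:
  assumes i: "i \<in> T" "gaplen i n"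
  obtains x where "x \<in> walks E" "gap B x 0 n"
proof
  let ?x = "\<lambda>t. exc i n (nat (t mod int (n + 1)))"
  have "(?x t, ?x (t + 1)) \<in> E" for t
  proof -
    define r where "r = nat (t mod int (n + 1))"
    have t: "t mod int (n + 1) = int r" by (simp add: r_def)
    have r: "r \<le> n" using pos_mod_bound[of "int (n + 1)" t] unfolding t by simp
    have "(t + 1) mod int (n + 1) = (int r + 1) mod int (n + 1)" by (simp only: t[symmetric] mod_add_left_eq)
    also have "\<dots> = int (Suc r mod (n + 1))" by (simp only: zmod_int of_nat_Suc add.commute)
    also have "Suc r mod (n + 1) = (if r = n then 0 else Suc r)" using r by simp
    finally have "?x (t + 1) = (if r = n then exc i n 0 else exc i n (Suc r))" by simp
    then have "?x (t + 1) = exc i n (Suc r)" using exc_0[OF i(1)] exc_end[OF i] by simp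
    then show ?thesis using exc_arc[OF i r] by (simp only: t nat_int)
  qed
  then show "?x \<in> walks E" by (simp add: walks_def)
  have "?x t = exc i n (nat t)" if "0 \<le> t" "t \<le> int n" for t
    using that by (simp add: mod_pos_pos_trivial)
  moreover have "?x (int n + 1) = exc i n 0" by (simp add: add.commute)
  ultimately show "gap B ?x 0 n"
    unfolding gap_def using exc_0[OF i(1)] exc_inner[OF i] by (auto simp del: of_nat_Suc)
qed

lemma finite_to_one_splits:
  assumes Z: "Z \<subseteq> walks E" "finite A" "SFT A Z"
    and fto: "finite_to_one_on (one_block_code (standard_symbol B)) Z"
    and onto: "one_block_code (standard_symbol B) ` Z = one_block_code (standard_symbol B) ` walks E"
  shows "\<exists>W. splits W"
proof (cases "T1 = {}")
  case True
  then show ?thesis unfolding splits_def by (intro exI[of _ "{}"]) simp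
next
  case False
  let ?f = "standard_symbol B"
  have lift: "\<exists>z\<in>Z. \<forall>t. ?f (z t) = ?f (x t)" if "x \<in> walks E" for x
  proof -
    have "one_block_code ?f x \<in> one_block_code ?f ` Z" using that onto by auto
    then show ?thesis by (auto simp: one_block_code_def fun_eq_iff)
  qed
  obtain N where N: "\<And>x y p. x \<in> Z \<Longrightarrow> y \<in> Z \<Longrightarrow> (\<And>t. p \<le> t \<Longrightarrow> t < p + int N \<Longrightarrow> x t = y t) \<Longrightarrow> glue p x y \<in> Z"
    using SFT_glue[OF Z(3)] by metis
  from fto obtain K where K: "\<And>z. z \<in> Z \<Longrightarrow>
      finite {z' \<in> Z. one_block_code ?f z' = one_block_code ?f z} \<and>
      card {z' \<in> Z. one_block_code ?f z' = one_block_code ?f z} \<le> K"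
    unfolding finite_to_one_on_def by blast
  \<comment> \<open>The symbol 1 occurs over \<open>B\<close> alone, so two walks that carry it at
    \<open>p\<close> meet there and can be glued as walks; \<open>lift\<close> then provides a point
    of \<open>Z\<close> with the same image.\<close>
  interpret sync_code A Z ?f "Suc 0" N K
  proof
    fix x y p assume xy: "x \<in> Z" "y \<in> Z" "?f (x p) = Suc 0" "?f (y p) = Suc 0"
    then have "glue p x y \<in> walks E" using Z(1) by (intro walks_glue) auto
    from lift[OF this] show "\<exists>z\<in>Z. \<forall>t. ?f (z t) = ?f (glue p x y t)" .
  qed (use Z(2) SFT_range[OF Z(3)] SFT_translate[OF Z(3)] N K in \<open>auto simp: one_block_code_def fun_eq_iff\<close>)
  obtain i0 where i0: "i0 \<in> T1" using False by blast
  then have "gaplen i0 (p i0 + q i0 - 1)" using p_pos[OF i0] by (auto simp: gaplen_def)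
  then obtain x0 where "x0 \<in> walks E" "gap B x0 0 (p i0 + q i0 - 1)"
    using loop_walk[OF T1D[OF i0]] by metis
  then obtain z0 where z0: "z0 \<in> Z" "?f (z0 0) = Suc 0"
    using lift[of x0] by (auto simp: gap_def standard_symbol_def)
  obtain y u v where win: "window y u v"
    and min: "\<And>y' u' v'. window y' u' v' \<Longrightarrow> card (states y u v) \<le> card (states y' u' v')"
    using minimal_window[OF z0] by metis
  obtain a where a: "a \<in> states y u v" using win by (auto simp: window_def states_def)
  \<comment> \<open>This restates \<open>over 1\<close> with starting block \<open>a\<close> for a
    filler of length \<open>n + 1\<close>, but without mentioning the filler, so that different
    \<open>n\<close> can be compared. The two copies of the window are \<open>u + v + n + 1\<close>
    apart.\<close>
  define ov where "ov n z \<longleftrightarrow> z \<in> Z \<and> (\<forall>t. - int u \<le> t \<and> t \<le> int v \<longrightarrow> ?f (z t) = y t) \<and>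
      gap B z (int v) n \<and>
      (\<forall>t. - int u \<le> t \<and> t \<le> int v \<longrightarrow> ?f (z (t + int (u + v + n + 1))) = y t) \<and>
      block_at z 0 N = a" for n z
  have ovD: "z \<in> Z" "z \<in> walks E" "gap B z (int v) n" if "ov n z" for n z
    using that Z(1) by (auto simp: ov_def)
  have magic: "(\<exists>z. ov n z) \<and> (\<forall>z z'. ov n z \<longrightarrow> ov n z' \<longrightarrow> z (int v + 1) = z' (int v + 1))"
    if n: "\<exists>i\<in>T1. gaplen i n" for n
  proof -
    from n obtain x where x: "x \<in> walks E" "gap B x 0 n" using loop_walk T1D by metis
    from lift[OF x(1)] obtain w where w: "w \<in> Z" "\<And>t. w t = B \<longleftrightarrow> x t = B"
      by (auto simp: standard_symbol_eq_iff)
    have gw: "gap B w 0 n" using x(2) w(2) by (simp add: gap_def)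
    interpret magic_loop A Z ?f "Suc 0" N K y u v w "Suc n"
    proof
      show "?f (w 0) = Suc 0" "?f (w (int (Suc n))) = Suc 0" using gw by (auto simp: gap_def add.commute)
    qed (use win min w in auto)
    have y: "y (int v) = Suc 0" "y (- int u) = Suc 0" using win by (auto simp: window_def)
    have ov: "ov n z \<longleftrightarrow> over 1 z \<and> block_at z 0 N = a" for z
    proof
      assume z: "ov n z"
      have "?f (z t) = per t" if t: "- int u \<le> t" "t \<le> int (1 * len + v)" for t
      proof -
        consider "t \<le> int v" | "int v \<le> t" "t \<le> int v + int (Suc n)" | "int v + int (Suc n) \<le> t" by linarith
        then show ?thesis
        proof cases
          case 1
          then show ?thesis using z t per_window[OF t(1)] unfolding ov_def by metis
        next
          case 2
          then have "z t = B \<longleftrightarrow> w (t - int v) = B"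
            using ovD(3)[OF z] gw unfolding gap_iff by auto
          then show ?thesis using per_loop[OF 2] by (simp add: standard_symbol_eq_iff)
        next
          case 3
          define r where "r = t - int len"
          have r: "- int u \<le> r \<and> r \<le> int v" "t = r + int (u + v + n + 1)"
            using 3 t by (auto simp: r_def len_def)
          have "?f (z t) = y r" using z r(1) unfolding ov_def r(2) by blast
          moreover have "per t = per (r + int 1 * int len)" by (simp add: r_def)
          then have "per t = y r" using per_window[of r] r(1) unfolding per_add by simp
          ultimately show ?thesis by simp
        qed
      qed
      then show "over 1 z \<and> block_at z 0 N = a" using z unfolding over_def ov_def by blast
    next
      assume z: "over 1 z \<and> block_at z 0 N = a"
      have f: "?f (z t) = per t" if "- int u \<le> t" "t \<le> int len + int v" for t
        using z that unfolding over_def by (simp only: mult_1 of_nat_add simp_thms)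
      have B: "z t = B \<longleftrightarrow> w (t - int v) = B" if "int v \<le> t" "t \<le> int v + int (Suc n)" for t
        using f[of t] per_loop[of t] that by (simp add: standard_symbol_eq_iff len_def)
      have "gap B z (int v) n \<longleftrightarrow> gap B w 0 n" by (rule gap_cong) (use B in auto)
      then have "gap B z (int v) n" using gw by simp
      moreover have "?f (z (t + int (u + v + n + 1))) = y t" if "- int u \<le> t" "t \<le> int v" for t
      proof -
        have e: "t + int (u + v + n + 1) = t + int 1 * int len" by (simp add: len_def)
        have "?f (z (t + int 1 * int len)) = per (t + int 1 * int len)" by (rule f) (use that in auto)
        then show ?thesis unfolding e per_add using per_window[of t] that by simp
      qed
      moreover have "?f (z t) = y t" if "- int u \<le> t" "t \<le> int v" for t
        using f[of t] per_window[of t] that by simp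
      ultimately show "ov n z" using z unfolding ov_def over_def by blast
    qed
    have "z (int v + 1) = z' (int v + 1)" if "ov n z" "ov n z'" for z z'
    proof -
      have "block_at z 0 (len + N) = block_at z' 0 (len + N)"
        using that unique_continuation[of z z'] by (simp add: ov)
      moreover obtain i where "i \<in> T1" "gaplen i n" using n by blast
      \<comment> \<open>A regular excursion has at least two arcs, so the first vertex after
        \<open>B\<close> still lies in the part fixed by \<open>unique_continuation\<close>.\<close>
      then have "v + 1 < len + N" using p_pos[of i] q_pos[of i] by (auto simp: len_def gaplen_def)
      ultimately show ?thesis by (auto simp: block_at_eq_iff dest!: spec[of _ "v + 1"] simp: add.commute)
    qed
    then show ?thesis using start_state[OF a, of 1] ov by auto
  qed
  \<comment> \<open>A gap of this length through a regular spoke leaves room on the circuit for a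
    full turn and \<open>N\<close> further positions. The summand \<open>2 * d i\<close> also rules
    out degenerate spokes, whose only gap length is \<open>d i - 1\<close>.\<close>
  obtain L where L: "\<And>i. i \<in> T \<Longrightarrow> p i + q i + 2 * d i + N \<le> L"
    using finite_nat_bound[OF finite_T, of "\<lambda>i. p i + q i + 2 * d i + N"] by blast
  have pump1: "\<exists>z'. ov (n + d i) z' \<and> z' (int v + 1) = z (int v + 1)"
    if z: "ov n z" and i: "i \<in> T1" "sp (z (int v + 1)) = i" and n: "L \<le> n" for n z i
  proof -
    \<comment> \<open>The \<open>N\<close> positions from \<open>P\<close> on are the last ones
      before the rim vertex at which the circuit is left. One period earlier the walk is already on
      the circuit, so \<open>z\<close> and its translate by \<open>d i\<close> agree there and may
      be glued in \<open>Z\<close>; the effect is one additional turn.\<close>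
    define P where "P = int v + int n + 1 - int (q i) - int N"
    define z' where "z' = glue P z (translate (- int (d i)) z)"
    obtain j where j: "j \<in> T" "gaplen j n" "\<And>t. t \<le> n + 1 \<Longrightarrow> z (int v + int t) = exc j n t"
      by (rule gap_exc[OF ovD(2)[OF z] ovD(3)[OF z]]) blast
    have "n \<ge> 1" using L[OF T1D[OF i(1)]] d_pos[OF T1D[OF i(1)]] n by linarith
    have "sp (exc j n 1) = j" using exc_inner[OF j(1,2), of 1] \<open>n \<ge> 1\<close> by simp
    moreover have "z (int v + 1) = exc j n 1" using j(3)[of 1] by simp
    ultimately have "j = i" using i(2) by metis
    have Li: "p i + q i + 2 * d i + N \<le> n" using L[OF T1D[OF i(1)]] n by simp
    have dp: "0 < d i" "0 < p i" using d_pos[OF T1D[OF i(1)]] p_pos[OF i(1)] by auto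
    have P: "int v + int (p i) + int (d i) < P" using Li dp unfolding P_def by linarith
    have cc: "z (int v + int t) = cc i (int t - int (p i))" if "p i \<le> t" "t + q i \<le> n + 1" for t
    proof -
      have "t \<le> n + 1" using that by simp
      then have "z (int v + int t) = exc i n t" using j(3) \<open>j = i\<close> by simp
      also have "\<dots> = cc i (int t - int (p i))"
      proof (cases "t = p i")
        case True
        then show ?thesis using i(1) gp_p[OF i(1)] by (simp add: exc_def)
      next
        case False
        then have "\<not> t \<le> p i" using that by simp
        then show ?thesis using that(2) i(1) by (simp add: exc_def)
      qed
      finally show ?thesis .
    qed
    have periodic: "z t = z (t - int (d i))" if "P \<le> t" "t < P + int N" for t
    proof -
      define s where "s = nat (t - int v)"
      have s: "t = int v + int s" "p i + d i \<le> s" "s + q i \<le> n + 1"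
        using that P unfolding s_def P_def by auto
      have "z t = cc i (int s - int (p i))" unfolding s(1) by (rule cc) (use s in auto)
      also have "\<dots> = cc i (int (s - d i) - int (p i))" using s by (intro cc_cong T1D i) auto
      also have "\<dots> = z (int v + int (s - d i))" by (rule cc[symmetric]) (use s in auto)
      also have "int v + int (s - d i) = t - int (d i)" using s by linarith
      finally show ?thesis .
    qed
    have "z' \<in> Z"
      unfolding z'_def
      by (rule N[OF ovD(1)[OF z] translate_Z[OF ovD(1)[OF z]]]) (simp add: translate_def periodic)
    have lo: "z' t = z t" if "t < P + int N" for t
      using periodic[of t] that by (simp add: z'_def glue_def translate_def)
    have hi: "z' t = z (t - int (d i))" if "P \<le> t" for t
      using that by (simp add: z'_def glue_def translate_def)
    have "block_at z' 0 N = block_at z 0 N" unfolding block_at_eq_iff using lo P by simp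
    moreover have "block_at z 0 N = a" using z unfolding ov_def by blast
    moreover have "?f (z' t) = y t" if t: "- int u \<le> t \<and> t \<le> int v" for t
    proof -
      have "z' t = z t" by (rule lo) (use t P in linarith)
      then show ?thesis using z t unfolding ov_def by simp
    qed
    moreover have "?f (z' (t + int (u + v + (n + d i) + 1))) = y t" if t: "- int u \<le> t \<and> t \<le> int v" for t
    proof -
      have "z' (t + int (u + v + (n + d i) + 1)) = z (t + int (u + v + (n + d i) + 1) - int (d i))"
        by (rule hi) (use t in \<open>simp add: P_def\<close>)
      also have "t + int (u + v + (n + d i) + 1) - int (d i) = t + int (u + v + n + 1)" by simp
      finally show ?thesis using z t unfolding ov_def by simp
    qed
    moreover have "gap B z' (int v) (n + d i)"
      unfolding gap_iff
    proof (intro allI impI)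
      note g = ovD(3)[OF z, unfolded gap_iff, rule_format]
      fix t assume t: "int v \<le> t \<and> t \<le> int v + int (n + d i) + 1"
      show "z' t = B \<longleftrightarrow> t = int v \<or> t = int v + int (n + d i) + 1"
      proof (cases "t < P")
        case True
        then have "t < int v + int n + 1" by (simp add: P_def)
        then show ?thesis using lo[of t] g[of t] True t by auto
      next
        case False
        then have "int v < t - int (d i)" using P by linarith
        then show ?thesis using hi[of t] g[of "t - int (d i)"] False t by auto
      qed
    qed
    ultimately have "ov (n + d i) z'" using \<open>z' \<in> Z\<close> unfolding ov_def by blast
    moreover have "z' (int v + 1) = z (int v + 1)" by (rule lo) (use P dp in linarith)
    ultimately show ?thesis by blast
  qed
  have pump: "\<exists>z'. ov (n + k * d i) z' \<and> z' (int v + 1) = z (int v + 1)"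
    if z: "ov n z" and i: "i \<in> T1" "sp (z (int v + 1)) = i" and n: "L \<le> n" for n z i k
  proof (induction k)
    case (Suc k)
    then obtain z' where z': "ov (n + k * d i) z'" "z' (int v + 1) = z (int v + 1)" by blast
    have "\<exists>z''. ov (n + k * d i + d i) z'' \<and> z'' (int v + 1) = z' (int v + 1)"
      by (rule pump1[OF z'(1) i(1)]) (use z'(2) i(2) n in auto)
    then show ?case using z'(2) by (simp add: ac_simps)
  qed (use z in auto)
  define W where "W = {i \<in> T1. \<exists>n\<ge>L. \<exists>z. ov n z \<and> sp (z (int v + 1)) = i}"
  have W: "W \<subseteq> T1" by (auto simp: W_def)
  have spoke: "\<exists>j\<in>T1. gaplen j n \<and> sp (z (int v + 1)) = j" if z: "ov n z" and n: "L \<le> n" for n z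
  proof -
    obtain j where j: "j \<in> T" "gaplen j n" "\<And>t. t \<le> n + 1 \<Longrightarrow> z (int v + int t) = exc j n t"
      by (rule gap_exc[OF ovD(2)[OF z] ovD(3)[OF z]]) blast
    have Lj: "2 * d j \<le> n" "0 < d j" using L[OF j(1)] n d_pos[OF j(1)] by auto
    then have "sp (z (int v + 1)) = j" using exc_inner[OF j(1,2), of 1] j(3)[of 1] by simp
    moreover have "j \<in> T1" using j(2) Lj by (auto simp: gaplen_def split: if_splits)
    ultimately show ?thesis using j(2) by blast
  qed
  have "\<forall>i\<in>W. \<exists>nz. L \<le> fst nz \<and> ov (fst nz) (snd nz) \<and> sp (snd nz (int v + 1)) = i"
    unfolding W_def by fastforce
  from bchoice[OF this] obtain g
    where g: "\<forall>i\<in>W. L \<le> fst (g i) \<and> ov (fst (g i)) (snd (g i)) \<and> sp (snd (g i) (int v + 1)) = i" ..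
  define nn where "nn i = fst (g i)" for i
  define zz where "zz i = snd (g i)" for i
  have nz: "L \<le> nn i" "ov (nn i) (zz i)" "sp (zz i (int v + 1)) = i" if "i \<in> W" for i
    using g that by (simp_all add: nn_def zz_def)
  have "finite W" using finite_subset[OF subset_trans[OF W T1_subset] finite_T] .
  then obtain M where M: "\<And>i. i \<in> W \<Longrightarrow> nn i \<le> M"
    using finite_nat_bound[of W nn] by blast
  \<comment> \<open>The gap lengths of \<open>i\<close> form an arithmetic progression with
    difference \<open>d i\<close>, so each one beyond the witness \<open>nn i\<close> is reached by
    adding turns. \<open>M\<close> makes this uniform in \<open>i\<close>.\<close>
  have reach: "\<exists>z. ov n z \<and> z (int v + 1) = zz i (int v + 1)" if i: "i \<in> W" and n: "gaplen i n" "M \<le> n" for i n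
  proof -
    have i1: "i \<in> T1" using i W by blast
    obtain j where "gaplen j (nn i)" "sp (zz i (int v + 1)) = j"
      using spoke[OF nz(2)[OF i] nz(1)[OF i]] by blast
    then have "gaplen i (nn i)" using nz(3)[OF i] by simp
    then obtain k k' where k: "nn i + 1 = p i + q i + k * d i" "n + 1 = p i + q i + k' * d i"
      using n(1) unfolding gaplen_regular[OF i1] by blast
    have "k * d i \<le> k' * d i" using k M[OF i] n(2) by linarith
    then have "k \<le> k'" using d_pos[OF T1D[OF i1]] by simp
    then have "k' * d i = k * d i + (k' - k) * d i" by (simp flip: add_mult_distrib)
    then have "n = nn i + (k' - k) * d i" using k by linarith
    then show ?thesis using pump[OF nz(2)[OF i] i1 nz(3)[OF i] nz(1)[OF i], of "k' - k"] by (simp only:)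
  qed
  have "\<exists>!j. j \<in> W \<and> gaplen j n" if n: "max L M \<le> n" "\<exists>i\<in>T1. gaplen i n" for n
  proof -
    have LM: "L \<le> n" "M \<le> n" using n(1) by auto
    obtain z where z: "ov n z" using magic[OF n(2)] by blast
    obtain j where "j \<in> T1" "gaplen j n" "sp (z (int v + 1)) = j" using spoke[OF z LM(1)] by blast
    then have j: "j \<in> W \<and> gaplen j n" using z LM(1) unfolding W_def by blast
    \<comment> \<open>Both spokes can serve the gap from the same state \<open>a\<close>. The vertex
      after \<open>B\<close> is then determined, and it reveals the spoke.\<close>
    have eq: "i = j" if ij: "i \<in> W \<and> gaplen i n" "j \<in> W \<and> gaplen j n" for i j
    proof -
      obtain z where z: "ov n z" "z (int v + 1) = zz i (int v + 1)" using reach[of i n] ij LM(2) by blast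
      obtain z' where z': "ov n z'" "z' (int v + 1) = zz j (int v + 1)" using reach[of j n] ij LM(2) by blast
      have "z (int v + 1) = z' (int v + 1)"
        using magic[OF n(2), THEN conjunct2, rule_format, OF z(1) z'(1)] .
      then have eq: "zz i (int v + 1) = zz j (int v + 1)" unfolding z(2) z'(2) .
      have "i = sp (zz i (int v + 1))" by (rule nz(3)[symmetric]) (rule ij(1)[THEN conjunct1])
      also have "\<dots> = j" unfolding eq by (rule nz(3)) (rule ij(2)[THEN conjunct1])
      finally show ?thesis .
    qed
    show ?thesis by (rule ex1I) (rule j, erule eq[OF _ j])
  qed
  then have "\<forall>n\<ge>max L M. (\<exists>i\<in>T1. gaplen i n) \<longrightarrow> (\<exists>!j. j \<in> W \<and> gaplen j n)" by blast
  then have "splits W" unfolding splits_def using W by (intro conjI exI)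
  then show ?thesis ..
qed

end

section \<open>The subshift given by a choice of spokes\<close>

lemma last_before:
  fixes t :: int
  assumes "P s" "s \<le> t"
  obtains a where "s \<le> a" "a \<le> t" "P a" "\<And>r. a < r \<Longrightarrow> r \<le> t \<Longrightarrow> \<not> P r"
proof -
  have "\<exists>k. P (t - int k)" using assms by (intro exI[of _ "nat (t - s)"]) simp
  define k where "k = (LEAST k. P (t - int k))"
  have k: "P (t - int k)" unfolding k_def by (rule LeastI_ex) fact
  have min: "k \<le> j" if "P (t - int j)" for j unfolding k_def using that by (rule Least_le)
  show thesis
  proof (rule that[of "t - int k"])
    show "s \<le> t - int k" using min[of "nat (t - s)"] assms by simp
    fix r assume "t - int k < r" "r \<le> t"
    then show "\<not> P r" using min[of "nat (t - r)"] by auto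
  qed (use k in auto)
qed

lemma next_after:
  fixes t :: int
  assumes "P s" "t \<le> s"
  obtains b where "b \<le> s" "t \<le> b" "P b" "\<And>r. t \<le> r \<Longrightarrow> r < b \<Longrightarrow> \<not> P r"
proof -
  have "P (- (- s))" using assms by simp
  then obtain a where a: "- s \<le> a" "a \<le> - t" "P (- a)" "\<And>r. a < r \<Longrightarrow> r \<le> - t \<Longrightarrow> \<not> P (- r)"
    using last_before[of "\<lambda>r. P (- r)" "- s" "- t"] assms(2) by auto
  show thesis
  proof (rule that[of "- a"])
    fix r assume "t \<le> r" "r < - a"
    then show "\<not> P r" using a(4)[of "- r"] by simp
  qed (use a in auto)
qed

lemma enclosing_gap:
  assumes "x s = B" "s \<le> t" "x s' = B" "t < s'"
  obtains a n where "gap B x a n" "s \<le> a" "a \<le> t" "t \<le> a + int n" "a + int n + 1 \<le> s'"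
proof -
  obtain a where a: "s \<le> a" "a \<le> t" "x a = B" "\<And>r. a < r \<Longrightarrow> r \<le> t \<Longrightarrow> x r \<noteq> B"
    using last_before[of "\<lambda>r. x r = B" s t] assms(1,2) by blast
  obtain b where b: "b \<le> s'" "t + 1 \<le> b" "x b = B" "\<And>r. t + 1 \<le> r \<Longrightarrow> r < b \<Longrightarrow> x r \<noteq> B"
    using next_after[of "\<lambda>r. x r = B" s' "t + 1"] assms(3,4) by auto
  define n where "n = nat (b - a - 1)"
  have n: "a + int n + 1 = b" using a b by (simp add: n_def)
  have "gap B x a n"
    unfolding gap_def n
  proof (intro conjI allI impI)
    fix r assume "a < r \<and> r \<le> a + int n"
    then show "x r \<noteq> B" using a(4)[of r] b(4)[of r] n by (cases "r \<le> t") auto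
  qed (use a b in auto)
  then show thesis by (rule that) (use a b n in auto)
qed

lemma gap_reversed: "gap B (\<lambda>t. x (- t)) a n \<longleftrightarrow> gap B x (- a - int n - 1) n"
proof -
  have *: "gap B x (- a - int n - 1) n" if "gap B (\<lambda>t. x (- t)) a n" for x :: "int \<Rightarrow> 'a" and a
    unfolding gap_iff
  proof (intro allI impI)
    fix t assume "- a - int n - 1 \<le> t \<and> t \<le> - a - int n - 1 + int n + 1"
    then have "a \<le> - t \<and> - t \<le> a + int n + 1" by simp
    from that[unfolded gap_iff, rule_format, OF this]
    show "x t = B \<longleftrightarrow> t = - a - int n - 1 \<or> t = - a - int n - 1 + int n + 1" by auto
  qed
  show ?thesis using *[of x a] *[of "\<lambda>t. x (- t)" "- a - int n - 1"] by auto
qed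

context spokes
begin

text \<open>The ray of the reversed graph in the original coordinates; \<open>t\<close> counts the
  steps left until \<open>B\<close>.\<close>

definition back_ray :: "'i \<Rightarrow> nat \<Rightarrow> 'v" where
  "back_ray i t = (if t \<le> q i then gm i (q i - t) else cc i (int (q i) - int t))"

lemma ray_reversed:
  "spokes.ray q (\<lambda>i t. gm i (q i - t)) (\<lambda>i t. cc i (- t)) = back_ray"
proof -
  interpret rev: spokes "E\<inverse>" B T T1 q p d "\<lambda>i t. gm i (q i - t)" "\<lambda>i t. gp i (p i - t)" "\<lambda>i t. cc i (- t)" sp
    by (rule reversed)
  show ?thesis by (intro ext) (simp add: rev.ray_def back_ray_def)
qed

lemma gaplen_reversed: "spokes.gaplen T1 q p d = gaplen"
proof -
  interpret rev: spokes "E\<inverse>" B T T1 q p d "\<lambda>i t. gm i (q i - t)" "\<lambda>i t. gp i (p i - t)" "\<lambda>i t. cc i (- t)" sp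
    by (rule reversed)
  show ?thesis by (intro ext) (simp only: rev.gaplen_def gaplen_def add.commute[of "q _" "p _"])
qed

lemma back_ray_arc: "i \<in> T1 \<Longrightarrow> (back_ray i (Suc t), back_ray i t) \<in> E"
  using spokes.ray_arc[OF reversed] unfolding ray_reversed by simp

lemma back_ray_0: "i \<in> T1 \<Longrightarrow> back_ray i 0 = B"
  using spokes.ray_0[OF reversed] unfolding ray_reversed by simp

lemma back_ray_inner: "i \<in> T1 \<Longrightarrow> 0 < t \<Longrightarrow> back_ray i t \<noteq> B \<and> sp (back_ray i t) = i"
  using spokes.ray_inner[OF reversed] unfolding ray_reversed by simp

end

text \<open>\<open>c_unique\<close> is where uniqueness enters: it lets the locally visible property
  of lying in \<open>W\<close> enforce the choice \<open>c n\<close>, which depends on the whole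
  gap. \<open>W_nonempty\<close> provides a spoke for tails, which belong to no gap.\<close>

locale choice = spokes +
  fixes W :: "'b set" and L :: nat and c :: "nat \<Rightarrow> 'b"
  assumes L_pos: "0 < L"
    and W_subset: "W \<subseteq> T1" and W_nonempty: "T1 \<noteq> {} \<Longrightarrow> W \<noteq> {}"
    and c_gaplen: "i \<in> T \<Longrightarrow> gaplen i n \<Longrightarrow> c n \<in> T \<and> gaplen (c n) n"
    and c_in_W: "i \<in> T \<Longrightarrow> gaplen i n \<Longrightarrow> L \<le> n \<Longrightarrow> c n \<in> W"
    and c_unique: "i \<in> W \<Longrightarrow> gaplen i n \<Longrightarrow> L \<le> n \<Longrightarrow> i = c n"
    and T_nonempty: "T \<noteq> {}"
begin

text \<open>The length of a long gap is invisible to a bounded window, so \<open>c n\<close> is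
  prescribed for short gaps only. The rule about \<open>L\<close> consecutive vertices takes care of
  long gaps and also of tails.\<close>

definition Z :: "(int \<Rightarrow> 'a) set" where
  "Z = {x \<in> walks E.
     (\<forall>a n. n < L \<longrightarrow> gap B x a n \<longrightarrow> (\<forall>t. a < t \<and> t \<le> a + int n \<longrightarrow> sp (x t) = c n)) \<and>
     (\<forall>a. (\<forall>t. a \<le> t \<and> t < a + int L \<longrightarrow> x t \<noteq> B) \<longrightarrow> (\<forall>t. a \<le> t \<and> t < a + int L \<longrightarrow> sp (x t) \<in> W))}"

lemma Z_walk: "x \<in> Z \<Longrightarrow> x \<in> walks E" by (simp add: Z_def)

lemma Z_short_gap: "x \<in> Z \<Longrightarrow> gap B x a n \<Longrightarrow> n < L \<Longrightarrow> a < t \<Longrightarrow> t \<le> a + int n \<Longrightarrow> sp (x t) = c n"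
  unfolding Z_def by blast

lemma Z_run: "x \<in> Z \<Longrightarrow> (\<And>t. a \<le> t \<Longrightarrow> t < a + int L \<Longrightarrow> x t \<noteq> B) \<Longrightarrow> a \<le> t \<Longrightarrow> t < a + int L \<Longrightarrow> sp (x t) \<in> W"
  unfolding Z_def by blast

lemma ZI:
  assumes "x \<in> walks E"
    and "\<And>a n t. n < L \<Longrightarrow> gap B x a n \<Longrightarrow> a < t \<Longrightarrow> t \<le> a + int n \<Longrightarrow> sp (x t) = c n"
    and "\<And>a t. (\<And>t. a \<le> t \<Longrightarrow> t < a + int L \<Longrightarrow> x t \<noteq> B) \<Longrightarrow> a \<le> t \<Longrightarrow> t < a + int L \<Longrightarrow> sp (x t) \<in> W"
  shows "x \<in> Z"
  unfolding Z_def using assms by blast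

text \<open>The gap lengths of a spoke are symmetric in \<open>p\<close> and \<open>q\<close>, so
  the same choice serves the reversed graph.\<close>

lemma reversed_choice:
  "choice (E\<inverse>) B T T1 q p d (\<lambda>i t. gm i (q i - t)) (\<lambda>i t. gp i (p i - t)) (\<lambda>i t. cc i (- t)) sp W L c"
proof -
  interpret rev: spokes "E\<inverse>" B T T1 q p d "\<lambda>i t. gm i (q i - t)" "\<lambda>i t. gp i (p i - t)" "\<lambda>i t. cc i (- t)" sp
    by (rule reversed)
  show ?thesis
    by unfold_locales (unfold gaplen_reversed, (fact L_pos W_subset W_nonempty c_gaplen c_in_W c_unique T_nonempty)+)
qed

lemma Z_reversed:
  assumes x: "x \<in> Z"
  shows "(\<lambda>t. x (- t)) \<in> choice.Z (E\<inverse>) B sp W L c"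
proof -
  interpret rev: choice "E\<inverse>" B T T1 q p d "\<lambda>i t. gm i (q i - t)" "\<lambda>i t. gp i (p i - t)" "\<lambda>i t. cc i (- t)" sp W L c
    by (rule reversed_choice)
  show ?thesis
  proof (rule rev.ZI)
    show "(\<lambda>t. x (- t)) \<in> walks (E\<inverse>)" by (rule walks_reversed[OF Z_walk[OF x]])
  next
    fix a n t assume "n < L" "gap B (\<lambda>t. x (- t)) a n" "a < t" "t \<le> a + int n"
    then show "sp (x (- t)) = c n"
      using Z_short_gap[OF x, of "- a - int n - 1" n "- t"] by (simp add: gap_reversed)
  next
    fix a t assume *: "\<And>t. a \<le> t \<Longrightarrow> t < a + int L \<Longrightarrow> x (- t) \<noteq> B" and t: "a \<le> t" "t < a + int L"
    show "sp (x (- t)) \<in> W"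
    proof (rule Z_run[OF x, of "- a - int L + 1"])
      fix r assume "- a - int L + 1 \<le> r" "r < - a - int L + 1 + int L"
      then show "x r \<noteq> B" using *[of "- r"] by simp
    qed (use t in auto)
  qed
qed

text \<open>A short gap uses \<open>c n\<close> by the first rule. A long one contains
  \<open>L\<close> consecutive vertices without \<open>B\<close>, so its spoke lies in
  \<open>W\<close>, and \<open>c_unique\<close> turns this into equality.\<close>

lemma Z_gap:
  assumes x: "x \<in> Z" and g: "gap B x a n" and t: "t \<le> n + 1"
  shows "x (a + int t) = exc (c n) n t"
proof -
  obtain i where i: "i \<in> T" "gaplen i n" "\<And>t. t \<le> n + 1 \<Longrightarrow> x (a + int t) = exc i n t"
    by (rule gap_exc[OF Z_walk[OF x] g]) blast
  show ?thesis
  proof (cases "n = 0")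
    \<comment> \<open>A gap of length 0 has no inner vertex that would reveal the spoke, but both of
      its positions are \<open>B\<close>.\<close>
    case True
    have c: "c n \<in> T" "gaplen (c n) n" using c_gaplen[OF i(1,2)] by auto
    consider "t = 0" | "t = n + 1" using t True by linarith
    then show ?thesis
    proof cases
      case 1
      then show ?thesis using g exc_0[OF c(1)] by (simp add: gap_def)
    next
      case 2
      then have "a + int t = a + int n + 1" by simp
      then have "x (a + int t) = B" using g unfolding gap_def by (simp only:)
      then show ?thesis using exc_end[OF c] 2 by simp
    qed
  next
    case False
    then have sp: "sp (x (a + 1)) = i" using i(3)[of 1] exc_inner[OF i(1,2), of 1] by simp
    have "i = c n"
    proof (cases "n < L")
      case True
      then show ?thesis using Z_short_gap[OF x g True, of "a + 1"] sp False by simp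
    next
      case n: False
      have "sp (x (a + 1)) \<in> W"
      proof (rule Z_run[OF x, of "a + 1"])
        fix r assume "a + 1 \<le> r" "r < a + 1 + int L"
        then have "a < r \<and> r \<le> a + int n" using n by linarith
        then show "x r \<noteq> B" using g unfolding gap_def by blast
      qed (use L_pos in auto)
      then show ?thesis using sp c_unique i(2) n by simp
    qed
    then show ?thesis using i(3) t by simp
  qed
qed

section \<open>How far the image determines a point of the subshift\<close>

lemma Z_eq_between:
  assumes x: "x \<in> Z" and x': "x' \<in> Z" and s: "x s = B" "x s' = B"
    and eq: "\<And>t. s \<le> t \<Longrightarrow> t \<le> s' \<Longrightarrow> x t = B \<longleftrightarrow> x' t = B" and t: "s \<le> t" "t \<le> s'"
  shows "x t = x' t"
proof (cases "t = s'")
  case True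
  then show ?thesis using s eq t by simp
next
  case False
  then have "t < s'" using t by simp
  from enclosing_gap[where x = x and B = B, OF s(1) t(1) s(2) this]
  obtain a n where a: "gap B x a n" "s \<le> a" "a \<le> t" "t \<le> a + int n" "a + int n + 1 \<le> s'" .
  have "gap B x a n \<longleftrightarrow> gap B x' a n" by (rule gap_cong, rule eq) (use a in auto)
  then have "gap B x' a n" using a(1) by simp
  then show ?thesis using Z_gap[OF x a(1), of "nat (t - a)"] Z_gap[OF x', of a n "nat (t - a)"] a(3,4) by simp
qed

lemma Z_tail_W:
  assumes x: "x \<in> Z" and i: "sp (x t) = i" and nB: "\<And>r. t \<le> r \<Longrightarrow> x r \<noteq> B"
  shows "i \<in> W"
  using Z_run[OF x, of t t] nB L_pos i by simp

text \<open>A tail is the ray of one spoke, and its first vertex reveals which one.\<close>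

lemma Z_eq_after:
  assumes x: "x \<in> Z" and x': "x' \<in> Z" and a: "x a = B" "x' a = B"
    and nB: "\<And>t. a < t \<Longrightarrow> x t \<noteq> B" "\<And>t. a < t \<Longrightarrow> x' t \<noteq> B"
    and 1: "x (a + 1) = x' (a + 1)" and t: "a \<le> t"
  shows "x t = x' t"
proof -
  obtain i where i: "i \<in> T1" "\<And>t. x (a + int t) = ray i t"
    by (rule right_ray[OF Z_walk[OF x] a(1) nB(1)]) blast+
  obtain j where j: "j \<in> T1" "\<And>t. x' (a + int t) = ray j t"
    by (rule right_ray[OF Z_walk[OF x'] a(2) nB(2)]) blast+
  have "i = sp (ray i 1)" using ray_inner[OF i(1), of 1] by simp
  also have "ray i 1 = ray j 1" using i(2)[of 1] j(2)[of 1] 1 by simp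
  also have "sp \<dots> = j" using ray_inner[OF j(1), of 1] by simp
  finally have "i = j" .
  then show ?thesis using i(2)[of "nat (t - a)"] j(2)[of "nat (t - a)"] t by simp
qed

lemma Z_eq_before:
  assumes x: "x \<in> Z" and x': "x' \<in> Z" and a: "x a = B" "x' a = B"
    and nB: "\<And>t. t < a \<Longrightarrow> x t \<noteq> B" "\<And>t. t < a \<Longrightarrow> x' t \<noteq> B"
    and 1: "x (a - 1) = x' (a - 1)" and t: "t \<le> a"
  shows "x t = x' t"
proof -
  interpret rev: choice "E\<inverse>" B T T1 q p d "\<lambda>i t. gm i (q i - t)" "\<lambda>i t. gp i (p i - t)" "\<lambda>i t. cc i (- t)" sp W L c
    by (rule reversed_choice)
  have "x (- (- t)) = x' (- (- t))"
    by (rule rev.Z_eq_after[OF Z_reversed[OF x] Z_reversed[OF x'], of "- a" "- t"]) (use a nB 1 t in auto)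
  then show ?thesis by simp
qed

lemma Z_eq_never:
  assumes x: "x \<in> Z" and x': "x' \<in> Z" and nB: "\<And>t. x t \<noteq> B" "\<And>t. x' t \<noteq> B" and 0: "x 0 = x' 0"
  shows "x t = x' t"
proof -
  obtain i s where i: "i \<in> T1" "\<And>t. x t = cc i (s + t)" by (rule never_B[OF Z_walk[OF x] nB(1)]) blast+
  obtain j r where j: "j \<in> T1" "\<And>t. x' t = cc j (r + t)" by (rule never_B[OF Z_walk[OF x'] nB(2)]) blast+
  have *: "cc i s = cc j r" using i(2)[of 0] j(2)[of 0] 0 by simp
  have "i = sp (cc i s)" using sp_cc[OF i(1)] by simp
  also have "\<dots> = j" unfolding * using sp_cc[OF j(1)] by simp
  finally have ij: "j = i" by simp
  have "[s = r] (mod int (d i))" using * unfolding ij cc_eq_iff[OF T1D[OF i(1)]] .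
  then have "[s + t = r + t] (mod int (d i))" by (simp add: cong_add_rcancel)
  then have "cc i (s + t) = cc i (r + t)" unfolding cc_eq_iff[OF T1D[OF i(1)]] .
  then show ?thesis unfolding i(2) j(2) ij .
qed

lemma Z_translate: "x \<in> Z \<Longrightarrow> translate k x \<in> Z"
proof (rule ZI)
  assume x: "x \<in> Z"
  show "translate k x \<in> walks E" by (rule walks_translate[OF Z_walk[OF x]])
  fix a n t assume "n < L" "gap B (translate k x) a n" "a < t" "t \<le> a + int n"
  moreover have "gap B (translate k x) a n \<longleftrightarrow> gap B x (a + k) n"
    by (rule gap_cong) (simp add: translate_def ac_simps)
  ultimately show "sp (translate k x t) = c n"
    using Z_short_gap[OF x, of "a + k" n "t + k"] by (simp add: translate_def)
next
  fix a t assume x: "x \<in> Z" and *: "\<And>t. a \<le> t \<Longrightarrow> t < a + int L \<Longrightarrow> translate k x t \<noteq> B" and t: "a \<le> t" "t < a + int L"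
  show "sp (translate k x t) \<in> W"
    unfolding translate_def
  proof (rule Z_run[OF x, of "a + k"])
    fix r assume "a + k \<le> r" "r < a + k + int L"
    then show "x r \<noteq> B" using *[of "r - k"] by (simp add: translate_def)
  qed (use t in auto)
qed

text \<open>Both rules defining \<open>Z\<close> concern stretches without \<open>B\<close> inside,
  and no such stretch can straddle \<open>e\<close>.\<close>

lemma Z_glue:
  assumes x: "x \<in> Z" and y: "y \<in> Z" and e: "x e = B" "y e = B"
  shows "glue e x y \<in> Z"
proof (rule ZI)
  have lo: "glue e x y t = x t" if "t \<le> e" for t using that e by (simp add: glue_def)
  have hi: "glue e x y t = y t" if "e \<le> t" for t using that by (simp add: glue_def)
  show "glue e x y \<in> walks E" by (rule walks_glue[OF Z_walk[OF x] Z_walk[OF y]]) (use e in simp)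
  fix a n t assume n: "n < L" and g: "gap B (glue e x y) a n" and t: "a < t" "t \<le> a + int n"
  have "\<not> (a < e \<and> e \<le> a + int n)"
  proof
    assume "a < e \<and> e \<le> a + int n"
    then have "glue e x y e \<noteq> B" using g unfolding gap_def by blast
    then show False using e hi[of e] by simp
  qed
  then consider "e \<le> a" | "a + int n + 1 \<le> e" by linarith
  then show "sp (glue e x y t) = c n"
  proof cases
    case 1
    have "gap B (glue e x y) a n \<longleftrightarrow> gap B y a n" by (rule gap_cong) (use hi 1 in simp)
    then show ?thesis using Z_short_gap[OF y _ n t] g hi[of t] 1 t by simp
  next
    case 2
    have "gap B (glue e x y) a n \<longleftrightarrow> gap B x a n" by (rule gap_cong) (use lo 2 in simp)
    then show ?thesis using Z_short_gap[OF x _ n t] g lo[of t] 2 t by simp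
  qed
next
  have lo: "glue e x y t = x t" if "t \<le> e" for t using that e by (simp add: glue_def)
  have hi: "glue e x y t = y t" if "e \<le> t" for t using that by (simp add: glue_def)
  fix a t assume *: "\<And>t. a \<le> t \<Longrightarrow> t < a + int L \<Longrightarrow> glue e x y t \<noteq> B" and t: "a \<le> t" "t < a + int L"
  have "\<not> (a \<le> e \<and> e < a + int L)" using *[of e] e hi[of e] by auto
  then consider "e < a" | "a + int L \<le> e" by linarith
  then show "sp (glue e x y t) \<in> W"
  proof cases
    case 1
    have "sp (y t) \<in> W"
    proof (rule Z_run[OF y, of a])
      fix r assume "a \<le> r" "r < a + int L"
      then show "y r \<noteq> B" using *[of r] hi[of r] 1 by simp
    qed (use t in auto)
    then show ?thesis using hi[of t] 1 t by simp
  next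
    case 2
    have "sp (x t) \<in> W"
    proof (rule Z_run[OF x, of a])
      fix r assume "a \<le> r" "r < a + int L"
      then show "x r \<noteq> B" using *[of r] lo[of r] 2 by simp
    qed (use t in auto)
    then show ?thesis using lo[of t] 2 t by simp
  qed
qed

end

lemma gap_unique:
  assumes "gap B x a n" "gap B x a' n'" "a \<le> t" "t \<le> a + int n" "a' \<le> t" "t \<le> a' + int n'"
  shows "a = a' \<and> n = n'"
proof -
  have *: "\<not> a < a'" if "gap B x a n" "gap B x a' n'" "a' \<le> t" "t \<le> a + int n" for a n a' n'
  proof
    assume "a < a'"
    then have "x a' \<noteq> B" using that unfolding gap_def by auto
    then show False using that(2) by (simp add: gap_def)
  qed
  have a: "a = a'" using *[OF assms(1,2)] *[OF assms(2,1)] assms by force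
  have *: "\<not> n < n'" if "gap B x a n" "gap B x a n'" for n n'
  proof
    assume "n < n'"
    then have "x (a + int n + 1) \<noteq> B" using that(2) unfolding gap_def by auto
    then show False using that(1) by (simp add: gap_def)
  qed
  have "n = n'" using *[of n n'] *[of n' n] assms(1,2) a by force
  with a show ?thesis by simp
qed

section \<open>Lifting every point of the image\<close>

context choice
begin

lemma c_gap:
  assumes "x \<in> walks E" "gap B x a n"
  shows "c n \<in> T" "gaplen (c n) n" "L \<le> n \<Longrightarrow> c n \<in> W"
proof -
  obtain i where "i \<in> T" "gaplen i n" by (rule gap_exc[OF assms]) blast
  then show "c n \<in> T" "gaplen (c n) n" "L \<le> n \<Longrightarrow> c n \<in> W" using c_gaplen c_in_W by auto
qed

lemma T1_nonempty:
  assumes x: "x \<in> walks E" and nB: "(\<forall>r>t. x r \<noteq> B) \<or> (\<forall>r<t. x r \<noteq> B)"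
  shows "T1 \<noteq> {}"
  using nB
proof
  assume *: "\<forall>r>t. x r \<noteq> B"
  obtain i where "i \<in> T1" by (rule tail[OF x, of "t + 1"]) (use * in auto)
  then show ?thesis by blast
next
  assume *: "\<forall>r<t. x r \<noteq> B"
  obtain i where "i \<in> T1" by (rule spokes.tail[OF reversed walks_reversed[OF x], of "- t + 1"]) (use * in auto)
  then show ?thesis by blast
qed

text \<open>Only the positions of \<open>B\<close> in \<open>x\<close> are kept. Gaps are refilled
  with the chosen excursions; tails, and points without \<open>B\<close>, are sent along one spoke
  \<open>i0\<close> of \<open>W\<close>.\<close>

lemma Z_onto:
  assumes x: "x \<in> walks E"
  obtains z where "z \<in> Z" "\<And>t. z t = B \<longleftrightarrow> x t = B"
proof -
  \<comment> \<open>If \<open>W\<close> is empty this is a meaningless default. It is used only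
    where \<open>x\<close> has a tail, and then \<open>T1_nonempty\<close> and
    \<open>W_nonempty\<close> guarantee a member of \<open>W\<close>.\<close>
  define i0 where "i0 = (SOME i. i \<in> W)"
  have i0: "i0 \<in> W" "i0 \<in> T1" "i0 \<in> T" if "(\<forall>r>t. x r \<noteq> B) \<or> (\<forall>r<t. x r \<noteq> B)" for t
  proof -
    have "W \<noteq> {}" using T1_nonempty[OF x that] W_nonempty by blast
    then show "i0 \<in> W" unfolding i0_def using some_in_eq by blast
    then show "i0 \<in> T1" "i0 \<in> T" using W_subset T1_subset by auto
  qed
  \<comment> \<open>The \<open>B\<close> at the left end is counted to the gap or ray that starts
    there, never the one at the right end. So the cases gap, right tail, left tail and no
    \<open>B\<close> at all exclude each other.\<close>
  define G where "G t an \<longleftrightarrow> gap B x (fst an) (snd an) \<and> fst an \<le> t \<and> t \<le> fst an + int (snd an)" for t an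
  define R where "R t a \<longleftrightarrow> x a = B \<and> a \<le> t \<and> (\<forall>r>a. x r \<noteq> B)" for t a
  define Q where "Q t b \<longleftrightarrow> x b = B \<and> t < b \<and> (\<forall>r<b. x r \<noteq> B)" for t b
  define z where "z t =
    (if \<exists>an. G t an then let an = SOME an. G t an in exc (c (snd an)) (snd an) (nat (t - fst an))
     else if \<exists>a. R t a then ray i0 (nat (t - (SOME a. R t a)))
     else if \<exists>b. Q t b then back_ray i0 (nat ((SOME b. Q t b) - t))
     else cc i0 t)" for t
  have notGR: "\<not> G t an" if "R t a" for t an a
  proof
    assume G: "G t an"
    let ?b = "fst an + int (snd an) + 1"
    have "x ?b = B" "a < ?b" using G that by (auto simp: G_def R_def gap_def)
    then show False using that by (simp add: R_def)
  qed
  have notQ: "\<not> G t an" "\<not> R t a" if "Q t b" for t an a b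
  proof -
    show "\<not> G t an"
    proof
      assume G: "G t an"
      then have "x (fst an) = B" "fst an < b" using that by (auto simp: G_def Q_def gap_def)
      then show False using that by (simp add: Q_def)
    qed
    show "\<not> R t a"
    proof
      assume "R t a"
      then have "x a = B" "a < b" using that by (auto simp: R_def Q_def)
      then show False using that by (simp add: Q_def)
    qed
  qed
  have zG: "z t = exc (c n) n (nat (t - a))" if "gap B x a n" "a \<le> t" "t \<le> a + int n" for t a n
  proof -
    have G: "G t (a, n)" using that by (simp add: G_def)
    then have S: "G t (SOME an. G t an)" by (rule someI)
    obtain b m where bm: "(SOME an. G t an) = (b, m)" by (rule prod.exhaust)
    have "G t (b, m)" using S unfolding bm .
    then have "gap B x b m" "b \<le> t" "t \<le> b + int m" unfolding G_def fst_conv snd_conv by blast+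
    then have "b = a \<and> m = n" using gap_unique[OF _ that(1)] that(2,3) by blast
    then have an: "(SOME an. G t an) = (a, n)" using bm by simp
    have "\<exists>an. G t an" using G by (rule exI)
    then show ?thesis unfolding z_def an by (simp only: if_True Let_def fst_conv snd_conv)
  qed
  have zR: "z t = ray i0 (nat (t - a))" if R: "R t a" for t a
  proof -
    have S: "R t (SOME a. R t a)" using R by (rule someI)
    have "\<not> (SOME a. R t a) < a" "\<not> a < (SOME a. R t a)" using S R unfolding R_def by blast+
    then have a: "(SOME a. R t a) = a" by linarith
    have "\<not> (\<exists>an. G t an)" "\<exists>a. R t a" using notGR[OF R] R by blast+
    then show ?thesis unfolding z_def a by (simp only: if_True if_False)
  qed
  have zQ: "z t = back_ray i0 (nat (b - t))" if Q: "Q t b" for t b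
  proof -
    have S: "Q t (SOME b. Q t b)" using Q by (rule someI)
    have "\<not> (SOME b. Q t b) < b" "\<not> b < (SOME b. Q t b)" using S Q unfolding Q_def by blast+
    then have b: "(SOME b. Q t b) = b" by linarith
    have "\<not> (\<exists>an. G t an)" "\<not> (\<exists>a. R t a)" "\<exists>b. Q t b" using notQ[OF Q] Q by blast+
    then show ?thesis unfolding z_def b by (simp only: if_True if_False)
  qed
  have zN: "z t = cc i0 t" if "\<forall>r. x r \<noteq> B" for t
  proof -
    have "\<not> (\<exists>an. G t an)" "\<not> (\<exists>a. R t a)" "\<not> (\<exists>b. Q t b)" using that by (auto simp: G_def R_def Q_def gap_def)
    then show ?thesis unfolding z_def by (simp only: if_False)
  qed
  have cases: thesis
    if "\<And>a n. gap B x a n \<Longrightarrow> a \<le> t \<Longrightarrow> t \<le> a + int n \<Longrightarrow> thesis" "\<And>a. R t a \<Longrightarrow> thesis"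
      "\<And>b. Q t b \<Longrightarrow> thesis" "\<forall>r. x r \<noteq> B \<Longrightarrow> thesis" for t thesis
  proof (cases "\<exists>s\<le>t. x s = B"; cases "\<exists>s>t. x s = B")
    assume "\<exists>s\<le>t. x s = B" "\<exists>s>t. x s = B"
    then obtain s s' where "x s = B" "s \<le> t" "x s' = B" "t < s'" by blast
    from enclosing_gap[where x = x and B = B, OF this] show thesis using that(1) by metis
  next
    assume "\<exists>s\<le>t. x s = B" and right: "\<not> (\<exists>s>t. x s = B)"
    then obtain s where s: "x s = B" "s \<le> t" by blast
    obtain a where a: "a \<le> t" "x a = B" "\<And>r. a < r \<Longrightarrow> r \<le> t \<Longrightarrow> x r \<noteq> B"
      using last_before[of "\<lambda>r. x r = B" s t] s by blast
    then have "R t a" unfolding R_def using right by (meson not_less)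
    then show thesis by (rule that(2))
  next
    assume left: "\<not> (\<exists>s\<le>t. x s = B)" and "\<exists>s>t. x s = B"
    then obtain s where s: "x s = B" "t \<le> s" by force
    obtain b where b: "t \<le> b" "x b = B" "\<And>r. t \<le> r \<Longrightarrow> r < b \<Longrightarrow> x r \<noteq> B"
      using next_after[of "\<lambda>r. x r = B" s t] s by blast
    moreover have "t \<noteq> b" using b(2) left by blast
    ultimately have "Q t b" unfolding Q_def using left by (meson not_le order_le_less)
    then show thesis by (rule that(3))
  next
    assume *: "\<not> (\<exists>s\<le>t. x s = B)" "\<not> (\<exists>s>t. x s = B)"
    have "\<forall>r. x r \<noteq> B"
    proof
      fix r show "x r \<noteq> B" using * by (cases "r \<le> t") (blast, metis not_le)
    qed
    then show thesis by (rule that(4))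
  qed
  have zB: "z t = B" if t: "x t = B" for t
  proof (rule cases[of t])
    fix a n assume g: "gap B x a n" "a \<le> t" "t \<le> a + int n"
    then have "t = a" using t unfolding gap_def by (metis order_le_less)
    then show ?thesis using zG[OF g] exc_0[OF c_gap(1)[OF x g(1)]] by simp
  next
    fix a assume R: "R t a"
    then have "t = a" using t unfolding R_def by (metis order_le_less)
    moreover have "i0 \<in> T1" using i0(2)[of a] R unfolding R_def by blast
    ultimately show ?thesis using zR[OF R] ray_0 by simp
  next
    fix b assume "Q t b" then show ?thesis using t unfolding Q_def by blast
  qed (use t in blast)
  have sp_z: "z t \<noteq> B \<and> sp (z t) \<in> W" if t: "x t \<noteq> B" and G: "\<not> (\<exists>a n. gap B x a n \<and> a \<le> t \<and> t \<le> a + int n)" for t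
  proof (rule cases[of t])
    fix a assume R: "R t a"
    then have "0 < nat (t - a)" using t by (auto simp: R_def order_le_less)
    moreover have "i0 \<in> T1" "i0 \<in> W" using i0(1,2)[of a] R unfolding R_def by blast+
    ultimately show ?thesis using zR[OF R] ray_inner[of i0 "nat (t - a)"] by simp
  next
    fix b assume Q: "Q t b"
    then have "0 < nat (b - t)" by (simp add: Q_def)
    moreover have "i0 \<in> T1" "i0 \<in> W" using i0(1,2)[of b] Q unfolding Q_def by blast+
    ultimately show ?thesis using zQ[OF Q] back_ray_inner[of i0 "nat (b - t)"] by simp
  next
    assume N: "\<forall>r. x r \<noteq> B"
    then have "i0 \<in> T1" "i0 \<in> W" using i0(1,2) by blast+
    then show ?thesis using zN[OF N] sp_cc by simp
  qed (use G in blast)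
  have inner: "z t \<noteq> B \<and> sp (z t) = c n" if g: "gap B x a n" "a < t" "t \<le> a + int n" for t a n
    using zG[OF g(1), of t] exc_inner[OF c_gap(1,2)[OF x g(1)], of "nat (t - a)"] g(2,3) by simp
  have z_iff: "z t = B \<longleftrightarrow> x t = B" for t
  proof
    assume "z t = B"
    show "x t = B"
    proof (rule ccontr)
      assume nB: "x t \<noteq> B"
      with \<open>z t = B\<close> sp_z obtain a n where g: "gap B x a n" "a \<le> t" "t \<le> a + int n" by blast
      moreover have "a \<noteq> t" using g(1) nB unfolding gap_def by blast
      ultimately show False using inner[OF g(1), of t] \<open>z t = B\<close> by simp
    qed
  qed (rule zB)
  have arcs: "(z t, z (t + 1)) \<in> E" for t
  proof (rule cases[of t])
    fix a n assume g: "gap B x a n" "a \<le> t" "t \<le> a + int n"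
    let ?k = "nat (t - a)"
    have "z (t + 1) = exc (c n) n (Suc ?k)"
    proof (cases "t + 1 \<le> a + int n")
      case True
      have "nat (t + 1 - a) = Suc ?k" using g(2) by simp
      then show ?thesis using zG[OF g(1), of "t + 1"] g(2) True by simp
    next
      case False
      then have e: "t + 1 = a + int n + 1" "Suc ?k = n + 1" using g(2,3) by auto
      have "x (t + 1) = B" unfolding e(1) using g(1) unfolding gap_def by blast
      then show ?thesis using zB[of "t + 1"] exc_end[OF c_gap(1,2)[OF x g(1)]] unfolding e(2) by simp
    qed
    moreover have "?k \<le> n" using g by simp
    ultimately show ?thesis using zG[OF g] exc_arc[OF c_gap(1,2)[OF x g(1)], of ?k] by simp
  next
    fix a assume R: "R t a"
    then have R': "R (t + 1) a" by (simp add: R_def)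
    have "a \<le> t" using R unfolding R_def by blast
    then have "nat (t + 1 - a) = Suc (nat (t - a))" by linarith
    moreover have "i0 \<in> T1" using i0(2)[of a] R unfolding R_def by blast
    ultimately show ?thesis using zR[OF R] zR[OF R'] ray_arc[of i0 "nat (t - a)"] by simp
  next
    fix b assume Q: "Q t b"
    have i: "i0 \<in> T1" using i0(2)[of b] Q unfolding Q_def by blast
    have "t < b" using Q unfolding Q_def by blast
    then have k: "nat (b - t) = Suc (nat (b - (t + 1)))" by linarith
    have "z (t + 1) = back_ray i0 (nat (b - (t + 1)))"
    proof (cases "t + 1 = b")
      case True
      then show ?thesis using zB[of b] Q back_ray_0[OF i] by (simp add: Q_def)
    next
      case False
      then have "Q (t + 1) b" using Q by (simp add: Q_def)
      then show ?thesis by (rule zQ)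
    qed
    then show ?thesis using zQ[OF Q] back_ray_arc[OF i] k by simp
  next
    assume N: "\<forall>r. x r \<noteq> B"
    then have "i0 \<in> T" using i0(3) by blast
    then show ?thesis using zN[OF N] cc_arc by simp
  qed
  have "z \<in> Z"
  proof (rule ZI)
    show "z \<in> walks E" using arcs by (simp add: walks_def)
  next
    fix a n t assume g: "gap B z a n" and t: "a < t" "t \<le> a + int n"
    have "gap B z a n \<longleftrightarrow> gap B x a n" by (rule gap_cong) (rule z_iff)
    then show "sp (z t) = c n" using inner[of a n t] g t by simp
  next
    fix a t assume nB: "\<And>t. a \<le> t \<Longrightarrow> t < a + int L \<Longrightarrow> z t \<noteq> B" and t: "a \<le> t" "t < a + int L"
    show "sp (z t) \<in> W"
    proof (cases "\<exists>a' n. gap B x a' n \<and> a' \<le> t \<and> t \<le> a' + int n")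
      case False
      then show ?thesis using sp_z[of t] nB[OF t] z_iff[of t] by blast
    next
      case True
      then obtain b n where g: "gap B x b n" "b \<le> t" "t \<le> b + int n" by blast
      have B: "z b = B" "z (b + int n + 1) = B" using g(1) z_iff by (auto simp: gap_def)
      \<comment> \<open>The run around \<open>t\<close> contains no \<open>B\<close>, hence lies
        inside the gap around \<open>t\<close>. The gap is thus long, and its spoke
        \<open>c n\<close> is in \<open>W\<close>.\<close>
      have "b < a" using nB[of b] B(1) g(2) t by force
      moreover have "a + int L \<le> b + int n + 1" using nB[of "b + int n + 1"] B(2) g(3) t by force
      ultimately have "L \<le> n" by linarith
      moreover have "b < t" using \<open>b < a\<close> t by simp
      ultimately show ?thesis using inner[OF g(1) _ g(3)] c_gap(3)[OF x g(1)] by simp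
    qed
  qed
  then show thesis using that z_iff by blast
qed

end

section \<open>Irreducibility and finite fibres of the subshift\<close>

context choice
begin

text \<open>A point that does not return runs around the circuit of a spoke in \<open>W\<close>. It
  is kept there for at least \<open>L\<close> more steps and then sent home, so that no short gap
  arises and the new stretch is subject to the rule about \<open>W\<close> alone.\<close>

lemma Z_extend_right:
  assumes x: "x \<in> Z"
  obtains x' b where "x' \<in> Z" "\<And>t. t < m \<Longrightarrow> x' t = x t" "m \<le> b" "x' b = B"
proof (cases "\<exists>b\<ge>m. x b = B")
  case True
  then show thesis using that[OF x] by blast
next
  case False
  then have nB: "x t \<noteq> B" if "m \<le> t" for t using that by blast
  obtain i b s where i: "i \<in> T1" "m \<le> b" and cc: "\<And>t. b \<le> t \<Longrightarrow> x t = cc i (s + t)"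
    by (rule tail[OF Z_walk[OF x] nB]) blast+
  have iW: "i \<in> W"
  proof (rule Z_tail_W[OF x, of b])
    show "sp (x b) = i" using cc[of b] sp_cc[OF i(1)] by simp
  qed (use nB i(2) in simp)
  obtain x0 where x0: "x0 \<in> Z" "x0 0 = B"
  proof -
    have "gaplen i (p i + q i - 1)" using p_pos[OF i(1)] unfolding gaplen_regular[OF i(1)]
      by (intro exI[of _ 0]) simp
    then obtain y where y: "y \<in> walks E" "gap B y 0 (p i + q i - 1)" by (rule loop_walk[OF T1D[OF i(1)]])
    obtain z where "z \<in> Z" "\<And>t. z t = B \<longleftrightarrow> y t = B" by (rule Z_onto[OF y(1)]) blast
    then show thesis using that y(2) unfolding gap_def by blast
  qed
  \<comment> \<open>The first time from \<open>b + int L\<close> on at which the walk stands at the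
    rim vertex, the only exit of the circuit.\<close>
  define e where "e = b + int L + (- (s + b + int L)) mod int (d i)"
  have dpos: "0 < int (d i)" using d_pos[OF T1D[OF i(1)]] by simp
  have e: "b + int L \<le> e" using pos_mod_sign[OF dpos] by (simp add: e_def)
  have "(s + e) mod int (d i) = 0"
  proof -
    have "s + e = (s + b + int L) + (- (s + b + int L)) mod int (d i)" by (simp add: e_def)
    also have "\<dots> mod int (d i) = ((s + b + int L) + - (s + b + int L)) mod int (d i)"
      by (rule mod_add_right_eq)
    finally show ?thesis by simp
  qed
  then have dvd: "int (d i) dvd s + e - 0" by (simp add: mod_0_imp_dvd)
  have "x e = cc i 0" using cc[of e] e cc_cong[OF T1D[OF i(1)] dvd] by simp
  then have xe: "x e = gm i 0" by (simp add: gm_0[OF i(1)])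
  define f where "f = e + int (q i)"
  have f: "e < f" using q_pos[OF i(1)] by (simp add: f_def)
  define x' where "x' t = (if t \<le> e then x t else if t \<le> f then gm i (nat (t - e)) else x0 (t - f))" for t
  have lo: "x' t = x t" if "t \<le> e" for t using that by (simp add: x'_def)
  have mid: "x' t = gm i (nat (t - e))" if "e \<le> t" "t \<le> f" for t
  proof (cases "t = e")
    case True then show ?thesis using xe by (simp add: x'_def)
  next
    case False then show ?thesis using that by (simp add: x'_def)
  qed
  have hi: "x' t = translate (- f) x0 t" if "f \<le> t" for t
  proof (cases "t = f")
    case True
    then show ?thesis using mid[of f] f gm_q[OF i(1)] x0(2) by (simp add: f_def translate_def)
  next
    case False then show ?thesis using that f by (simp add: x'_def translate_def)
  qed
  have inner: "x' t \<noteq> B \<and> (b \<le> t \<longrightarrow> sp (x' t) = i)" if "m \<le> t" "t < f" for t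
  proof (cases "t \<le> e")
    case True
    then show ?thesis using lo nB cc[of t] sp_cc[OF i(1)] that by simp
  next
    case False
    then have "nat (t - e) < q i" using that unfolding f_def by linarith
    then show ?thesis using mid[of t] sp_gm[OF i(1)] False that by simp
  qed
  have x0': "translate (- f) x0 \<in> Z" by (rule Z_translate[OF x0(1)])
  have x'f: "x' f = B" using hi[of f] x0(2) by (simp add: translate_def)
  have "x' \<in> Z"
  proof (rule ZI)
    have "(x' t, x' (t + 1)) \<in> E" for t
    proof -
      consider "t < e" | "e \<le> t" "t < f" | "f \<le> t" by linarith
      then show ?thesis
      proof cases
        case 1
        then show ?thesis using lo[of t] lo[of "t + 1"] arc[OF Z_walk[OF x], of t] by simp
      next
        case 2
        then have "nat (t - e) < q i" "nat (t + 1 - e) = Suc (nat (t - e))" unfolding f_def by linarith+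
        then show ?thesis using mid[of t] mid[of "t + 1"] 2 gm_arc[OF i(1), of "nat (t - e)"] by simp
      next
        case 3
        then show ?thesis using hi[of t] hi[of "t + 1"] arc[OF Z_walk[OF x0'], of t] by simp
      qed
    qed
    then show "x' \<in> walks E" by (simp add: walks_def)
  next
    fix a n t assume n: "n < L" and g: "gap B x' a n" and t: "a < t" "t \<le> a + int n"
    have "\<not> (m \<le> a \<and> a < f)" using inner[of a] g unfolding gap_def by blast
    moreover have "\<not> (a < f \<and> f \<le> a + int n)" using x'f g unfolding gap_def by blast
    moreover have "\<not> (m \<le> a + int n + 1 \<and> a + int n + 1 < f)"
      using inner[of "a + int n + 1"] g unfolding gap_def by blast
    ultimately consider "f \<le> a" | "a + int n + 1 \<le> e" using n e i(2) by linarith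
    then show "sp (x' t) = c n"
    proof cases
      case 1
      have "gap B x' a n \<longleftrightarrow> gap B (translate (- f) x0) a n" by (rule gap_cong) (use hi 1 in simp)
      then show ?thesis using Z_short_gap[OF x0' _ n t] g hi[of t] 1 t by simp
    next
      case 2
      have "gap B x' a n \<longleftrightarrow> gap B x a n" by (rule gap_cong) (use lo 2 in simp)
      then show ?thesis using Z_short_gap[OF x _ n t] g lo[of t] 2 t by simp
    qed
  next
    fix a t assume *: "\<And>t. a \<le> t \<Longrightarrow> t < a + int L \<Longrightarrow> x' t \<noteq> B" and t: "a \<le> t" "t < a + int L"
    have "\<not> (a \<le> f \<and> f < a + int L)" using *[of f] x'f by blast
    \<comment> \<open>In the third case \<open>e < a + int L\<close> and
      \<open>b + int L \<le> e\<close> put \<open>a\<close> after \<open>b\<close>, so the whole run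
      lies in spoke \<open>i\<close>.\<close>
    then consider "f < a" | "a + int L \<le> e" | "e < a + int L" "a + int L \<le> f" by linarith
    then show "sp (x' t) \<in> W"
    proof cases
      case 1
      have "sp (translate (- f) x0 t) \<in> W"
      proof (rule Z_run[OF x0', of a])
        fix r assume "a \<le> r" "r < a + int L"
        then show "translate (- f) x0 r \<noteq> B" using *[of r] hi[of r] 1 by simp
      qed (use t in auto)
      then show ?thesis using hi[of t] 1 t by simp
    next
      case 2
      have "sp (x t) \<in> W"
      proof (rule Z_run[OF x, of a])
        fix r assume "a \<le> r" "r < a + int L"
        then show "x r \<noteq> B" using *[of r] lo[of r] 2 by simp
      qed (use t in auto)
      then show ?thesis using lo[of t] 2 t by simp
    next
      case 3
      then have "b \<le> t" "t < f" using t e by linarith+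
      then show ?thesis using inner[of t] i(2) iW by simp
    qed
  qed
  moreover have "x' t = x t" if "t < m" for t using lo that e i(2) by simp
  moreover have "m \<le> f" using e i(2) f by linarith
  ultimately show thesis using that x'f by blast
qed

lemma Z_extend_left:
  assumes x: "x \<in> Z"
  obtains x' b where "x' \<in> Z" "\<And>t. m < t \<Longrightarrow> x' t = x t" "b \<le> m" "x' b = B"
proof -
  interpret rev: choice "E\<inverse>" B T T1 q p d "\<lambda>i t. gm i (q i - t)" "\<lambda>i t. gp i (p i - t)" "\<lambda>i t. cc i (- t)" sp W L c
    by (rule reversed_choice)
  obtain x' b where x': "x' \<in> rev.Z" "\<And>t. t < - m \<Longrightarrow> x' t = x (- t)" "- m \<le> b" "x' b = B"
    by (rule rev.Z_extend_right[OF Z_reversed[OF x], of "- m"]) blast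
  have 1: "(\<lambda>t. x' (- t)) \<in> Z" using rev.Z_reversed[OF x'(1)] by simp
  show thesis
  proof (rule that[OF 1, of "- b"])
    fix t assume "m < t"
    then show "x' (- t) = x t" using x'(2)[of "- t"] by simp
  qed (use x' in auto)
qed

text \<open>Both points are led to \<open>B\<close> outside the given blocks, the first after
  \<open>u\<close> and the second before \<open>v\<close>, and glued at \<open>B\<close>. The bound
  \<open>j - 1\<close> keeps the first symbol of \<open>v\<close> intact.\<close>

lemma Z_irreducible: "irreducible_shift Z"
  unfolding irreducible_shift_def
proof (intro ballI)
  fix u v assume "u \<in> allowed_blocks Z" "v \<in> allowed_blocks Z"
  then obtain x i m y j n where u: "u = block_at x i m" "x \<in> Z" and v: "v = block_at y j n" "y \<in> Z"
    unfolding allowed_blocks_def by blast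
  obtain x' b where x': "x' \<in> Z" "\<And>t. t < i + int m \<Longrightarrow> x' t = x t" "i + int m \<le> b" "x' b = B"
    by (rule Z_extend_right[OF u(2), of "i + int m"]) blast
  obtain y' e where y': "y' \<in> Z" "\<And>t. j - 1 < t \<Longrightarrow> y' t = y t" "e \<le> j - 1" "y' e = B"
    by (rule Z_extend_left[OF v(2), of "j - 1"]) blast
  define z where "z = glue b x' (translate (e - b) y')"
  have z: "z \<in> Z" unfolding z_def
    by (rule Z_glue[OF x'(1) Z_translate[OF y'(1)] x'(4)]) (use y'(4) in \<open>simp add: translate_def\<close>)
  define k where "k = nat (j - e + b - (i + int m))"
  have k: "i + int m + int k = j - e + b" unfolding k_def using x'(3) y'(3) by simp
  have "block_at z i m = u"
    unfolding u(1) block_at_eq_iff z_def using x'(2,3) by (simp add: glue_def)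
  moreover have "block_at z (i + int m + int k) n = v"
    unfolding v(1) block_at_eq_iff z_def k
  proof (intro allI impI)
    fix r
    have "glue b x' (translate (e - b) y') (j - e + b + int r) = y' (j + int r)"
      using y'(3) by (simp add: glue_def translate_def)
    then show "glue b x' (translate (e - b) y') (j - e + b + int r) = y (j + int r)"
      using y'(2)[of "j + int r"] by simp
  qed
  moreover have "u @ block_at z (i + int m) k @ v = block_at z i (m + k + n)"
    unfolding calculation(1)[symmetric] calculation(2)[symmetric]
    by (simp only: block_at_append add.assoc[of m k n])
  ultimately have "u @ block_at z (i + int m) k @ v \<in> allowed_blocks Z"
    "block_at z (i + int m) k \<in> allowed_blocks Z" using z unfolding allowed_blocks_def by auto
  then show "\<exists>w\<in>allowed_blocks Z. u @ w @ v \<in> allowed_blocks Z" by blast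
qed

text \<open>The first position of the right tail. The default 0 is the place where a point without
  any \<open>B\<close> is inspected. The value depends only on the positions of \<open>B\<close>, so
  it is constant on fibres.\<close>

definition right_end :: "(int \<Rightarrow> 'a) \<Rightarrow> int" where
  "right_end x = (if \<exists>a. x a = B \<and> (\<forall>t>a. x t \<noteq> B) then (SOME a. x a = B \<and> (\<forall>t>a. x t \<noteq> B)) + 1 else 0)"

definition left_end :: "(int \<Rightarrow> 'a) \<Rightarrow> int" where
  "left_end x = (if \<exists>a. x a = B \<and> (\<forall>t<a. x t \<noteq> B) then (SOME a. x a = B \<and> (\<forall>t<a. x t \<noteq> B)) - 1 else 0)"

lemma right_end: "x a = B \<Longrightarrow> (\<And>t. a < t \<Longrightarrow> x t \<noteq> B) \<Longrightarrow> right_end x = a + 1"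
proof -
  assume a: "x a = B" "\<And>t. a < t \<Longrightarrow> x t \<noteq> B"
  have "(SOME a. x a = B \<and> (\<forall>t>a. x t \<noteq> B)) = a"
  proof (rule some_equality)
    fix b assume "x b = B \<and> (\<forall>t>b. x t \<noteq> B)"
    then have "\<not> a < b" "\<not> b < a" using a by blast+
    then show "b = a" by linarith
  qed (use a in blast)
  moreover have "\<exists>a. x a = B \<and> (\<forall>t>a. x t \<noteq> B)" using a by blast
  ultimately show ?thesis unfolding right_end_def by (simp only: if_True)
qed

lemma left_end: "x a = B \<Longrightarrow> (\<And>t. t < a \<Longrightarrow> x t \<noteq> B) \<Longrightarrow> left_end x = a - 1"
proof -
  assume a: "x a = B" "\<And>t. t < a \<Longrightarrow> x t \<noteq> B"
  have "(SOME a. x a = B \<and> (\<forall>t<a. x t \<noteq> B)) = a"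
  proof (rule some_equality)
    fix b assume "x b = B \<and> (\<forall>t<b. x t \<noteq> B)"
    then have "\<not> a < b" "\<not> b < a" using a by blast+
    then show "b = a" by linarith
  qed (use a in blast)
  moreover have "\<exists>a. x a = B \<and> (\<forall>t<a. x t \<noteq> B)" using a by blast
  ultimately show ?thesis unfolding left_end_def by (simp only: if_True)
qed

lemma ends_never: "(\<And>t. x t \<noteq> B) \<Longrightarrow> right_end x = 0"
  by (simp add: right_end_def)

text \<open>Between two visits to \<open>B\<close> the image decides. Each tail, and likewise a
  point without \<open>B\<close>, is settled by one vertex, so two vertices at places known from the
  image suffice. This embeds every fibre into \<open>A \<times> A\<close>.\<close>

lemma Z_eqI:
  assumes x: "x \<in> Z" and x': "x' \<in> Z" and eq: "\<And>t. x t = B \<longleftrightarrow> x' t = B"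
    and ends: "x (left_end x) = x' (left_end x)" "x (right_end x) = x' (right_end x)"
  shows "x = x'"
proof
  fix t
  show "x t = x' t"
  proof (cases "\<exists>s\<le>t. x s = B"; cases "\<exists>s>t. x s = B")
    assume "\<exists>s\<le>t. x s = B" "\<exists>s>t. x s = B"
    then obtain s s' where s: "x s = B" "s \<le> t" "x s' = B" "t < s'" by blast
    show ?thesis by (rule Z_eq_between[OF x x' s(1,3) eq s(2)]) (use s(4) in simp)
  next
    assume "\<exists>s\<le>t. x s = B" and right: "\<not> (\<exists>s>t. x s = B)"
    then obtain s where s: "x s = B" "s \<le> t" by blast
    obtain a where a: "a \<le> t" "x a = B" "\<And>r. a < r \<Longrightarrow> r \<le> t \<Longrightarrow> x r \<noteq> B"
      using last_before[of "\<lambda>r. x r = B" s t] s by blast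
    have nB: "x r \<noteq> B" if "a < r" for r using a(3)[of r] right that by (cases "r \<le> t") auto
    have "right_end x = a + 1" by (rule right_end) (fact a(2), rule nB)
    then have 1: "x (a + 1) = x' (a + 1)" using ends(2) by simp
    have a': "x' a = B" "\<And>r. a < r \<Longrightarrow> x' r \<noteq> B" using a(2) nB eq by blast+
    show ?thesis by (rule Z_eq_after[OF x x' a(2) a'(1) nB a'(2) 1 a(1)])
  next
    assume left: "\<not> (\<exists>s\<le>t. x s = B)" and "\<exists>s>t. x s = B"
    then obtain s where s: "x s = B" "t \<le> s" by force
    obtain a where a: "t \<le> a" "x a = B" "\<And>r. t \<le> r \<Longrightarrow> r < a \<Longrightarrow> x r \<noteq> B"
      using next_after[of "\<lambda>r. x r = B" s t] s by blast
    have nB: "x r \<noteq> B" if "r < a" for r using a(3)[of r] left that by (cases "r \<le> t") auto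
    have "left_end x = a - 1" by (rule left_end) (fact a(2), rule nB)
    then have 1: "x (a - 1) = x' (a - 1)" using ends(1) by simp
    have a': "x' a = B" "\<And>r. r < a \<Longrightarrow> x' r \<noteq> B" using a(2) nB eq by blast+
    show ?thesis by (rule Z_eq_before[OF x x' a(2) a'(1) nB a'(2) 1 a(1)])
  next
    assume *: "\<not> (\<exists>s\<le>t. x s = B)" "\<not> (\<exists>s>t. x s = B)"
    have nB: "x r \<noteq> B" for r using * by (cases "r \<le> t") (blast, metis not_le)
    have "right_end x = 0" by (rule ends_never) (rule nB)
    then have 0: "x 0 = x' 0" using ends(2) by simp
    have nB': "\<And>r. x' r \<noteq> B" using nB eq by blast
    show ?thesis by (rule Z_eq_never[OF x x' nB nB' 0])
  qed
qed

lemma Z_finite_to_one: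
  assumes A: "finite A" "Field E \<subseteq> A"
  shows "finite_to_one_on (one_block_code (standard_symbol B)) Z"
  unfolding finite_to_one_on_def
proof (intro exI ballI)
  fix y assume "y \<in> one_block_code (standard_symbol B) ` Z"
  then obtain x where x: "x \<in> Z" "y = one_block_code (standard_symbol B) x" by blast
  let ?F = "{z \<in> Z. one_block_code (standard_symbol B) z = y}"
  let ?h = "\<lambda>z. (z (left_end x), z (right_end x))"
  have B: "z t = B \<longleftrightarrow> x t = B" if "z \<in> ?F" for z t
  proof -
    have "one_block_code (standard_symbol B) z t = one_block_code (standard_symbol B) x t" using that x(2) by simp
    then show ?thesis by (simp add: one_block_code_def standard_symbol_eq_iff)
  qed
  have e: "left_end z = left_end x" "right_end z = right_end x" if "z \<in> ?F" for z
    unfolding left_end_def right_end_def B[OF that] by (rule refl)+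
  have "inj_on ?h ?F"
  proof (rule inj_onI)
    fix z z' assume z: "z \<in> ?F" "z' \<in> ?F" and h: "?h z = ?h z'"
    show "z = z'"
    proof (rule Z_eqI)
      show "z t = B \<longleftrightarrow> z' t = B" for t unfolding B[OF z(1)] B[OF z(2)] by (rule refl)
      show "z (left_end z) = z' (left_end z)" "z (right_end z) = z' (right_end z)"
        unfolding e[OF z(1)] using h by simp_all
    qed (use z in simp_all)
  qed
  moreover have "?h ` ?F \<subseteq> A \<times> A"
  proof clarify
    fix z assume "z \<in> Z"
    then have "z t \<in> A" for t using in_Field[OF Z_walk] A(2) by blast
    then show "z (left_end x) \<in> A \<and> z (right_end x) \<in> A" by simp
  qed
  moreover have "finite (A \<times> A)" using A(1) by simp
  ultimately show "finite ?F \<and> card ?F \<le> card (A \<times> A)"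
    using card_inj_on_le[of ?h ?F "A \<times> A"] inj_on_finite[of ?h ?F "A \<times> A"] by blast
qed

end

section \<open>Finite type and degree one\<close>

lemma step_SFT_imp_SFT: "step_SFT A M Z \<Longrightarrow> SFT A Z"
  unfolding step_SFT_def SFT_def by blast

context choice
begin

text \<open>Every rule defining \<open>Z\<close> is visible in a window of \<open>L + 2\<close>
  symbols: an arc, a gap shorter than \<open>L\<close> with both of its ends, a run of length
  \<open>L\<close>. So it suffices to forbid the words of this length that do not occur in
  \<open>Z\<close>.\<close>

lemma Z_step_SFT:
  assumes A: "finite A" "Field E \<subseteq> A"
  shows "step_SFT A (L + 1) Z"
  unfolding step_SFT_def
proof (intro exI conjI)
  let ?F = "{w \<in> lists A. length w = L + 1 + 1 \<and> w \<notin> allowed_blocks Z}"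
  have "finite {w. set w \<subseteq> A \<and> length w = L + 1 + 1}" by (rule finite_lists_length_eq[OF A(1)])
  then show "finite ?F" by (rule finite_subset[rotated]) (auto simp: in_lists_conv_set)
  show "?F \<subseteq> {w \<in> lists A. length w = L + 1 + 1}" by blast
  show "Z = shift_avoiding A ?F"
  proof (intro equalityI subsetI)
    fix x assume x: "x \<in> Z"
    then have "range x \<subseteq> A" using in_Field[OF Z_walk] A(2) by blast
    moreover have "block_at x i (length w) \<noteq> w" if "w \<in> ?F" for w i
      using x that unfolding allowed_blocks_def by auto
    ultimately show "x \<in> shift_avoiding A ?F" unfolding shift_avoiding_def by blast
  next
    fix x assume x: "x \<in> shift_avoiding A ?F"
    have local: "\<exists>z\<in>Z. \<forall>t. i \<le> t \<and> t \<le> i + int L + 1 \<longrightarrow> x t = z t" for i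
    proof -
      let ?w = "block_at x i (L + 1 + 1)"
      have "?w \<in> lists A" using x unfolding shift_avoiding_def block_at_def in_lists_conv_set by auto
      moreover have "?w \<notin> ?F" using x unfolding shift_avoiding_def by fastforce
      ultimately have "?w \<in> allowed_blocks Z" by simp
      then obtain z j n where z: "z \<in> Z" "?w = block_at z j n" unfolding allowed_blocks_def by blast
      have "length ?w = n" unfolding z(2) by simp
      then have n: "n = L + 1 + 1" by simp
      have eq: "\<forall>k<L + 1 + 1. x (i + int k) = z (j + int k)" using z(2) unfolding n block_at_eq_iff .
      have "x t = translate (j - i) z t" if "i \<le> t" "t \<le> i + int L + 1" for t
        using eq[rule_format, of "nat (t - i)"] that by (simp add: translate_def algebra_simps)
      then show ?thesis using Z_translate[OF z(1), of "j - i"] by blast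
    qed
    show "x \<in> Z"
    proof (rule ZI)
      have "(x t, x (t + 1)) \<in> E" for t
      proof -
        obtain z where z: "z \<in> Z" "\<And>r. t \<le> r \<Longrightarrow> r \<le> t + int L + 1 \<Longrightarrow> x r = z r" using local by blast
        then show ?thesis using arc[OF Z_walk[OF z(1)], of t] by simp
      qed
      then show "x \<in> walks E" by (simp add: walks_def)
    next
      fix a n t assume n: "n < L" and g: "gap B x a n" and t: "a < t" "t \<le> a + int n"
      obtain z where z: "z \<in> Z" "\<And>r. a \<le> r \<Longrightarrow> r \<le> a + int L + 1 \<Longrightarrow> x r = z r" using local by blast
      have "gap B x a n \<longleftrightarrow> gap B z a n" by (rule gap_cong) (use z(2) n in simp)
      then show "sp (x t) = c n" using Z_short_gap[OF z(1) _ n t] g z(2)[of t] t n by simp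
    next
      fix a t assume *: "\<And>t. a \<le> t \<Longrightarrow> t < a + int L \<Longrightarrow> x t \<noteq> B" and t: "a \<le> t" "t < a + int L"
      obtain z where z: "z \<in> Z" "\<And>r. a \<le> r \<Longrightarrow> r \<le> a + int L + 1 \<Longrightarrow> x r = z r" using local by blast
      have "sp (z t) \<in> W"
      proof (rule Z_run[OF z(1), of a])
        fix r assume "a \<le> r" "r < a + int L"
        then show "z r \<noteq> B" using *[of r] z(2)[of r] by simp
      qed (use t in auto)
      then show "sp (x t) \<in> W" using z(2)[of t] t by simp
    qed
  qed
qed

lemma Z_contains_B:
  obtains x where "x \<in> Z" "x 0 = B"
proof -
  obtain i where i: "i \<in> T" using T_nonempty by blast
  obtain n where n: "gaplen i n"
  proof (cases "i \<in> T1")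
    case True
    then have "gaplen i (p i + q i - 1)"
      using p_pos[OF True] unfolding gaplen_regular[OF True] by (intro exI[of _ 0]) simp
    then show thesis by (rule that)
  next
    case False
    then have "gaplen i (d i - 1)" using d_pos[OF i] by (simp add: gaplen_def)
    then show thesis by (rule that)
  qed
  obtain y where y: "y \<in> walks E" "gap B y 0 n" by (rule loop_walk[OF i n])
  obtain z where "z \<in> Z" "\<And>t. z t = B \<longleftrightarrow> y t = B" by (rule Z_onto[OF y(1)]) blast
  then show thesis using that y(2) unfolding gap_def by blast
qed

text \<open>
  Between two visits to the centre a point of \<open>Z\<close> is determined by its image, so a long
  block of the image that begins and ends with 1 has a single preimage.
\<close>

lemma Z_degree:
  assumes A: "finite A" "Field E \<subseteq> A"
  shows "code_degree M (standard_symbol B) Z = 1"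
proof -
  let ?f = "standard_symbol B"
  define N where "N = max 1 M"
  define P where "P w i = {take N (drop i u) | u. u \<in> allowed_blocks Z \<and> map ?f u = w}" for w i
  define S where "S = {card (P w i) | w i. w \<in> allowed_blocks (one_block_code ?f ` Z) \<and> i + N \<le> length w}"
  have deg: "code_degree M ?f Z = Inf S" unfolding code_degree_def S_def P_def N_def Let_def ..
  \<comment> \<open>\<open>card\<close> is 0 for empty and for infinite sets, so both have to be
    excluded.\<close>
  have lower: "1 \<le> s" if S: "s \<in> S" for s
  proof -
    obtain w i where s: "s = card (P w i)" "w \<in> allowed_blocks (one_block_code ?f ` Z)" "i + N \<le> length w"
      using S unfolding S_def by blast
    obtain x j n where x: "x \<in> Z" "w = block_at (one_block_code ?f x) j n"
      using s(2) unfolding allowed_blocks_def by blast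
    have "block_at x j n \<in> allowed_blocks Z" "map ?f (block_at x j n) = w"
      using x map_block_at[of ?f x j n] unfolding allowed_blocks_def by blast+
    then have "P w i \<noteq> {}" unfolding P_def by blast
    moreover have "P w i \<subseteq> {v. set v \<subseteq> A \<and> length v = N}"
    proof
      fix v assume "v \<in> P w i"
      then obtain u where u: "v = take N (drop i u)" "u \<in> allowed_blocks Z" "map ?f u = w" unfolding P_def by blast
      obtain z k l where z: "z \<in> Z" "u = block_at z k l" using u(2) unfolding allowed_blocks_def by blast
      have "z t \<in> A" for t using in_Field[OF Z_walk[OF z(1)]] A(2) by blast
      then have "set u \<subseteq> A" unfolding z(2) block_at_def by auto
      moreover have "set v \<subseteq> set u" unfolding u(1) using set_take_subset set_drop_subset by fast
      moreover have "length u = length w" using u(3) by auto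
      then have "length v = N" using s(3) unfolding u(1) by simp
      ultimately show "v \<in> {v. set v \<subseteq> A \<and> length v = N}" by blast
    qed
    then have "finite (P w i)" using finite_lists_length_eq[OF A(1)] by (rule finite_subset)
    ultimately have "0 < card (P w i)" by (simp add: card_gt_0_iff)
    then show ?thesis using s(1) by simp
  qed
  have "1 \<in> S"
  proof -
    obtain x0 where x0: "x0 \<in> Z" "x0 0 = B" by (rule Z_contains_B)
    \<comment> \<open>The word that attains degree 1 is the image of a stretch from a visit at 0 to
      a visit at some \<open>b\<close> with \<open>int N \<le> b\<close>, so that the
      \<open>N\<close>-block at position 0 lies between two visits.\<close>
    obtain x b where x: "x \<in> Z" "\<And>t. t < int N \<Longrightarrow> x t = x0 t" "int N \<le> b" "x b = B"
      by (rule Z_extend_right[OF x0(1), of "int N"]) blast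
    have x_0: "x 0 = B" using x(2)[of 0] x0(2) by (simp add: N_def)
    define n where "n = nat b + 1"
    define w where "w = block_at (one_block_code ?f x) 0 n"
    have b: "0 \<le> b" using x(3) by simp
    have "P w 0 = {block_at x 0 N}"
    proof
      show "{block_at x 0 N} \<subseteq> P w 0"
      proof -
        have "block_at x 0 n \<in> allowed_blocks Z" "map ?f (block_at x 0 n) = w"
          using x(1) map_block_at[of ?f x 0 n] unfolding allowed_blocks_def w_def by blast+
        moreover have "N \<le> n" using x(3) unfolding n_def by linarith
        then have "take N (drop 0 (block_at x 0 n)) = block_at x 0 N" by (simp add: take_block_at)
        ultimately show ?thesis unfolding P_def by (metis (mono_tags, lifting) insert_subset empty_subsetI mem_Collect_eq)
      qed
      show "P w 0 \<subseteq> {block_at x 0 N}"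
      proof
        fix v assume "v \<in> P w 0"
        then obtain u where u: "v = take N (drop 0 u)" "u \<in> allowed_blocks Z" "map ?f u = w" unfolding P_def by blast
        obtain y j l where y: "y \<in> Z" "u = block_at y j l" using u(2) unfolding allowed_blocks_def by blast
        have "length u = length w" using u(3) by auto
        then have l: "l = n" unfolding y(2) w_def by simp
        define z where "z = translate j y"
        have z: "z \<in> Z" unfolding z_def by (rule Z_translate[OF y(1)])
        have uz: "u = block_at z 0 n" unfolding y(2) l z_def block_at_eq_iff by (simp add: translate_def add.commute)
        have "block_at (one_block_code ?f z) 0 n = block_at (one_block_code ?f x) 0 n"
          using u(3) unfolding uz map_block_at w_def .
        then have B: "x t = B \<longleftrightarrow> z t = B" if "0 \<le> t" "t \<le> b" for t
          using that unfolding block_at_eq_iff one_block_code_def standard_symbol_eq_iff n_def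
          by (elim allE[of _ "nat t"]) auto
        have "x t = z t" if "0 \<le> t" "t \<le> b" for t
          by (rule Z_eq_between[OF x(1) z x_0 x(4) B that])
        then have "block_at z 0 N = block_at x 0 N" using x(3) unfolding block_at_eq_iff by simp
        moreover have "N \<le> n" using x(3) unfolding n_def by linarith
        ultimately have "v = block_at x 0 N" unfolding u(1) uz by (simp add: take_block_at)
        then show "v \<in> {block_at x 0 N}" by simp
      qed
    qed
    then have "card (P w 0) = 1" by simp
    moreover have "w \<in> allowed_blocks (one_block_code ?f ` Z)" using x(1) unfolding allowed_blocks_def w_def by blast
    moreover have "0 + N \<le> length w" using x(3) unfolding w_def n_def length_block_at by linarith
    ultimately show "1 \<in> S" unfolding S_def by (metis (mono_tags, lifting) mem_Collect_eq)
  qed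
  then have "Inf S = 1" using lower by (metis cInf_eq_minimum)
  then show ?thesis using deg by simp
qed

lemma Z_almost_invertible:
  assumes "finite A" "Field E \<subseteq> A"
  shows "almost_invertible_on A (standard_symbol B) Z"
  unfolding almost_invertible_on_def
  using Z_finite_to_one[OF assms] Z_step_SFT[OF assms] Z_degree[OF assms] by blast

lemma Z_image: "one_block_code (standard_symbol B) ` Z = one_block_code (standard_symbol B) ` walks E"
proof
  show "one_block_code (standard_symbol B) ` Z \<subseteq> one_block_code (standard_symbol B) ` walks E"
    using Z_walk by blast
  show "one_block_code (standard_symbol B) ` walks E \<subseteq> one_block_code (standard_symbol B) ` Z"
  proof
    fix y assume "y \<in> one_block_code (standard_symbol B) ` walks E"
    then obtain x where x: "x \<in> walks E" "y = one_block_code (standard_symbol B) x" by blast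
    obtain z where z: "z \<in> Z" "\<And>t. z t = B \<longleftrightarrow> x t = B" by (rule Z_onto[OF x(1)]) blast
    have "one_block_code (standard_symbol B) z = y"
      unfolding x(2) one_block_code_def by (intro ext) (simp add: standard_symbol_eq_iff z(2))
    then show "y \<in> one_block_code (standard_symbol B) ` Z" using z(1) by blast
  qed
qed

end

section \<open>The subshift obtained from a splitting set of spokes\<close>

context spokes
begin

lemma splits_imp_choice:
  assumes W: "splits W" and T: "T \<noteq> {}"
  obtains L c where "choice E B T T1 p q d gp gm cc sp W L c"
proof -
  obtain L0 where W1: "W \<subseteq> T1"
    and L0: "\<And>n. L0 \<le> n \<Longrightarrow> \<exists>i\<in>T1. gaplen i n \<Longrightarrow> \<exists>!j. j \<in> W \<and> gaplen j n"
    using W unfolding splits_def by blast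
  obtain K where K: "\<And>i. i \<in> T \<Longrightarrow> d i \<le> K" using finite_nat_bound[OF finite_T, of d] by blast
  \<comment> \<open>\<open>L0\<close> makes the spoke in \<open>W\<close> unique, and
    \<open>K\<close> exceeds every gap length of a degenerate spoke, so that gaps from
    \<open>L\<close> on are regular.\<close>
  define L where "L = Suc (L0 + K)"
  have regular: "i \<in> T1" if "i \<in> T" "gaplen i n" "L \<le> n" for i n
    using K[OF that(1)] that(2,3) unfolding L_def gaplen_def by (auto split: if_splits)
  define c where "c n = (if L \<le> n then SOME j. j \<in> W \<and> gaplen j n else SOME i. i \<in> T \<and> gaplen i n)" for n
  have large: "c n \<in> W \<and> gaplen (c n) n \<and> (\<forall>j. j \<in> W \<and> gaplen j n \<longrightarrow> j = c n)"
    if "i \<in> T" "gaplen i n" "L \<le> n" for i n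
  proof -
    have "\<exists>i\<in>T1. gaplen i n" using regular[OF that] that(2) by blast
    moreover have "L0 \<le> n" using that(3) by (simp add: L_def)
    ultimately have ex1: "\<exists>!j. j \<in> W \<and> gaplen j n" by (rule L0[rotated])
    then have "\<exists>j. j \<in> W \<and> gaplen j n" by blast
    then have "(SOME j. j \<in> W \<and> gaplen j n) \<in> W \<and> gaplen (SOME j. j \<in> W \<and> gaplen j n) n" by (rule someI_ex)
    then have "c n \<in> W \<and> gaplen (c n) n" using that(3) unfolding c_def by (simp only: if_True)
    then show ?thesis using ex1 by blast
  qed
  have small: "c n \<in> T \<and> gaplen (c n) n" if "i \<in> T" "gaplen i n" "\<not> L \<le> n" for i n
  proof -
    have "\<exists>i. i \<in> T \<and> gaplen i n" using that by blast
    then have "(SOME i. i \<in> T \<and> gaplen i n) \<in> T \<and> gaplen (SOME i. i \<in> T \<and> gaplen i n) n" by (rule someI_ex)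
    then show ?thesis using that(3) unfolding c_def by (simp only: if_False)
  qed
  have "choice E B T T1 p q d gp gm cc sp W L c"
  proof
    show "0 < L" by (simp add: L_def)
    show "W \<subseteq> T1" by (rule W1)
    show "T \<noteq> {}" by (rule T)
  next
    assume "T1 \<noteq> {}"
    then obtain i where i: "i \<in> T1" by blast
    define n where "n = p i + q i + L * d i - 1"
    have "n + 1 = p i + q i + L * d i" using p_pos[OF i] by (simp add: n_def)
    then have "gaplen i n" unfolding gaplen_regular[OF i] by blast
    moreover have "L * 1 \<le> L * d i" using d_pos[OF T1D[OF i]] by (intro mult_le_mono2) simp
    then have "L \<le> n" using p_pos[OF i] q_pos[OF i] unfolding n_def by linarith
    ultimately show "W \<noteq> {}" using large[OF T1D[OF i]] by blast
  next
    fix i n assume "i \<in> T" "gaplen i n"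
    then show "c n \<in> T \<and> gaplen (c n) n"
      using large[of i n] small[of i n] W1 T1_subset by blast
  next
    fix i n assume "i \<in> T" "gaplen i n" "L \<le> n"
    then show "c n \<in> W" using large by blast
  next
    fix i n assume "i \<in> W" "gaplen i n" "L \<le> n"
    then show "i = c n" using large[of i n] W1 T1_subset by blast
  qed
  then show thesis by (rule that)
qed

lemma splits_imp_almost_invertible:
  assumes "splits W" "T \<noteq> {}" and A: "finite A" "Field E \<subseteq> A"
  shows "\<exists>Z\<subseteq>walks E. SFT A Z \<and> irreducible_shift Z \<and> almost_invertible_on A (standard_symbol B) Z \<and>
    one_block_code (standard_symbol B) ` Z = one_block_code (standard_symbol B) ` walks E"
proof -
  obtain L c where "choice E B T T1 p q d gp gm cc sp W L c" by (rule splits_imp_choice[OF assms(1,2)])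
  then interpret choice E B T T1 p q d gp gm cc sp W L c .
  show ?thesis
    using Z_walk step_SFT_imp_SFT[OF Z_step_SFT[OF A]] Z_irreducible Z_almost_invertible[OF A] Z_image
    by (intro exI[of _ Z]) blast
qed

end

section \<open>Spoke graphs as systems of spokes\<close>

text \<open>The static description of the graph: injectivity of the paths, intersections of the
  pieces, and the list of arcs. How a walk may move, as stated in \<open>spokes\<close>, is derived
  from it.\<close>

locale spoke_paths =
  fixes E :: "('v \<times> 'v) set" and B :: 'v and T T1 :: "'i set" and p q d :: "'i \<Rightarrow> nat"
    and gp gm :: "'i \<Rightarrow> nat \<Rightarrow> 'v" and cc :: "'i \<Rightarrow> int \<Rightarrow> 'v" and V :: "'i \<Rightarrow> 'v set"
  assumes finite_T: "finite T" and T1_subset: "T1 \<subseteq> T"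
    and d_pos: "i \<in> T \<Longrightarrow> 0 < d i"
    and p_pos: "i \<in> T1 \<Longrightarrow> 0 < p i" and q_pos: "i \<in> T1 \<Longrightarrow> 0 < q i"
    and gp_0: "i \<in> T1 \<Longrightarrow> gp i 0 = B" and gp_p: "i \<in> T1 \<Longrightarrow> gp i (p i) = cc i 0"
    and gm_0: "i \<in> T1 \<Longrightarrow> gm i 0 = cc i 0" and gm_q: "i \<in> T1 \<Longrightarrow> gm i (q i) = B"
    and cc_deg: "i \<in> T - T1 \<Longrightarrow> cc i 0 = B"
    and cc_eq_iff: "i \<in> T \<Longrightarrow> cc i r = cc i s \<longleftrightarrow> [r = s] (mod int (d i))"
    and gp_V: "i \<in> T1 \<Longrightarrow> t \<le> p i \<Longrightarrow> gp i t \<in> V i"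
    and gm_V: "i \<in> T1 \<Longrightarrow> t \<le> q i \<Longrightarrow> gm i t \<in> V i"
    and cc_V: "i \<in> T \<Longrightarrow> cc i s \<in> V i"
    and V_disjoint: "i \<in> T \<Longrightarrow> j \<in> T \<Longrightarrow> u \<in> V i \<Longrightarrow> u \<in> V j \<Longrightarrow> u \<noteq> B \<Longrightarrow> i = j"
    and gp_inj: "i \<in> T1 \<Longrightarrow> gp i t = gp i t' \<Longrightarrow> t \<le> p i \<Longrightarrow> t' \<le> p i \<Longrightarrow> t = t'"
    and gm_inj: "i \<in> T1 \<Longrightarrow> gm i t = gm i t' \<Longrightarrow> t \<le> q i \<Longrightarrow> t' \<le> q i \<Longrightarrow> t = t'"
    and gp_gm: "i \<in> T1 \<Longrightarrow> gp i t = gm i t' \<Longrightarrow> t \<le> p i \<Longrightarrow> t' \<le> q i \<Longrightarrow>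
      t = 0 \<and> t' = q i \<or> t = p i \<and> t' = 0"
    and gp_cc: "i \<in> T1 \<Longrightarrow> gp i t = cc i s \<Longrightarrow> t \<le> p i \<Longrightarrow> t = p i"
    and gm_cc: "i \<in> T1 \<Longrightarrow> gm i t = cc i s \<Longrightarrow> t \<le> q i \<Longrightarrow> t = 0"
    and E_eq: "E = (\<Union>i\<in>T1. (\<lambda>t. (gp i t, gp i (Suc t))) ` {..<p i} \<union> (\<lambda>t. (gm i t, gm i (Suc t))) ` {..<q i}) \<union>
      (\<Union>i\<in>T. range (\<lambda>s. (cc i s, cc i (s + 1))))"
begin

lemma T1D: "i \<in> T1 \<Longrightarrow> i \<in> T" using T1_subset by auto

lemma arcE:
  assumes "(u, v) \<in> E"
  obtains (out) i t where "i \<in> T1" "t < p i" "u = gp i t" "v = gp i (Suc t)"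
    | (inn) i t where "i \<in> T1" "t < q i" "u = gm i t" "v = gm i (Suc t)"
    | (rim) i s where "i \<in> T1" "u = cc i s" "v = cc i (s + 1)"
    | (deg) i s where "i \<in> T - T1" "u = cc i s" "v = cc i (s + 1)"
  using assms unfolding E_eq by blast

lemma gp_B: "i \<in> T1 \<Longrightarrow> gp i t = B \<Longrightarrow> t \<le> p i \<Longrightarrow> t = 0"
  using gp_inj[of i t 0] gp_0 by simp

lemma gm_B: "i \<in> T1 \<Longrightarrow> gm i t = B \<Longrightarrow> t \<le> q i \<Longrightarrow> t = q i"
  using gm_inj[of i t "q i"] gm_q by simp

lemma cc_B: "i \<in> T1 \<Longrightarrow> cc i s \<noteq> B"
  using gp_cc[of i 0 s] gp_0[of i] p_pos[of i] by auto

lemma cc_dvd: "i \<in> T \<Longrightarrow> cc i s = cc i 0 \<longleftrightarrow> int (d i) dvd s"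
  by (simp add: cc_eq_iff cong_0_iff)

lemma deg_B: "i \<in> T - T1 \<Longrightarrow> cc i s = B \<longleftrightarrow> int (d i) dvd s"
  using cc_dvd[of i s] cc_deg[of i] by simp

lemma deg_B': "i \<in> T - T1 \<Longrightarrow> 0 < s \<Longrightarrow> s < int (d i) \<Longrightarrow> cc i s \<noteq> B"
  using deg_B[of i s] zdvd_imp_le[of "int (d i)" s] by auto

lemma cc_shift: "i \<in> T \<Longrightarrow> cc i r = cc i s \<Longrightarrow> cc i (r + k) = cc i (s + k)"
  unfolding cc_eq_iff by (simp add: cong_add_rcancel)

definition sp :: "'v \<Rightarrow> 'i" where "sp u = (SOME i. i \<in> T \<and> u \<in> V i)"

lemma sp_eq: "i \<in> T \<Longrightarrow> u \<in> V i \<Longrightarrow> u \<noteq> B \<Longrightarrow> sp u = i"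
proof -
  assume i: "i \<in> T" "u \<in> V i" "u \<noteq> B"
  then have "\<exists>j. j \<in> T \<and> u \<in> V j" by blast
  then have "sp u \<in> T \<and> u \<in> V (sp u)" unfolding sp_def by (rule someI_ex)
  then show "sp u = i" using V_disjoint i by blast
qed

lemma cc_shift_m1: "i \<in> T \<Longrightarrow> cc i (r + 1) = cc i s \<Longrightarrow> cc i r = cc i (s - 1)"
  using cc_shift[of i "r + 1" s "- 1"] by simp

lemma succ_B:
  assumes "(B, v) \<in> E"
  shows "(\<exists>i\<in>T1. v = gp i 1) \<or> (\<exists>i\<in>T-T1. v = cc i 1)"
  using assms
proof (cases rule: arcE)
  case (out i t)
  then show ?thesis using gp_B[of i t] by auto
next
  case (inn i t)
  then show ?thesis using gm_B[of i t] by auto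
next
  case (rim i s)
  then show ?thesis using cc_B[of i s] by simp
next
  case (deg i s)
  then have "cc i s = cc i 0" using cc_deg by simp
  then have "cc i (s + 1) = cc i (0 + 1)" using deg(1) by (intro cc_shift) auto
  then show ?thesis using deg by auto
qed

lemma pred_B:
  assumes "(v, B) \<in> E"
  shows "(\<exists>i\<in>T1. v = gm i (q i - 1)) \<or> (\<exists>i\<in>T-T1. v = cc i (-1))"
  using assms
proof (cases rule: arcE)
  case (out i t)
  then show ?thesis using gp_B[of i "Suc t"] by auto
next
  case (inn i t)
  then have "Suc t = q i" using gm_B[of i "Suc t"] by auto
  then have "t = q i - 1" by simp
  then show ?thesis using inn(1,3) by blast
next
  case (rim i s)
  then show ?thesis using cc_B[of i "s + 1"] by simp
next
  case (deg i s)
  then have "cc i (s + 1) = cc i 0" using cc_deg by simp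
  then have "cc i s = cc i (0 - 1)" using deg(1) by (intro cc_shift_m1) auto
  then show ?thesis using deg by auto
qed

text \<open>The pattern for the other successor and predecessor lemmas away from \<open>B\<close>:
  an arc at a vertex other than \<open>B\<close> belongs to the spoke of that vertex by
  \<open>V_disjoint\<close>, and the intersection rules leave only the expected piece and
  index.\<close>

lemma succ_gp:
  assumes "(gp i t, v) \<in> E" and i: "i \<in> T1" and t: "0 < t" "t < p i"
  shows "v = gp i (Suc t)"
proof -
  have nB: "gp i t \<noteq> B" using gp_B[OF i, of t] t by auto
  have V: "gp i t \<in> V i" using gp_V i t by simp
  from assms(1) show ?thesis
  proof (cases rule: arcE)
    case (out j r)
    then have "i = j" using V_disjoint[OF _ _ V _ nB] T1D i gp_V by simp
    then show ?thesis using gp_inj[of i t r] out i t by simp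
  next
    case (inn j r)
    then have "i = j" using V_disjoint[OF _ _ V _ nB] T1D i gm_V by simp
    then show ?thesis using gp_gm[of i t r] inn i t by simp
  next
    case (rim j s)
    then have "i = j" using V_disjoint[OF _ _ V _ nB] T1D i cc_V by simp
    then show ?thesis using gp_cc[of i t s] rim i t by simp
  next
    case (deg j s)
    then have "i = j" using V_disjoint[OF _ _ V _ nB] T1D i cc_V by simp
    then show ?thesis using deg i by simp
  qed
qed

lemma pred_gp:
  assumes "(v, gp i t) \<in> E" and i: "i \<in> T1" and t: "0 < t" "t < p i"
  shows "v = gp i (t - 1)"
proof -
  have nB: "gp i t \<noteq> B" using gp_B[OF i, of t] t by auto
  have V: "gp i t \<in> V i" using gp_V i t by simp
  from assms(1) show ?thesis
  proof (cases rule: arcE)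
    case (out j r)
    then have "i = j" using V_disjoint[OF _ _ V _ nB] T1D i gp_V by simp
    then have "t = Suc r" using gp_inj[of i t "Suc r"] out i t by simp
    then show ?thesis using out \<open>i = j\<close> by simp
  next
    case (inn j r)
    then have "i = j" using V_disjoint[OF _ _ V _ nB] T1D i gm_V by simp
    then show ?thesis using gp_gm[of i t "Suc r"] inn i t by simp
  next
    case (rim j s)
    then have "i = j" using V_disjoint[OF _ _ V _ nB] T1D i cc_V by simp
    then show ?thesis using gp_cc[of i t "s + 1"] rim i t by simp
  next
    case (deg j s)
    then have "i = j" using V_disjoint[OF _ _ V _ nB] T1D i cc_V by simp
    then show ?thesis using deg i by simp
  qed
qed

lemma succ_gm:
  assumes "(gm i t, v) \<in> E" and i: "i \<in> T1" and t: "0 < t" "t < q i"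
  shows "v = gm i (Suc t)"
proof -
  have nB: "gm i t \<noteq> B" using gm_B[OF i, of t] t by auto
  have V: "gm i t \<in> V i" using gm_V i t by simp
  from assms(1) show ?thesis
  proof (cases rule: arcE)
    case (out j r)
    then have "i = j" using V_disjoint[OF _ _ V _ nB] T1D i gp_V by simp
    then show ?thesis using gp_gm[of i r t] out i t by simp
  next
    case (inn j r)
    then have "i = j" using V_disjoint[OF _ _ V _ nB] T1D i gm_V by simp
    then show ?thesis using gm_inj[of i t r] inn i t by simp
  next
    case (rim j s)
    then have "i = j" using V_disjoint[OF _ _ V _ nB] T1D i cc_V by simp
    then show ?thesis using gm_cc[of i t s] rim i t by simp
  next
    case (deg j s)
    then have "i = j" using V_disjoint[OF _ _ V _ nB] T1D i cc_V by simp
    then show ?thesis using deg i by simp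
  qed
qed

lemma pred_gm:
  assumes "(v, gm i t) \<in> E" and i: "i \<in> T1" and t: "0 < t" "t < q i"
  shows "v = gm i (t - 1)"
proof -
  have nB: "gm i t \<noteq> B" using gm_B[OF i, of t] t by auto
  have V: "gm i t \<in> V i" using gm_V i t by simp
  from assms(1) show ?thesis
  proof (cases rule: arcE)
    case (out j r)
    then have "i = j" using V_disjoint[OF _ _ V _ nB] T1D i gp_V by simp
    then show ?thesis using gp_gm[of i "Suc r" t] out i t by simp
  next
    case (inn j r)
    then have "i = j" using V_disjoint[OF _ _ V _ nB] T1D i gm_V by simp
    then have "t = Suc r" using gm_inj[of i t "Suc r"] inn i t by simp
    then show ?thesis using inn \<open>i = j\<close> by simp
  next
    case (rim j s)
    then have "i = j" using V_disjoint[OF _ _ V _ nB] T1D i cc_V by simp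
    then show ?thesis using gm_cc[of i t "s + 1"] rim i t by simp
  next
    case (deg j s)
    then have "i = j" using V_disjoint[OF _ _ V _ nB] T1D i cc_V by simp
    then show ?thesis using deg i by simp
  qed
qed

lemma succ_cc:
  assumes "(cc i s, v) \<in> E" and i: "i \<in> T1"
  shows "v = cc i (s + 1) \<or> int (d i) dvd s \<and> v = gm i 1"
proof -
  have nB: "cc i s \<noteq> B" using cc_B[OF i] .
  have V: "cc i s \<in> V i" using cc_V[OF T1D[OF i]] .
  from assms(1) show ?thesis
  proof (cases rule: arcE)
    case (out j r)
    then have "i = j" using V_disjoint[OF _ _ V _ nB] T1D i gp_V by simp
    then show ?thesis using gp_cc[of i r s] out i by simp
  next
    case (inn j r)
    then have "i = j" using V_disjoint[OF _ _ V _ nB] T1D i gm_V by simp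
    then have "r = 0" using gm_cc[of i r s] inn i by simp
    then show ?thesis using inn \<open>i = j\<close> gm_0[OF i] cc_dvd[OF T1D[OF i], of s] by simp
  next
    case (rim j r)
    then have "i = j" using V_disjoint[OF _ _ V _ nB] T1D i cc_V by simp
    then show ?thesis using cc_shift[OF T1D[OF i], of s r 1] rim by simp
  next
    case (deg j r)
    then have "i = j" using V_disjoint[OF _ _ V _ nB] T1D i cc_V by simp
    then show ?thesis using deg i by simp
  qed
qed

lemma pred_cc:
  assumes "(v, cc i s) \<in> E" and i: "i \<in> T1"
  shows "v = cc i (s - 1) \<or> int (d i) dvd s \<and> v = gp i (p i - 1)"
proof -
  have nB: "cc i s \<noteq> B" using cc_B[OF i] .
  have V: "cc i s \<in> V i" using cc_V[OF T1D[OF i]] .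
  from assms(1) show ?thesis
  proof (cases rule: arcE)
    case (out j r)
    then have "i = j" using V_disjoint[OF _ _ V _ nB] T1D i gp_V by simp
    then have r: "Suc r = p i" using gp_cc[of i "Suc r" s] out i by simp
    then have "cc i s = cc i 0" using out \<open>i = j\<close> gp_p[OF i] by simp
    moreover have "r = p i - 1" using r by simp
    ultimately show ?thesis using out \<open>i = j\<close> cc_dvd[OF T1D[OF i], of s] by simp
  next
    case (inn j r)
    then have "i = j" using V_disjoint[OF _ _ V _ nB] T1D i gm_V by simp
    then show ?thesis using gm_cc[of i "Suc r" s] inn i by simp
  next
    case (rim j r)
    then have "i = j" using V_disjoint[OF _ _ V _ nB] T1D i cc_V by simp
    then show ?thesis using cc_shift_m1[OF T1D[OF i], of r s] rim by simp
  next
    case (deg j r)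
    then have "i = j" using V_disjoint[OF _ _ V _ nB] T1D i cc_V by simp
    then show ?thesis using deg i by simp
  qed
qed

lemma succ_deg:
  assumes "(cc i s, v) \<in> E" and i: "i \<in> T - T1" and s: "0 < s" "s < int (d i)"
  shows "v = cc i (s + 1)"
proof -
  have nB: "cc i s \<noteq> B" using deg_B'[OF i s] .
  have iT: "i \<in> T" using i by simp
  have V: "cc i s \<in> V i" using cc_V[OF iT] .
  have no: False if "j \<in> T1" "cc i s \<in> V j" for j
    using V_disjoint[OF iT T1D[OF that(1)] V that(2) nB] that(1) i by simp
  from assms(1) show ?thesis
  proof (cases rule: arcE)
    case (out j r)
    then show ?thesis using no[of j] gp_V[of j "r"] by simp
  next
    case (inn j r)
    then show ?thesis using no[of j] gm_V[of j "r"] by simp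
  next
    case (rim j r)
    then show ?thesis using no[of j] cc_V[OF T1D, of j] by simp
  next
    case (deg j r)
    then have "i = j" using V_disjoint[OF iT _ V _ nB] cc_V by simp
    then show ?thesis using cc_shift[OF iT, of s r 1] deg by simp
  qed
qed

lemma pred_deg:
  assumes "(v, cc i s) \<in> E" and i: "i \<in> T - T1" and s: "0 < s" "s < int (d i)"
  shows "v = cc i (s - 1)"
proof -
  have nB: "cc i s \<noteq> B" using deg_B'[OF i s] .
  have iT: "i \<in> T" using i by simp
  have V: "cc i s \<in> V i" using cc_V[OF iT] .
  have no: False if "j \<in> T1" "cc i s \<in> V j" for j
    using V_disjoint[OF iT T1D[OF that(1)] V that(2) nB] that(1) i by simp
  from assms(1) show ?thesis
  proof (cases rule: arcE)
    case (out j r)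
    then show ?thesis using no[of j] gp_V[of j "Suc r"] by simp
  next
    case (inn j r)
    then show ?thesis using no[of j] gm_V[of j "Suc r"] by simp
  next
    case (rim j r)
    then show ?thesis using no[of j] cc_V[OF T1D, of j] by simp
  next
    case (deg j r)
    then have "i = j" using V_disjoint[OF iT _ V _ nB] cc_V by simp
    then show ?thesis using cc_shift_m1[OF iT, of r s] deg by simp
  qed
qed

lemma vertex:
  assumes "u \<in> Field E" and nB: "u \<noteq> B"
  shows "(\<exists>i\<in>T1. (\<exists>t. 0 < t \<and> t < p i \<and> u = gp i t) \<or> (\<exists>s. u = cc i s) \<or> (\<exists>t. 0 < t \<and> t < q i \<and> u = gm i t)) \<or>
      (\<exists>i\<in>T-T1. \<exists>s. 0 < s \<and> s < int (d i) \<and> u = cc i s)"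
proof -
  have gp: ?thesis if "i \<in> T1" "t \<le> p i" "u = gp i t" for i t
  proof (cases "t = p i")
    case True
    then show ?thesis using that gp_p by blast
  next
    case False
    moreover have "t \<noteq> 0" by (rule notI) (use that nB gp_0[of i] in simp)
    ultimately have "0 < t \<and> t < p i" using that by simp
    then show ?thesis using that by blast
  qed
  have gm: ?thesis if "i \<in> T1" "t \<le> q i" "u = gm i t" for i t
  proof (cases "t = 0")
    case True
    then show ?thesis using that gm_0 by blast
  next
    case False
    moreover have "t \<noteq> q i" by (rule notI) (use that nB gm_q[of i] in simp)
    ultimately have "0 < t \<and> t < q i" using that by simp
    then show ?thesis using that by blast
  qed
  have degenerate: ?thesis if i: "i \<in> T - T1" and u: "u = cc i s" for i s
  proof -
    have iT: "i \<in> T" using i by simp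
    \<comment> \<open>The index is reduced to one period, and 0 drops out because a degenerate
      circuit is at \<open>B\<close> there.\<close>
    define r where "r = s mod int (d i)"
    have "cc i r = cc i s" unfolding cc_eq_iff[OF iT] r_def by (simp add: cong_def)
    moreover have "r \<noteq> 0"
    proof
      assume "r = 0"
      then have "cc i s = B" unfolding deg_B[OF i] r_def by (rule mod_0_imp_dvd)
      then show False using nB u by simp
    qed
    moreover have "0 \<le> r" "r < int (d i)" using d_pos[OF iT] by (simp_all add: r_def)
    ultimately have "0 < r \<and> r < int (d i) \<and> u = cc i r" using u by simp
    then show ?thesis using i by blast
  qed
  obtain v where "(u, v) \<in> E \<or> (v, u) \<in> E" using assms(1) unfolding Field_def by blast
  then show ?thesis
  proof
    assume "(u, v) \<in> E"
    then show ?thesis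
    proof (cases rule: arcE)
      case (out i t) then show ?thesis by (intro gp[of i t]) simp_all
    next
      case (inn i t) then show ?thesis by (intro gm[of i t]) simp_all
    next
      case (rim i s) then show ?thesis by blast
    next
      case (deg i s) then show ?thesis by (intro degenerate[of i s])
    qed
  next
    assume "(v, u) \<in> E"
    then show ?thesis
    proof (cases rule: arcE)
      case (out i t) then show ?thesis by (intro gp[of i "Suc t"]) simp_all
    next
      case (inn i t) then show ?thesis by (intro gm[of i "Suc t"]) simp_all
    next
      case (rim i s) then show ?thesis by blast
    next
      case (deg i s) then show ?thesis by (intro degenerate[of i "s + 1"])
    qed
  qed
qed

lemma arcs_in_E:
  "i \<in> T1 \<Longrightarrow> t < p i \<Longrightarrow> (gp i t, gp i (Suc t)) \<in> E"
  "i \<in> T1 \<Longrightarrow> t < q i \<Longrightarrow> (gm i t, gm i (Suc t)) \<in> E"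
  "i \<in> T \<Longrightarrow> (cc i s, cc i (s + 1)) \<in> E"
  unfolding E_eq by blast+

lemma spokes: "spokes E B T T1 p q d gp gm cc sp"
proof
  show "finite T" "T1 \<subseteq> T" by (fact finite_T T1_subset)+
  fix i t assume i: "i \<in> T1"
  show "0 < t \<Longrightarrow> t \<le> p i \<Longrightarrow> gp i t \<noteq> B \<and> sp (gp i t) = i"
    using gp_B[OF i, of t] sp_eq[OF T1D[OF i] gp_V[OF i]] by blast
  show "t < q i \<Longrightarrow> gm i t \<noteq> B \<and> sp (gm i t) = i"
    using gm_B[OF i, of t] sp_eq[OF T1D[OF i] gm_V[OF i, of t]] by auto
  fix s show "cc i s \<noteq> B \<and> sp (cc i s) = i"
    using cc_B[OF i] sp_eq[OF T1D[OF i] cc_V[OF T1D[OF i]]] by blast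
next
  fix i s assume "i \<in> T - T1" "0 < s" "s < int (d i)"
  then show "cc i s \<noteq> B \<and> sp (cc i s) = i" using deg_B'[of i s] sp_eq[of i "cc i s"] cc_V[of i s] by simp
qed (fact d_pos p_pos q_pos gp_0 gp_p gm_0 gm_q cc_deg cc_eq_iff arcs_in_E succ_B succ_gp succ_cc
    succ_deg succ_gm pred_B pred_gp pred_cc pred_deg pred_gm vertex)+

end

section \<open>Gap lengths and residue classes\<close>

context spokes
begin

lemma gaplen_iff_cong:
  assumes i: "i \<in> T1"
  shows "gaplen i n \<longleftrightarrow> p i + q i - 1 \<le> n \<and> [n = p i + q i - 1] (mod d i)"
proof
  assume "gaplen i n"
  then obtain k where k: "n + 1 = p i + q i + k * d i" unfolding gaplen_regular[OF i] by blast
  then have n: "n = k * d i + (p i + q i - 1)" using p_pos[OF i] by linarith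
  show "p i + q i - 1 \<le> n \<and> [n = p i + q i - 1] (mod d i)"
    unfolding n cong_def mod_mult_self3 by (rule conjI[OF le_add2 refl])
next
  assume n: "p i + q i - 1 \<le> n \<and> [n = p i + q i - 1] (mod d i)"
  then obtain k where "n = k * d i + (p i + q i - 1)"
    using cong_le_nat[of "p i + q i - 1" n "d i"] by blast
  then have "n + 1 = p i + q i + k * d i" using p_pos[OF i] by linarith
  then show "gaplen i n" unfolding gaplen_regular[OF i] by blast
qed

text \<open>Beyond the largest offset \<open>M\<close>, the gap lengths of a spoke fill a residue
  class modulo \<open>d i\<close>, hence a union of classes modulo \<open>D\<close>. Every class
  modulo \<open>D\<close> has arbitrarily large members, so a statement about all large lengths is
  one about residues.\<close>

lemma splits_iff_residues:
  assumes D: "0 < D" "\<And>i. i \<in> T1 \<Longrightarrow> d i dvd D"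
    and K: "\<And>i. i \<in> T1 \<Longrightarrow> K i = {b \<in> {0..<D}. [b = p i + q i - 1] (mod d i)}"
  shows "splits W \<longleftrightarrow> W \<subseteq> T1 \<and> (\<Union>i\<in>W. K i) = (\<Union>i\<in>T1. K i) \<and> disjoint_family_on K W"
proof -
  define m where "m i = p i + q i - 1" for i
  have "finite T1" using T1_subset finite_T by (rule finite_subset)
  then obtain M where M: "\<And>i. i \<in> T1 \<Longrightarrow> m i \<le> M" using finite_nat_bound[of T1 m] by blast
  have gaplen: "gaplen i n \<longleftrightarrow> n mod D \<in> K i" if "i \<in> T1" "M \<le> n" for i n
  proof -
    have "n mod D mod d i = n mod d i" by (rule mod_mod_cancel[OF D(2)[OF that(1)]])
    then have "[n = m i] (mod d i) \<longleftrightarrow> [n mod D = m i] (mod d i)" by (simp only: cong_def)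
    moreover have "m i \<le> n" using M[OF that(1)] that(2) by linarith
    ultimately show ?thesis
      unfolding gaplen_iff_cong[OF that(1)] K[OF that(1)] m_def[symmetric] using D(1) by simp
  qed
  have large: "\<exists>n\<ge>N. n mod D = b" if "b < D" for N b
  proof (intro exI conjI)
    show "(b + N * D) mod D = b" using that by simp
    have "N * 1 \<le> N * D" using D(1) by (intro mult_le_mono2) simp
    then show "N \<le> b + N * D" by linarith
  qed
  show ?thesis
  proof
    assume "splits W"
    then obtain L where W: "W \<subseteq> T1"
      and L: "\<And>n. L \<le> n \<Longrightarrow> \<exists>i\<in>T1. gaplen i n \<Longrightarrow> \<exists>!j. j \<in> W \<and> gaplen j n"
      unfolding splits_def by blast
    have *: "\<exists>!j. j \<in> W \<and> b \<in> K j" if i: "i \<in> T1" and b: "b \<in> K i" for i b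
    proof -
      have "b < D" using b K[OF i] by simp
      then obtain n where n: "L + M \<le> n" "n mod D = b" using large by blast
      have "M \<le> n" "L \<le> n" using n(1) by simp_all
      have g: "gaplen j n \<longleftrightarrow> b \<in> K j" if "j \<in> T1" for j using gaplen[OF that \<open>M \<le> n\<close>] n(2) by simp
      have "\<exists>i\<in>T1. gaplen i n" using g[OF i] i b by blast
      from L[OF \<open>L \<le> n\<close> this] obtain j
        where j: "j \<in> W" "gaplen j n" and unique: "\<And>k. k \<in> W \<Longrightarrow> gaplen k n \<Longrightarrow> k = j" by blast
      show ?thesis
      proof (rule ex1I)
        show "j \<in> W \<and> b \<in> K j" using j g[of j] W by blast
        show "k = j" if "k \<in> W \<and> b \<in> K k" for k using unique[of k] g[of k] that W by blast
      qed
    qed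
    have "K i \<subseteq> (\<Union>j\<in>W. K j)" if "i \<in> T1" for i
    proof
      fix b assume "b \<in> K i"
      from *[OF that this] show "b \<in> (\<Union>j\<in>W. K j)" by blast
    qed
    then have "(\<Union>i\<in>T1. K i) \<subseteq> (\<Union>j\<in>W. K j)" by (rule UN_least)
    moreover have "(\<Union>j\<in>W. K j) \<subseteq> (\<Union>i\<in>T1. K i)" using W by blast
    moreover have "disjoint_family_on K W"
      unfolding disjoint_family_on_def
    proof (intro ballI impI equals0I)
      fix i j b assume ij: "i \<in> W" "j \<in> W" "i \<noteq> j" and b: "b \<in> K i \<inter> K j"
      then have "\<exists>!k. k \<in> W \<and> b \<in> K k" using *[of i b] W by blast
      then show False using ij b by blast
    qed
    ultimately show "W \<subseteq> T1 \<and> (\<Union>i\<in>W. K i) = (\<Union>i\<in>T1. K i) \<and> disjoint_family_on K W"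
      using W by (intro conjI subset_antisym)
  next
    assume A: "W \<subseteq> T1 \<and> (\<Union>i\<in>W. K i) = (\<Union>i\<in>T1. K i) \<and> disjoint_family_on K W"
    have "\<exists>!j. j \<in> W \<and> gaplen j n" if n: "M \<le> n" and i: "i \<in> T1" "gaplen i n" for n i
    proof -
      have "n mod D \<in> (\<Union>i\<in>T1. K i)" using gaplen[OF i(1) n] i by blast
      then obtain j where j: "j \<in> W" "n mod D \<in> K j" using A by blast
      then have "gaplen j n" using gaplen[of j n] n A by blast
      moreover have "k = j" if k: "k \<in> W" "gaplen k n" for k
      proof (rule ccontr)
        assume "k \<noteq> j"
        then have "K k \<inter> K j = {}" using A k(1) j(1) unfolding disjoint_family_on_def by blast
        moreover have "n mod D \<in> K k" using gaplen[of k n] n A k by blast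
        ultimately show False using j(2) by blast
      qed
      ultimately show ?thesis using j(1) by (intro ex1I[of _ j]) blast+
    qed
    then have "\<forall>n\<ge>M. (\<exists>i\<in>T1. gaplen i n) \<longrightarrow> (\<exists>!j. j \<in> W \<and> gaplen j n)" by blast
    then show "splits W" unfolding splits_def by (intro conjI exI) (rule A[THEN conjunct1])
  qed
qed

end

section \<open>Vertex sequences of paths and cycles\<close>

lemma length_pawalk_verts [simp]: "length (pawalk_verts u es) = Suc (length es)"
  by (induction es arbitrary: u) auto

lemma pcas_nth:
  "pcas u es v \<Longrightarrow> pawalk_verts u es ! 0 = u \<and> pawalk_verts u es ! length es = v \<and>
     (\<forall>t<length es. es ! t = (pawalk_verts u es ! t, pawalk_verts u es ! Suc t))"
proof (induction es arbitrary: u)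
  case (Cons e es)
  have IH: "pawalk_verts (snd e) es ! 0 = snd e" "pawalk_verts (snd e) es ! length es = v"
    "\<And>t. t < length es \<Longrightarrow> es ! t = (pawalk_verts (snd e) es ! t, pawalk_verts (snd e) es ! Suc t)"
    using Cons by auto
  have "(e # es) ! t = (pawalk_verts u (e # es) ! t, pawalk_verts u (e # es) ! Suc t)" if "t < length (e # es)" for t
    using that IH(1) IH(3)[of "t - 1"] by (cases t) auto
  then show ?case using Cons.prems IH(2) by simp
qed simp

lemma pcas_arcs:
  assumes "pcas u es v"
  shows "set es = (\<lambda>t. (pawalk_verts u es ! t, pawalk_verts u es ! Suc t)) ` {..<length es}"
proof -
  have "set es = (!) es ` {..<length es}" by (auto simp: set_conv_nth)
  also have "\<dots> = (\<lambda>t. (pawalk_verts u es ! t, pawalk_verts u es ! Suc t)) ` {..<length es}"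
    by (rule image_cong) (use pcas_nth[OF assms] in auto)
  finally show ?thesis .
qed

text \<open>The vertex list of a closed walk repeats its first entry at the end; reduction modulo
  the number of arcs never reads this last copy.\<close>

definition cyclic_vertex :: "'v \<Rightarrow> ('v \<times> 'v) list \<Rightarrow> int \<Rightarrow> 'v" where
  "cyclic_vertex u es s = pawalk_verts u es ! nat (s mod int (length es))"

locale closed_walk =
  fixes u :: 'v and es :: "('v \<times> 'v) list"
  assumes closed: "pcas u es u" and nonempty: "es \<noteq> []" and distinct_tl: "distinct (tl (pawalk_verts u es))"
begin

lemma ends: "pawalk_verts u es ! 0 = u" "pawalk_verts u es ! length es = u"
  using pcas_nth[OF closed] by auto

lemma nth_eq:
  assumes "s < length es" "t < length es" "pawalk_verts u es ! s = pawalk_verts u es ! t"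
  shows "s = t"
proof -
  define vs where "vs = pawalk_verts u es"
  \<comment> \<open>Distinctness is known for the tail of the vertex list, in which the base vertex
    occurs as the closing entry; \<open>h\<close> translates indices accordingly.\<close>
  define h where "h k = (if k = 0 then length es - 1 else k - 1)" for k
  have h: "vs ! k = tl vs ! h k" "h k < length (tl vs)" if "k < length es" for k
  proof -
    show "h k < length (tl vs)" using that by (auto simp: h_def vs_def)
    then have "tl vs ! h k = vs ! Suc (h k)" by (rule nth_tl)
    also have "\<dots> = vs ! k" using that ends by (cases "k = 0") (simp_all add: h_def vs_def)
    finally show "vs ! k = tl vs ! h k" by simp
  qed
  have "tl vs ! h s = tl vs ! h t"
    unfolding h(1)[OF assms(1), symmetric] h(1)[OF assms(2), symmetric] using assms(3) by (simp only: vs_def)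
  then have "h s = h t"
    using nth_eq_iff_index_eq[OF _ h(2)[OF assms(1)] h(2)[OF assms(2)]] distinct_tl unfolding vs_def by blast
  then show ?thesis using assms(1,2) by (auto simp: h_def split: if_splits)
qed

lemma length_pos: "0 < int (length es)" using nonempty by simp

lemma cyclic_index: "nat (s mod int (length es)) < length es"
  using pos_mod_bound[OF length_pos, of s] pos_mod_sign[OF length_pos, of s] by linarith

lemma cyclic_eq_iff: "cyclic_vertex u es r = cyclic_vertex u es s \<longleftrightarrow> [r = s] (mod int (length es))"
proof
  assume "cyclic_vertex u es r = cyclic_vertex u es s"
  then have "nat (r mod int (length es)) = nat (s mod int (length es))"
    unfolding cyclic_vertex_def by (rule nth_eq[OF cyclic_index cyclic_index])
  then show "[r = s] (mod int (length es))"
    using pos_mod_sign[OF length_pos, of r] pos_mod_sign[OF length_pos, of s] unfolding cong_def by linarith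
qed (simp add: cyclic_vertex_def cong_def)

lemma cyclic_0: "cyclic_vertex u es 0 = u"
  using ends by (simp add: cyclic_vertex_def)

lemma cyclic_Suc: "cyclic_vertex u es (s + 1) = pawalk_verts u es ! Suc (nat (s mod int (length es)))"
proof -
  define r where "r = nat (s mod int (length es))"
  have r: "s mod int (length es) = int r" "r < length es"
    using pos_mod_sign[OF length_pos, of s] cyclic_index[of s] unfolding r_def by simp_all
  have "(s + 1) mod int (length es) = (int r + 1) mod int (length es)" by (simp only: r(1)[symmetric] mod_add_left_eq)
  also have "\<dots> = int (Suc r mod length es)" by (simp only: zmod_int of_nat_Suc add.commute)
  finally have "cyclic_vertex u es (s + 1) = pawalk_verts u es ! (Suc r mod length es)"
    unfolding cyclic_vertex_def by (simp only: nat_int)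
  also have "\<dots> = pawalk_verts u es ! Suc r" using r(2) ends by (cases "Suc r = length es") auto
  finally show ?thesis unfolding r_def .
qed

lemma cyclic_in_verts: "cyclic_vertex u es s \<in> set (pawalk_verts u es)"
  using cyclic_index[of s] by (simp add: cyclic_vertex_def)

lemma cyclic_arcs: "set es = range (\<lambda>s. (cyclic_vertex u es s, cyclic_vertex u es (s + 1)))"
proof -
  have "range (\<lambda>s. (cyclic_vertex u es s, cyclic_vertex u es (s + 1))) =
      (\<lambda>t. (pawalk_verts u es ! t, pawalk_verts u es ! Suc t)) ` range (\<lambda>s. nat (s mod int (length es)))"
    unfolding cyclic_Suc image_image unfolding cyclic_vertex_def ..
  also have "range (\<lambda>s. nat (s mod int (length es))) = {..<length es}"
  proof
    show "range (\<lambda>s. nat (s mod int (length es))) \<subseteq> {..<length es}" using cyclic_index by auto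
    show "{..<length es} \<subseteq> range (\<lambda>s. nat (s mod int (length es)))"
    proof
      fix t assume "t \<in> {..<length es}"
      then have "t = nat (int t mod int (length es))" by simp
      then show "t \<in> range (\<lambda>s. nat (s mod int (length es)))" by (rule range_eqI)
    qed
  qed
  finally show ?thesis using pcas_arcs[OF closed] by simp
qed

end

lemma closed_walk_cycle:
  assumes "pre_digraph.cycle (with_proj G) es" "pre_digraph.awalk (with_proj G) u es u"
  shows "closed_walk u es"
proof
  show "pcas u es u" using assms(2) by (simp add: pre_digraph.awalk_def cas_with_proj_eq)
  obtain w where w: "distinct (tl (pawalk_verts w es))" and ne: "es \<noteq> []"
    using assms(1) unfolding pre_digraph.cycle_def awalk_verts_with_proj_eq by blast
  show "es \<noteq> []" by (rule ne)
  \<comment> \<open>A cycle is distinct with respect to some base \<open>w\<close>, but the vertex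
    list of a nonempty walk does not depend on the base argument.\<close>
  show "distinct (tl (pawalk_verts u es))" using w ne by (cases es) auto
qed

lemma apath_nth:
  assumes "pre_digraph.apath (with_proj G) u es v"
  shows "pcas u es v" "pawalk_verts u es ! 0 = u" "pawalk_verts u es ! length es = v"
    "s \<le> length es \<Longrightarrow> t \<le> length es \<Longrightarrow> pawalk_verts u es ! s = pawalk_verts u es ! t \<Longrightarrow> s = t"
proof -
  show c: "pcas u es v" using assms by (simp add: pre_digraph.apath_def pre_digraph.awalk_def cas_with_proj_eq)
  show "pawalk_verts u es ! 0 = u" "pawalk_verts u es ! length es = v" using pcas_nth[OF c] by auto
  have "distinct (pawalk_verts u es)"
    using assms by (simp add: pre_digraph.apath_def awalk_verts_with_proj_eq)
  then show "s \<le> length es \<Longrightarrow> t \<le> length es \<Longrightarrow> pawalk_verts u es ! s = pawalk_verts u es ! t \<Longrightarrow> s = t"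
    by (simp add: nth_eq_iff_index_eq)
qed

lemma spoke_graph_paths:
  assumes G: "spoke_graph G B T U"
  shows "spoke_paths (parcs G) B T (regular_indices G B T U)
    (\<lambda>i. length (out_path (U i))) (\<lambda>i. length (in_path (U i))) (\<lambda>i. length (circuit (U i)))
    (\<lambda>i t. pawalk_verts B (out_path (U i)) ! t) (\<lambda>i t. pawalk_verts (rim (U i)) (in_path (U i)) ! t)
    (\<lambda>i. cyclic_vertex (rim (U i)) (circuit (U i))) (\<lambda>i. spoke_verts B (U i))"
proof -
  let ?T1 = "regular_indices G B T U"
  have reg: "regular_spoke G B (U i)" if "i \<in> ?T1" for i using that by (simp add: regular_indices_def)
  have deg: "degenerate_spoke G B (U i)" if "i \<in> T - ?T1" for i
    using that G by (auto simp: regular_indices_def spoke_graph_def)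
  have cyc: "closed_walk (rim (U i)) (circuit (U i))" if "i \<in> T" for i
    using G that unfolding spoke_graph_def regular_spoke_def degenerate_spoke_def by (metis closed_walk_cycle)
  have out: "pre_digraph.apath (with_proj G) B (out_path (U i)) (rim (U i))" if "i \<in> ?T1" for i
    using reg[OF that] by (simp add: regular_spoke_def)
  have inn: "pre_digraph.apath (with_proj G) (rim (U i)) (in_path (U i)) B" if "i \<in> ?T1" for i
    using reg[OF that] by (simp add: regular_spoke_def)
  have ne: "rim (U i) \<noteq> B" if "i \<in> ?T1" for i using reg[OF that] by (simp add: regular_spoke_def)
  have meet: "set (pawalk_verts B (out_path (U i))) \<inter> set (pawalk_verts (rim (U i)) (in_path (U i))) = {B, rim (U i)}"
    "set (pawalk_verts B (out_path (U i))) \<inter> set (pawalk_verts (rim (U i)) (circuit (U i))) = {rim (U i)}"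
    "set (pawalk_verts (rim (U i)) (in_path (U i))) \<inter> set (pawalk_verts (rim (U i)) (circuit (U i))) = {rim (U i)}"
    if "i \<in> ?T1" for i
    using reg[OF that] by (simp_all add: regular_spoke_def)
  have sub: "?T1 \<subseteq> T" by (auto simp: regular_indices_def)
  show ?thesis
  proof
    show "finite T" using G by (simp add: spoke_graph_def)
    show "?T1 \<subseteq> T" by (rule sub)
    show "0 < length (circuit (U i))" if "i \<in> T" for i
      using closed_walk.nonempty[OF cyc[OF that]] by simp
    show "cyclic_vertex (rim (U i)) (circuit (U i)) r = cyclic_vertex (rim (U i)) (circuit (U i)) s \<longleftrightarrow>
        [r = s] (mod int (length (circuit (U i))))" if "i \<in> T" for i r s
      by (rule closed_walk.cyclic_eq_iff[OF cyc[OF that]])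
    show "cyclic_vertex (rim (U i)) (circuit (U i)) s \<in> spoke_verts B (U i)" if "i \<in> T" for i s
      using closed_walk.cyclic_in_verts[OF cyc[OF that]] by (simp add: spoke_verts_def)
    show "cyclic_vertex (rim (U i)) (circuit (U i)) 0 = B" if "i \<in> T - ?T1" for i
      using closed_walk.cyclic_0[OF cyc, of i] deg[OF that] that by (simp add: degenerate_spoke_def)
    show "i = j" if "i \<in> T" "j \<in> T" "u \<in> spoke_verts B (U i)" "u \<in> spoke_verts B (U j)" "u \<noteq> B" for i j u
    proof (rule ccontr)
      assume "i \<noteq> j"
      then have "spoke_verts B (U i) \<inter> spoke_verts B (U j) = {B}" using G that(1,2) by (simp add: spoke_graph_def)
      then show False using that by blast
    qed
  next
    fix i assume i: "i \<in> ?T1"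
    then have iT: "i \<in> T" using sub by blast
    note o = apath_nth[OF out[OF i]] and n = apath_nth[OF inn[OF i]]
    have c0: "cyclic_vertex (rim (U i)) (circuit (U i)) 0 = rim (U i)"
      by (rule closed_walk.cyclic_0[OF cyc[OF iT]])
    have in_out: "pawalk_verts B (out_path (U i)) ! t \<in> set (pawalk_verts B (out_path (U i)))"
      if "t \<le> length (out_path (U i))" for t using that by simp
    have in_in: "pawalk_verts (rim (U i)) (in_path (U i)) ! t \<in> set (pawalk_verts (rim (U i)) (in_path (U i)))"
      if "t \<le> length (in_path (U i))" for t using that by simp
    show "0 < length (out_path (U i))" using o(1) ne[OF i] by (cases "out_path (U i)") auto
    show "0 < length (in_path (U i))" using n(1) ne[OF i] by (cases "in_path (U i)") auto
    show "pawalk_verts B (out_path (U i)) ! 0 = B" by (rule o(2))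
    show "pawalk_verts B (out_path (U i)) ! length (out_path (U i)) = cyclic_vertex (rim (U i)) (circuit (U i)) 0"
      unfolding c0 by (rule o(3))
    show "pawalk_verts (rim (U i)) (in_path (U i)) ! 0 = cyclic_vertex (rim (U i)) (circuit (U i)) 0"
      unfolding c0 by (rule n(2))
    show "pawalk_verts (rim (U i)) (in_path (U i)) ! length (in_path (U i)) = B" by (rule n(3))
    show "pawalk_verts B (out_path (U i)) ! t \<in> spoke_verts B (U i)" if "t \<le> length (out_path (U i))" for t
      using in_out[OF that] by (simp add: spoke_verts_def)
    show "pawalk_verts (rim (U i)) (in_path (U i)) ! t \<in> spoke_verts B (U i)" if "t \<le> length (in_path (U i))" for t
      using in_in[OF that] by (simp add: spoke_verts_def)
    show "t = t'" if "pawalk_verts B (out_path (U i)) ! t = pawalk_verts B (out_path (U i)) ! t'"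
      "t \<le> length (out_path (U i))" "t' \<le> length (out_path (U i))" for t t'
      by (rule o(4)[OF that(2,3,1)])
    show "t = t'" if "pawalk_verts (rim (U i)) (in_path (U i)) ! t = pawalk_verts (rim (U i)) (in_path (U i)) ! t'"
      "t \<le> length (in_path (U i))" "t' \<le> length (in_path (U i))" for t t'
      by (rule n(4)[OF that(2,3,1)])
    show "t = 0 \<and> t' = length (in_path (U i)) \<or> t = length (out_path (U i)) \<and> t' = 0"
      if eq: "pawalk_verts B (out_path (U i)) ! t = pawalk_verts (rim (U i)) (in_path (U i)) ! t'"
        and t: "t \<le> length (out_path (U i))" "t' \<le> length (in_path (U i))" for t t'
    proof -
      have "pawalk_verts B (out_path (U i)) ! t \<in> {B, rim (U i)}"
        using in_out[OF t(1)] in_in[OF t(2)] eq meet(1)[OF i] by auto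
      then consider "pawalk_verts B (out_path (U i)) ! t = B" | "pawalk_verts B (out_path (U i)) ! t = rim (U i)" by blast
      then show ?thesis
      proof cases
        case 1
        then have "t = 0" "t' = length (in_path (U i))"
          using o(4)[OF t(1), of 0] o(2) n(4)[OF t(2), of "length (in_path (U i))"] n(3) eq by simp_all
        then show ?thesis by blast
      next
        case 2
        then have "t = length (out_path (U i))" "t' = 0"
          using o(4)[OF t(1), of "length (out_path (U i))"] o(3) n(4)[OF t(2), of 0] n(2) eq by simp_all
        then show ?thesis by blast
      qed
    qed
    show "t = length (out_path (U i))"
      if eq: "pawalk_verts B (out_path (U i)) ! t = cyclic_vertex (rim (U i)) (circuit (U i)) s"
        and t: "t \<le> length (out_path (U i))" for t s
    proof -
      have "pawalk_verts B (out_path (U i)) ! t = rim (U i)"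
        using in_out[OF t] closed_walk.cyclic_in_verts[OF cyc[OF iT], of s] eq meet(2)[OF i] by auto
      then show ?thesis using o(4)[OF t, of "length (out_path (U i))"] o(3) by simp
    qed
    show "t = 0"
      if eq: "pawalk_verts (rim (U i)) (in_path (U i)) ! t = cyclic_vertex (rim (U i)) (circuit (U i)) s"
        and t: "t \<le> length (in_path (U i))" for t s
    proof -
      have "pawalk_verts (rim (U i)) (in_path (U i)) ! t = rim (U i)"
        using in_in[OF t] closed_walk.cyclic_in_verts[OF cyc[OF iT], of s] eq meet(3)[OF i] by auto
      then show ?thesis using n(4)[OF t, of 0] n(2) by simp
    qed
  next
    have c: "set (circuit (U i)) = range (\<lambda>s. (cyclic_vertex (rim (U i)) (circuit (U i)) s,
        cyclic_vertex (rim (U i)) (circuit (U i)) (s + 1)))" if "i \<in> T" for i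
      by (rule closed_walk.cyclic_arcs[OF cyc[OF that]])
    have empty: "set (out_path (U i)) \<union> set (in_path (U i)) = {}" if "i \<in> T - ?T1" for i
      using deg[OF that] by (simp add: degenerate_spoke_def)
    have "parcs G = (\<Union>i\<in>T. spoke_arcs (U i))" using G by (simp add: spoke_graph_def)
    also have "\<dots> = (\<Union>i\<in>T. set (out_path (U i)) \<union> set (in_path (U i))) \<union> (\<Union>i\<in>T. set (circuit (U i)))"
      by (simp only: spoke_arcs_def UN_Un_distrib)
    \<comment> \<open>Degenerate spokes have empty paths, so only regular spokes contribute path
      arcs.\<close>
    also have "(\<Union>i\<in>T. set (out_path (U i)) \<union> set (in_path (U i))) =
        (\<Union>i\<in>?T1. set (out_path (U i)) \<union> set (in_path (U i)))"
    proof (intro equalityI UN_least)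
      fix i assume "i \<in> T"
      show "set (out_path (U i)) \<union> set (in_path (U i)) \<subseteq>
          (\<Union>i\<in>?T1. set (out_path (U i)) \<union> set (in_path (U i)))"
      proof (cases "i \<in> ?T1")
        case True
        then show ?thesis by (rule UN_upper)
      qed (use empty[of i] \<open>i \<in> T\<close> in simp)
    next
      fix i assume "i \<in> ?T1"
      then have "i \<in> T" using sub by (rule subsetD[rotated])
      then show "set (out_path (U i)) \<union> set (in_path (U i)) \<subseteq>
          (\<Union>i\<in>T. set (out_path (U i)) \<union> set (in_path (U i)))" by (rule UN_upper)
    qed
    also have "\<dots> = (\<Union>i\<in>?T1. (\<lambda>t. (pawalk_verts B (out_path (U i)) ! t, pawalk_verts B (out_path (U i)) ! Suc t)) `
          {..<length (out_path (U i))} \<union>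
        (\<lambda>t. (pawalk_verts (rim (U i)) (in_path (U i)) ! t, pawalk_verts (rim (U i)) (in_path (U i)) ! Suc t)) `
          {..<length (in_path (U i))})"
      by (rule SUP_cong[OF refl]) (simp only: pcas_arcs[OF apath_nth(1)[OF out]] pcas_arcs[OF apath_nth(1)[OF inn]])
    also have "(\<Union>i\<in>T. set (circuit (U i))) = (\<Union>i\<in>T. range (\<lambda>s. (cyclic_vertex (rim (U i)) (circuit (U i)) s,
        cyclic_vertex (rim (U i)) (circuit (U i)) (s + 1))))"
      by (rule SUP_cong[OF refl c])
    finally show "parcs G = (\<Union>i\<in>?T1. (\<lambda>t. (pawalk_verts B (out_path (U i)) ! t, pawalk_verts B (out_path (U i)) ! Suc t)) `
          {..<length (out_path (U i))} \<union>
        (\<lambda>t. (pawalk_verts (rim (U i)) (in_path (U i)) ! t, pawalk_verts (rim (U i)) (in_path (U i)) ! Suc t)) `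
          {..<length (in_path (U i))}) \<union>
        (\<Union>i\<in>T. range (\<lambda>s. (cyclic_vertex (rim (U i)) (circuit (U i)) s,
          cyclic_vertex (rim (U i)) (circuit (U i)) (s + 1))))" .
  qed
qed

theorem theorem8p1:
  fixes G :: "'v pair_pre_digraph" and B :: 'v
    and T :: "'i set" and U :: "'i \<Rightarrow> 'v spoke"
  assumes "spoke_graph G B T U"
  defines "T1 \<equiv> regular_indices G B T U"
    and "\<phi> \<equiv> one_block_code (standard_symbol B)"
  shows
    "((\<exists>W\<subseteq>T1. (\<Union>i\<in>W. residue_set T1 U i) = (\<Union>i\<in>T1. residue_set T1 U i) \<and>
          disjoint_family_on (residue_set T1 U) W) \<longleftrightarrow>
      (\<exists>Z\<subseteq>vertex_shift G. SFT (pverts G) Z \<and> irreducible_shift Z \<and>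
          almost_invertible_on (pverts G) (standard_symbol B) Z \<and>
          \<phi> ` Z = standard_image G B)) \<and>
     ((\<exists>Z\<subseteq>vertex_shift G. SFT (pverts G) Z \<and> irreducible_shift Z \<and>
          almost_invertible_on (pverts G) (standard_symbol B) Z \<and>
          \<phi> ` Z = standard_image G B) \<longleftrightarrow>
      (\<exists>Z\<subseteq>vertex_shift G. SFT (pverts G) Z \<and> irreducible_shift Z \<and>
          finite_to_one_on \<phi> Z \<and>
          \<phi> ` Z = standard_image G B))"
    (is "(?P1 \<longleftrightarrow> ?P2) \<and> (?P2 \<longleftrightarrow> ?P3)")
proof -
  let ?p = "\<lambda>i. length (out_path (U i))" and ?q = "\<lambda>i. length (in_path (U i))"
    and ?d = "\<lambda>i. length (circuit (U i))"
  interpret paths: spoke_paths "parcs G" B T T1 ?p ?q ?d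
    "\<lambda>i t. pawalk_verts B (out_path (U i)) ! t" "\<lambda>i t. pawalk_verts (rim (U i)) (in_path (U i)) ! t"
    "\<lambda>i. cyclic_vertex (rim (U i)) (circuit (U i))" "\<lambda>i. spoke_verts B (U i)"
    unfolding T1_def by (rule spoke_graph_paths[OF assms(1)])
  interpret spokes "parcs G" B T T1 ?p ?q ?d
    "\<lambda>i t. pawalk_verts B (out_path (U i)) ! t" "\<lambda>i t. pawalk_verts (rim (U i)) (in_path (U i)) ! t"
    "\<lambda>i. cyclic_vertex (rim (U i)) (circuit (U i))" paths.sp
    by (rule paths.spokes)
  interpret pair_fin_digraph G using assms(1) by (simp add: spoke_graph_def)
  have walks: "vertex_shift G = walks (parcs G)" by (simp add: vertex_shift_def walks_def)
  have image: "standard_image G B = \<phi> ` walks (parcs G)" by (simp add: standard_image_def \<phi>_def walks)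
  have fin: "finite (pverts G)" by (rule pair_finite_verts)
  have field: "Field (parcs G) \<subseteq> pverts G" using in_arcsD1 in_arcsD2 by (auto simp: Field_def)
  have T: "T \<noteq> {}" using assms(1) by (simp add: spoke_graph_def)
  have "finite T1" by (rule finite_subset[OF T1_subset finite_T])
  moreover have "?d i \<noteq> 0" if "i \<in> T1" for i using d_pos[OF T1D[OF that]] by simp
  \<comment> \<open>\<open>Lcm\<close> of a finite set is 0 only if 0 is a member, and circuits are
    nonempty.\<close>
  ultimately have D: "0 < common_period T1 U"
    unfolding common_period_def spoke_period_def by (intro gr0I) (auto simp: Lcm_0_iff)
  have "splits W \<longleftrightarrow> W \<subseteq> T1 \<and> (\<Union>i\<in>W. residue_set T1 U i) = (\<Union>i\<in>T1. residue_set T1 U i) \<and>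
      disjoint_family_on (residue_set T1 U) W" for W
  proof (rule splits_iff_residues[OF D])
    show "?d i dvd common_period T1 U" if "i \<in> T1" for i
      unfolding common_period_def spoke_period_def using that by (intro dvd_Lcm) simp
  qed (simp add: residue_set_def spoke_offset_def spoke_period_def)
  then have P1: "?P1 \<longleftrightarrow> (\<exists>W. splits W)" by (simp only:)
  have P2: ?P2 if "\<exists>W. splits W"
  proof -
    from that obtain W where "splits W" ..
    from splits_imp_almost_invertible[OF this T fin field]
    show ?thesis unfolding walks image \<phi>_def .
  qed
  have P3: ?P3 if ?P2
    using that unfolding almost_invertible_on_def \<phi>_def by (elim exE conjE) (intro exI conjI)
  have splits: "\<exists>W. splits W" if ?P3
  proof -
    from that obtain Z where "Z \<subseteq> walks (parcs G)" "SFT (pverts G) Z" "finite_to_one_on \<phi> Z"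
      "\<phi> ` Z = \<phi> ` walks (parcs G)"
      unfolding walks image by (elim exE conjE)
    then show ?thesis using finite_to_one_splits[OF _ fin] unfolding \<phi>_def by (simp only:)
  qed
  show ?thesis unfolding P1
  proof (intro conjI iffI)
    show "\<exists>W. splits W" if ?P2 by (rule splits[OF P3[OF that]])
    show ?P2 if ?P3 by (rule P2[OF splits[OF that]])
  qed (fact P2 P3)+
qed

end
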